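(* Let $g_1,\dots,g_N$ be distinct functions in $L^2(\mathbb{R})$ and let $\Lambda_1,\dots,\Lambda_N\subset\mathbb{R}^2$ all be uniformly discrete. \begin{enumerate} \item If $\bigcup_{n=1}^N G(g_n,\Lambda_n)$ is a Riesz sequence in $L^2(\mathbb{R})$, then $D^+(\{\Lambda_n\})\le 1$. \item If $\bigcup_{n=1}^N G(g_n,\Lambda_n)$ is a frame in $L^2(\mathbb{R})$, then $D^-(\{\Lambda_n\})\ge 1$. \end{enumerate}
   Context: For $g\in L^2(\mathbb{R})$ and $(a,b)\in\mathbb{R}^2$ put $g_{ab}(t)=e^{2\pi i b t}g(t-a)$. The Gabor system is $G(g,\Lambda)=\{g_{\lambda\mu}\}_{(\lambda,\mu)\in\Lambda}$. $Q_{(a,b)}(R)=\{(x,y):|x-a|\le R,\ |y-b|\le R\}$. A set is uniformly discrete if distinct points are at distance greater than some $\delta>0$. The upper and lower densities of the family are \[ D^{+}(\{\Lambda_n\})=\lim_{R\to\infty}\frac{\max_{(a,b)\in\mathbb{R}^2}\sum_{n=1}^N|\Lambda_n\cap Q_{(a,b)}(R)|}{(2R)^2},\qquad D^{-}(\{\Lambda_n\})=\lim_{R\to\infty}\frac{\min_{(a,b)\in\mathbb{R}^2}\sum_{n=1}^N|\Lambda_n\cap Q_{(a,b)}(R)|}{(2R)^2}. \] These limits exist for uniformly discrete families. Riesz sequence: $A\sum|a_k|^2\le\|\sum a_kf_k\|^2\le B\sum|a_k|^2$ for some $A,B>0$. Frame: $A\|f\|^2\le\sum|\langle f,f_k\rangle|^2\le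 B\|f\|^2$ for some $A,B>0$. *)

theory Defs
  imports "HOL-Analysis.Analysis"
begin

definition L2 :: "(real \<Rightarrow> complex) set" where
  "L2 = {f. f \<in> borel_measurable lborel \<and> integrable lborel (\<lambda>t. (cmod (f t))\<^sup>2)}"

definition L2_normsq :: "(real \<Rightarrow> complex) \<Rightarrow> real" where
  "L2_normsq f = (LINT t|lborel. (cmod (f t))\<^sup>2)"

definition L2_inner :: "(real \<Rightarrow> complex) \<Rightarrow> (real \<Rightarrow> complex) \<Rightarrow> complex" where
  "L2_inner f h = (LINT t|lborel. f t * cnj (h t))"

definition tf_shift :: "(real \<Rightarrow> complex) \<Rightarrow> real \<Rightarrow> real \<Rightarrow> real \<Rightarrow> complex" where
  "tf_shift g a b = (\<lambda>t. exp (2 * complex_of_real pi * \<i> * complex_of_real (b * t)) * g (t - a))"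

definition riesz_sequence :: "'i set \<Rightarrow> ('i \<Rightarrow> real \<Rightarrow> complex) \<Rightarrow> bool" where
  "riesz_sequence I f \<longleftrightarrow> (\<exists>A B. A > 0 \<and> B > 0 \<and>
     (\<forall>F c. finite F \<longrightarrow> F \<subseteq> I \<longrightarrow>
        A * (\<Sum>k\<in>F. (cmod (c k))\<^sup>2) \<le> L2_normsq (\<lambda>t. \<Sum>k\<in>F. c k * f k t) \<and>
        L2_normsq (\<lambda>t. \<Sum>k\<in>F. c k * f k t) \<le> B * (\<Sum>k\<in>F. (cmod (c k))\<^sup>2)))"

definition frame :: "'i set \<Rightarrow> ('i \<Rightarrow> real \<Rightarrow> complex) \<Rightarrow> bool" where
  "frame I f \<longleftrightarrow> (\<exists>A B. A > 0 \<and> B > 0 \<and>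
     (\<forall>h\<in>L2. (\<lambda>k. (cmod (L2_inner h (f k)))\<^sup>2) summable_on I \<and>
        A * L2_normsq h \<le> (\<Sum>\<^sub>\<infinity>k\<in>I. (cmod (L2_inner h (f k)))\<^sup>2) \<and>
        (\<Sum>\<^sub>\<infinity>k\<in>I. (cmod (L2_inner h (f k)))\<^sup>2) \<le> B * L2_normsq h))"

definition uniformly_discrete :: "(real \<times> real) set \<Rightarrow> bool" where
  "uniformly_discrete S \<longleftrightarrow> (\<exists>\<delta>>0. \<forall>x\<in>S. \<forall>y\<in>S. x \<noteq> y \<longrightarrow> dist x y > \<delta>)"

definition square :: "real \<times> real \<Rightarrow> real \<Rightarrow> (real \<times> real) set" where
  "square p R = {(x, y). \<bar>x - fst p\<bar> \<le> R \<and> \<bar>y - snd p\<bar> \<le> R}"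

definition count_in :: "nat \<Rightarrow> (nat \<Rightarrow> (real \<times> real) set) \<Rightarrow> real \<times> real \<Rightarrow> real \<Rightarrow> real" where
  "count_in N \<Lambda> p R = (\<Sum>n=1..N. real (card (\<Lambda> n \<inter> square p R)))"

definition upper_density :: "nat \<Rightarrow> (nat \<Rightarrow> (real \<times> real) set) \<Rightarrow> real" where
  "upper_density N \<Lambda> = Lim at_top (\<lambda>R. (SUP p. count_in N \<Lambda> p R) / (2 * R)\<^sup>2)"

definition lower_density :: "nat \<Rightarrow> (nat \<Rightarrow> (real \<times> real) set) \<Rightarrow> real" where
  "lower_density N \<Lambda> = Lim at_top (\<lambda>R. (INF p. count_in N \<Lambda> p R) / (2 * R)\<^sup>2)"

definition gabor_index :: "nat \<Rightarrow> (nat \<Rightarrow> (real \<times> real) set) \<Rightarrow> (nat \<times> (real \<times> real)) set" where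
  "gabor_index N \<Lambda> = {(n, p). n \<in> {1..N} \<and> p \<in> \<Lambda> n}"

definition gabor_family :: "(nat \<Rightarrow> real \<Rightarrow> complex) \<Rightarrow> nat \<times> (real \<times> real) \<Rightarrow> real \<Rightarrow> complex" where
  "gabor_family g k = tf_shift (g (fst k)) (fst (snd k)) (snd (snd k))"

end

(*
  Both parts compare the Gabor system with the orthonormal basis E of time-frequency shifts of the
  indicator of [0,1) along the integer lattice.  Let F be a system with lower frame bound A and H a
  system with a lower Riesz bound, and suppose that every element of H located in a square Q(R) has
  coefficients of small square sum against the elements of F located outside Q(R + r).  On the
  coefficient vectors of the elements of H in Q(R) that annihilate F in Q(R + r), a space of dimension
  at least #H - #F, the lower bounds together with a trace estimate leave room only for a small multiple
  of #H; hence #H in Q(R) is at most (1 + o(1)) #F in Q(R + r).  Part 1 takes F = E, part 2 takes H = E.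

  The smallness of the coefficients, uniform in the position of the square (Ramanathan and Steger's
  homogeneous approximation property), holds for arbitrary windows: by L2-approximation it reduces to
  C^1 windows with Lipschitz derivative and compact support, whose shifts along a separated set form a
  Bessel family by Schur's test.
*)

theory Submission
  imports Defs
begin

section \<open>Inner product and time-frequency shifts on L2\<close>

text \<open>The difficulty is that one radius \<open>r\<close> must serve every position of the
  square although the windows are merely in L2. Two facts make this possible. The modulus of an
  inner product of two shifts depends only on the difference of their positions, so the square can
  be moved to the origin at the cost of reflecting the point set, which keeps its separation. And
  replacing the window of H by an approximation perturbs all coefficient sums at once, by the Bessel
  bound of F: that of E in part 1, the upper frame bound in part 2. Since \<open>r\<close> stays
  fixed while \<open>R\<close> grows, the squares of radius \<open>R\<close> and
  \<open>R + r\<close> have the same area to leading order; the value 1 in the theorem is the number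
  of integer lattice points per unit area. The densities are values of \<open>Lim\<close>, which
  carry no information until the limits are known to exist; sub- and superadditivity of the extremal
  counts supply this.\<close>

lemma L2_D: "f \<in> L2 \<Longrightarrow> f \<in> borel_measurable lborel" "f \<in> L2 \<Longrightarrow> integrable lborel (\<lambda>t. (cmod (f t))\<^sup>2)"
  by (auto simp: L2_def)

lemma norm_add_sq_le: "(norm (a + b))\<^sup>2 \<le> 2 * (norm a)\<^sup>2 + 2 * (norm (b :: 'a :: real_normed_vector))\<^sup>2"
proof -
  have "(norm (a + b))\<^sup>2 \<le> (norm a + norm b)\<^sup>2"
    by (simp add: norm_triangle_ineq power_mono)
  also have "\<dots> \<le> 2 * (norm a)\<^sup>2 + 2 * (norm b)\<^sup>2"
    using sum_squares_bound[of "norm a" "norm b"] by (simp add: power2_sum)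
  finally show ?thesis .
qed

lemma L2_add [intro]: assumes "f \<in> L2" "h \<in> L2" shows "(\<lambda>t. f t + h t) \<in> L2"
proof -
  note [measurable] = L2_D(1)[OF assms(1)] L2_D(1)[OF assms(2)]
  have "integrable lborel (\<lambda>t. (cmod (f t + h t))\<^sup>2)"
    by (rule Bochner_Integration.integrable_bound[where f = "\<lambda>t. 2 * (cmod (f t))\<^sup>2 + 2 * (cmod (h t))\<^sup>2"])
       (use L2_D(2) assms norm_add_sq_le in auto)
  then show ?thesis by (simp add: L2_def)
qed

lemma L2_scale [intro]: assumes "f \<in> L2" shows "(\<lambda>t. c * f t) \<in> L2"
  using assms by (auto simp: L2_def norm_mult power_mult_distrib)

lemma L2_zero [simp, intro]: "(\<lambda>t. 0) \<in> L2"
  by (simp add: L2_def)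

lemma L2_diff [intro]: assumes "f \<in> L2" "h \<in> L2" shows "(\<lambda>t. f t - h t) \<in> L2"
  using L2_add[OF assms(1) L2_scale[OF assms(2), of "-1"]] by simp

lemma L2_sum [intro]: assumes "\<And>k. k \<in> F \<Longrightarrow> f k \<in> L2" shows "(\<lambda>t. \<Sum>k\<in>F. f k t) \<in> L2"
  using assms by (induction F rule: infinite_finite_induct) auto

lemma L2_inner_integrable:
  assumes "f \<in> L2" "h \<in> L2" shows "integrable lborel (\<lambda>t. f t * cnj (h t))"
proof -
  note [measurable] = L2_D(1)[OF assms(1)] L2_D(1)[OF assms(2)]
  have [measurable]: "cnj \<in> borel_measurable borel"
    by (intro borel_measurable_continuous_onI continuous_intros)
  show ?thesis
  proof (rule Bochner_Integration.integrable_bound[where f = "\<lambda>t. (cmod (f t))\<^sup>2 + (cmod (h t))\<^sup>2"])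
    show "AE x in lborel. norm (f x * cnj (h x)) \<le> norm ((cmod (f x))\<^sup>2 + (cmod (h x))\<^sup>2)"
    proof (intro AE_I2)
      fix x
      have "0 \<le> cmod (f x) * cmod (h x)" by simp
      then show "norm (f x * cnj (h x)) \<le> norm ((cmod (f x))\<^sup>2 + (cmod (h x))\<^sup>2)"
        using sum_squares_bound[of "cmod (f x)" "cmod (h x)"]
        unfolding norm_mult complex_mod_cnj real_norm_def by linarith
    qed
  qed (use L2_D(2) assms in auto)
qed

lemma L2_inner_add_left:
  "f \<in> L2 \<Longrightarrow> g \<in> L2 \<Longrightarrow> h \<in> L2 \<Longrightarrow> L2_inner (\<lambda>t. f t + g t) h = L2_inner f h + L2_inner g h"
  by (simp add: L2_inner_def distrib_right L2_inner_integrable)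

lemma L2_inner_scale_left: "L2_inner (\<lambda>t. c * f t) h = c * L2_inner f h"
  by (simp add: L2_inner_def mult.assoc)

lemma L2_inner_commute: "L2_inner h f = cnj (L2_inner f h)"
  unfolding L2_inner_def Bochner_Integration.integral_cnj[symmetric] by (simp add: mult.commute)

lemma L2_inner_sum_left:
  "(\<And>k. k \<in> F \<Longrightarrow> f k \<in> L2) \<Longrightarrow> h \<in> L2 \<Longrightarrow>
     L2_inner (\<lambda>t. \<Sum>k\<in>F. c k * f k t) h = (\<Sum>k\<in>F. c k * L2_inner (f k) h)"
proof (induction F rule: infinite_finite_induct)
  case (insert x F)
  have "(\<lambda>t. \<Sum>k\<in>F. c k * f k t) \<in> L2" by (rule L2_sum) (use insert.prems in auto)
  then show ?case
    using insert by (simp add: L2_inner_add_left L2_scale L2_inner_scale_left)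
qed (simp_all add: L2_inner_def)

lemma L2_inner_sum_right:
  assumes "\<And>k. k \<in> F \<Longrightarrow> f k \<in> L2" "h \<in> L2"
  shows "L2_inner h (\<lambda>t. \<Sum>k\<in>F. c k * f k t) = (\<Sum>k\<in>F. cnj (c k) * L2_inner h (f k))"
  by (subst L2_inner_commute) (simp add: L2_inner_sum_left assms L2_inner_commute[of h] cnj_sum)

lemma L2_inner_self: "L2_inner f f = of_real (L2_normsq f)"
  unfolding L2_inner_def L2_normsq_def complex_norm_square[symmetric] of_real_power[symmetric]
  by (rule integral_complex_of_real)

lemma L2_normsq_nonneg [simp]: "L2_normsq f \<ge> 0"
  by (simp add: L2_normsq_def)

lemma L2_normsq_scale: "L2_normsq (\<lambda>t. c * f t) = (cmod c)\<^sup>2 * L2_normsq f"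
  by (simp add: L2_normsq_def norm_mult power_mult_distrib)

lemma L2_normsq_add_le:
  assumes "f \<in> L2" "h \<in> L2"
  shows "L2_normsq (\<lambda>t. f t + h t) \<le> 2 * L2_normsq f + 2 * L2_normsq h"
proof -
  have "L2_normsq (\<lambda>t. f t + h t) \<le> (LINT t|lborel. 2 * (cmod (f t))\<^sup>2 + 2 * (cmod (h t))\<^sup>2)"
    unfolding L2_normsq_def
    by (intro integral_mono) (use L2_D(2)[OF L2_add[OF assms]] L2_D(2) assms norm_add_sq_le in auto)
  also have "\<dots> = 2 * L2_normsq f + 2 * L2_normsq h"
    by (simp add: L2_normsq_def L2_D(2) assms)
  finally show ?thesis .
qed

lemma L2_normsq_diff:
  assumes "f \<in> L2" "h \<in> L2"
  shows "L2_normsq (\<lambda>t. f t - h t) = L2_normsq f - 2 * Re (L2_inner f h) + L2_normsq h"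
proof -
  have "(\<lambda>t. (cmod (f t - h t))\<^sup>2) = (\<lambda>t. (cmod (f t))\<^sup>2 - 2 * Re (f t * cnj (h t)) + (cmod (h t))\<^sup>2)"
    unfolding cmod_power2 by (auto simp: power2_eq_square algebra_simps)
  then show ?thesis
    unfolding L2_normsq_def L2_inner_def
    by (simp add: L2_D(2) assms L2_inner_integrable del: times_complex.sel)
qed

section \<open>Time-frequency shifts as isometries, and their covariance\<close>

lemma cmod_tf [simp]: "cmod (exp (2 * complex_of_real pi * \<i> * complex_of_real x)) = 1"
  by (simp add: norm_exp_eq_Re)

lemma L2_tf [intro]: assumes "f \<in> L2" shows "tf_shift f a b \<in> L2"
proof -
  have [measurable]: "f \<in> borel_measurable borel" using assms by (auto simp: L2_def)
  have "integrable lborel (\<lambda>t. (cmod (f (-a + 1 * t)))\<^sup>2)"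
    by (rule lborel_integrable_real_affine[OF L2_D(2)[OF assms]]) simp
  then show ?thesis by (auto simp: L2_def tf_shift_def norm_mult)
qed

lemma L2_normsq_tf: "L2_normsq (tf_shift f a b) = L2_normsq f"
proof -
  have "L2_normsq f = (LINT t|lborel. (cmod (f (-a + 1 * t)))\<^sup>2)"
    unfolding L2_normsq_def using lborel_integral_real_affine[of 1 "\<lambda>t. (cmod (f t))\<^sup>2" "-a"] by simp
  then show ?thesis by (simp add: L2_normsq_def tf_shift_def norm_mult)
qed

abbreviation tfs :: "real \<times> real \<Rightarrow> (real \<Rightarrow> complex) \<Rightarrow> real \<Rightarrow> complex" where
  "tfs z f \<equiv> tf_shift f (fst z) (snd z)"

lemma tf_shift_add: "tf_shift (\<lambda>t. f t + h t) a b = (\<lambda>t. tf_shift f a b t + tf_shift h a b t)"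
  and tf_shift_scale: "tf_shift (\<lambda>t. c * f t) a b = (\<lambda>t. c * tf_shift f a b t)"
  by (auto simp: tf_shift_def algebra_simps)

text \<open>Shifts compose up to a unimodular factor. The two windows also change places, so that a
  sum over the shifts of \<open>g\<close> becomes a sum over the shifts of \<open>f\<close> by the
  points \<open>z - l\<close>, tested against the fixed function \<open>g\<close>.\<close>

lemma cmod_inner_tfs: "cmod (L2_inner (tfs z f) (tfs l g)) = cmod (L2_inner g (tfs (z - l) f))"
proof -
  define e where "e = (\<lambda>x. exp (2 * complex_of_real pi * \<i> * complex_of_real x))"
  have e_eq: "exp (2 * complex_of_real pi * \<i> * complex_of_real x) = e x" for x
    by (simp add: e_def)
  have e_add: "e (x + y) = e x * e y" for x y
    by (simp add: e_def distrib_left exp_add)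
  have cnj_e: "cnj (e x) = e (- x)" for x
    by (simp add: e_def exp_cnj)
  define \<beta> where "\<beta> = snd z - snd l"
  have "L2_inner (tfs z f) (tfs l g) = (LINT t|lborel. e (\<beta> * t) * f (t - fst z) * cnj (g (t - fst l)))"
    unfolding L2_inner_def tf_shift_def e_eq complex_cnj_mult cnj_e
    by (intro Bochner_Integration.integral_cong)
       (simp_all add: \<beta>_def distrib_right left_diff_distrib e_add diff_conv_add_uminus del: add_uminus_conv_diff)
  \<comment> \<open>Translate by \<open>fst l\<close>; the phase that splits off next has modulus
    1.\<close>
  also have "\<dots> = (LINT t|lborel. e (\<beta> * (fst l + t)) * f (t + fst l - fst z) * cnj (g t))"
    by (subst lborel_integral_real_affine[of 1 _ "fst l"]) (simp_all add: add.commute)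
  also have "\<dots> = e (\<beta> * fst l) * (LINT t|lborel. e (\<beta> * t) * f (t - (fst z - fst l)) * cnj (g t))"
    by (subst Bochner_Integration.integral_mult_right_zero[symmetric], intro Bochner_Integration.integral_cong)
       (simp_all add: distrib_left e_add algebra_simps)
  also have "(LINT t|lborel. e (\<beta> * t) * f (t - (fst z - fst l)) * cnj (g t)) = L2_inner (tfs (z - l) f) g"
    by (simp add: L2_inner_def tf_shift_def e_def \<beta>_def mult.assoc)
  finally have "cmod (L2_inner (tfs z f) (tfs l g)) = cmod (L2_inner (tfs (z - l) f) g)"
    by (simp add: norm_mult e_def)
  then show ?thesis by (simp add: L2_inner_commute[of g])
qed

section \<open>Functions with Lipschitz derivative and decay of their short-time Fourier transforms\<close>

text \<open>One constant bounds the function, its derivative and the Lipschitz constant of the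
  derivative. This regularity suffices for quadratic Fourier decay, and splines with a jump in the
  second derivative have it.\<close>

definition C11 :: "real \<Rightarrow> (real \<Rightarrow> real) \<Rightarrow> bool" where
  "C11 K f \<longleftrightarrow> (\<exists>f'. \<forall>t. (f has_real_derivative f' t) (at t) \<and> \<bar>f t\<bar> \<le> K \<and> \<bar>f' t\<bar> \<le> K \<and>
     (\<forall>s. \<bar>f' s - f' t\<bar> \<le> K * \<bar>s - t\<bar>))"

lemma C11_I:
  assumes "\<And>t. (f has_real_derivative f' t) (at t)" "\<And>t. \<bar>f t\<bar> \<le> K" "\<And>t. \<bar>f' t\<bar> \<le> K"
    "\<And>s t. \<bar>f' s - f' t\<bar> \<le> K * \<bar>s - t\<bar>"
  shows "C11 K f"
  using assms unfolding C11_def by blast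

lemma C11_bound: "C11 K f \<Longrightarrow> \<bar>f t\<bar> \<le> K"
  by (auto simp: C11_def)

lemma C11_nonneg: "C11 K f \<Longrightarrow> 0 \<le> K"
  using C11_bound[of K f 0] by linarith

lemma C11_continuous: "C11 K f \<Longrightarrow> continuous_on S f"
  unfolding C11_def by (blast intro: DERIV_continuous_on has_field_derivative_at_within)

lemma C11_measurable: "C11 K f \<Longrightarrow> f \<in> borel_measurable borel"
  by (rule borel_measurable_continuous_onI) (rule C11_continuous)

lemma DERIV_bounded_Lipschitz:
  fixes f :: "real \<Rightarrow> real"
  assumes "\<And>t. (f has_real_derivative f' t) (at t)" "\<And>t. \<bar>f' t\<bar> \<le> K"
  shows "\<bar>f s - f t\<bar> \<le> K * \<bar>s - t\<bar>"
  using field_differentiable_bound[of UNIV f f' K s t] assms by simp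

text \<open>The factor 4 comes from the derivative: it is a sum of two products, each with Lipschitz
  constant \<open>2 * K * L\<close>.\<close>

lemma C11_mult:
  assumes "C11 K f" "C11 L g"
  shows "C11 (4 * K * L) (\<lambda>t. f t * g t)"
proof -
  obtain f' where f: "\<And>t. (f has_real_derivative f' t) (at t)" "\<And>t. \<bar>f t\<bar> \<le> K" "\<And>t. \<bar>f' t\<bar> \<le> K"
    "\<And>s t. \<bar>f' s - f' t\<bar> \<le> K * \<bar>s - t\<bar>"
    using assms(1) unfolding C11_def by metis
  obtain g' where g: "\<And>t. (g has_real_derivative g' t) (at t)" "\<And>t. \<bar>g t\<bar> \<le> L" "\<And>t. \<bar>g' t\<bar> \<le> L"
    "\<And>s t. \<bar>g' s - g' t\<bar> \<le> L * \<bar>s - t\<bar>"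
    using assms(2) unfolding C11_def by metis
  have K: "0 \<le> K" "0 \<le> L" using assms C11_nonneg by auto
  have lf: "\<bar>f s - f t\<bar> \<le> K * \<bar>s - t\<bar>" and lg: "\<bar>g s - g t\<bar> \<le> L * \<bar>s - t\<bar>" for s t
    using DERIV_bounded_Lipschitz f g by blast+
  have b: "\<bar>x * y\<bar> \<le> K * L" if "\<bar>x\<bar> \<le> K" "\<bar>y\<bar> \<le> L" for x y
    using that K by (simp add: abs_mult mult_mono)
  show ?thesis
  proof (rule C11_I[where f' = "\<lambda>t. f' t * g t + f t * g' t"])
    show "((\<lambda>t. f t * g t) has_real_derivative f' t * g t + f t * g' t) (at t)" for t
      by (auto intro!: derivative_eq_intros f(1) g(1))
    show "\<bar>f t * g t\<bar> \<le> 4 * K * L" for t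
      using b[OF f(2) g(2), of t t] K mult_nonneg_nonneg[OF K] by linarith
    show "\<bar>f' t * g t + f t * g' t\<bar> \<le> 4 * K * L" for t
      using b[OF f(3) g(2), of t t] b[OF f(2) g(3), of t t] mult_nonneg_nonneg[OF K] by linarith
    fix s t
    have p: "\<bar>u s * v s - u t * v t\<bar> \<le> 2 * (K * L) * \<bar>s - t\<bar>"
      if "\<bar>u s - u t\<bar> \<le> K * \<bar>s - t\<bar>" "\<bar>v s - v t\<bar> \<le> L * \<bar>s - t\<bar>" "\<bar>u t\<bar> \<le> K" "\<bar>v s\<bar> \<le> L" for u v :: "real \<Rightarrow> real"
    proof -
      have "u s * v s - u t * v t = (u s - u t) * v s + u t * (v s - v t)" by algebra
      moreover have "\<bar>(u s - u t) * v s\<bar> \<le> (K * \<bar>s - t\<bar>) * L"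
        unfolding abs_mult by (rule mult_mono) (use that K in auto)
      moreover have "\<bar>u t * (v s - v t)\<bar> \<le> K * (L * \<bar>s - t\<bar>)"
        unfolding abs_mult by (rule mult_mono) (use that K in auto)
      ultimately show ?thesis by (simp add: algebra_simps)
    qed
    have "\<bar>f' s * g s - f' t * g t\<bar> \<le> 2 * (K * L) * \<bar>s - t\<bar>" "\<bar>f s * g' s - f t * g' t\<bar> \<le> 2 * (K * L) * \<bar>s - t\<bar>"
      by (rule p; rule f g lf lg)+
    then show "\<bar>(f' s * g s + f s * g' s) - (f' t * g t + f t * g' t)\<bar> \<le> 4 * K * L * \<bar>s - t\<bar>"
      by (simp add: algebra_simps abs_le_iff)
  qed
qed

text \<open>The factors 1, \<open>\<bar>m\<bar>\<close> and \<open>m\<^sup>2\<close> belong to the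
  function, its derivative and the Lipschitz constant of the derivative; their sum dominates
  each.\<close>

lemma C11_affine:
  assumes "C11 K f" shows "C11 (K * (1 + \<bar>m\<bar> + m\<^sup>2)) (\<lambda>t. f (m * t + c))"
proof -
  obtain f' where f: "\<And>t. (f has_real_derivative f' t) (at t)" "\<And>t. \<bar>f t\<bar> \<le> K" "\<And>t. \<bar>f' t\<bar> \<le> K"
    "\<And>s t. \<bar>f' s - f' t\<bar> \<le> K * \<bar>s - t\<bar>"
    using assms unfolding C11_def by metis
  have K: "0 \<le> K" using assms by (rule C11_nonneg)
  then have pos: "0 \<le> K * \<bar>m\<bar>" "0 \<le> K * m\<^sup>2" by auto
  show ?thesis
  proof (rule C11_I[where f' = "\<lambda>t. f' (m * t + c) * m"])
    show "((\<lambda>t. f (m * t + c)) has_real_derivative f' (m * t + c) * m) (at t)" for t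
      by (auto intro!: derivative_eq_intros DERIV_chain2[OF f(1)])
    show "\<bar>f (m * t + c)\<bar> \<le> K * (1 + \<bar>m\<bar> + m\<^sup>2)" for t
      using f(2)[of "m * t + c"] pos unfolding distrib_left by linarith
    have "\<bar>f' (m * t + c) * m\<bar> \<le> K * \<bar>m\<bar>" for t
      unfolding abs_mult by (rule mult_right_mono) (use f in auto)
    then show "\<bar>f' (m * t + c) * m\<bar> \<le> K * (1 + \<bar>m\<bar> + m\<^sup>2)" for t
      using pos K unfolding distrib_left by (smt (verit))
    fix s t
    have "\<bar>f' (m * s + c) - f' (m * t + c)\<bar> * \<bar>m\<bar> \<le> K * \<bar>m * s + c - (m * t + c)\<bar> * \<bar>m\<bar>"
      by (rule mult_right_mono[OF f(4)]) simp
    also have "\<dots> = K * m\<^sup>2 * \<bar>s - t\<bar>"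
    proof -
      have "m * s + c - (m * t + c) = m * (s - t)" by algebra
      then show ?thesis by (simp add: abs_mult power2_eq_square)
    qed
    also have "\<dots> \<le> K * (1 + \<bar>m\<bar> + m\<^sup>2) * \<bar>s - t\<bar>"
      using pos K by (intro mult_right_mono) (auto simp: distrib_left)
    finally show "\<bar>f' (m * s + c) * m - f' (m * t + c) * m\<bar> \<le> K * (1 + \<bar>m\<bar> + m\<^sup>2) * \<bar>s - t\<bar>"
      unfolding left_diff_distrib[symmetric] abs_mult .
  qed
qed

lemma C11_translate: assumes "C11 K f" shows "C11 K (\<lambda>t. f (t - a))"
proof -
  obtain f' where f: "\<And>t. (f has_real_derivative f' t) (at t)" "\<And>t. \<bar>f t\<bar> \<le> K" "\<And>t. \<bar>f' t\<bar> \<le> K"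
    "\<And>s t. \<bar>f' s - f' t\<bar> \<le> K * \<bar>s - t\<bar>"
    using assms unfolding C11_def by metis
  show ?thesis
  proof (rule C11_I[where f' = "\<lambda>t. f' (t - a)"])
    show "((\<lambda>t. f (t - a)) has_real_derivative f' (t - a)) (at t)" for t
    proof -
      have "((\<lambda>t. t - a) has_real_derivative 1) (at t)" by (auto intro!: derivative_eq_intros)
      from DERIV_chain2[OF f(1) this] show ?thesis by simp
    qed
    show "\<bar>f' (s - a) - f' (t - a)\<bar> \<le> K * \<bar>s - t\<bar>" for s t
      using f(4)[of "s - a" "t - a"] by simp
  qed (use f in auto)
qed

lemma C11_second_difference:
  assumes "C11 K f" shows "\<bar>2 * f t - f (t + s) - f (t - s)\<bar> \<le> 2 * K * s\<^sup>2"
proof -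
  obtain f' where f: "\<And>t. (f has_real_derivative f' t) (at t)" 
    "\<And>s t. \<bar>f' s - f' t\<bar> \<le> K * \<bar>s - t\<bar>"
    using assms unfolding C11_def by metis
  have K: "0 \<le> K" using assms by (rule C11_nonneg)
  have pos: "\<bar>2 * f t - f (t + s) - f (t - s)\<bar> \<le> 2 * K * s\<^sup>2" if s: "s > 0" for s
  proof -
    \<comment> \<open>The derivative of \<open>u\<close> at \<open>x\<close> is a difference of
      values of \<open>f'\<close> at distance \<open>2 * x\<close>, so the mean value theorem gives
      two powers of \<open>s\<close>.\<close>
    define u where "u = (\<lambda>s. f (t + s) + f (t - s))"
    have du: "(u has_real_derivative f' (t + x) - f' (t - x)) (at x)" for x
    proof -
      have "((\<lambda>s. f (t + s)) has_real_derivative f' (t + x) * 1) (at x)"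
        by (rule DERIV_chain2[OF f(1)]) (auto intro!: derivative_eq_intros)
      moreover have "((\<lambda>s. f (t - s)) has_real_derivative f' (t - x) * (-1)) (at x)"
        by (rule DERIV_chain2[OF f(1)]) (auto intro!: derivative_eq_intros)
      ultimately show ?thesis
        unfolding u_def using DERIV_add by fastforce
    qed
    obtain z where z: "0 < z" "z < s" "u s - u 0 = (s - 0) * (f' (t + z) - f' (t - z))"
      using MVT2[OF s du] by blast
    have "\<bar>f' (t + z) - f' (t - z)\<bar> \<le> K * \<bar>(t + z) - (t - z)\<bar>" by (rule f)
    also have "\<dots> \<le> K * (2 * s)" using z K by (intro mult_left_mono) auto
    finally have "\<bar>u s - u 0\<bar> \<le> s * (K * (2 * s))"
      unfolding z(3) abs_mult using s by (simp add: mult_left_mono)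
    then show ?thesis by (simp add: u_def power2_eq_square algebra_simps)
  qed
  show ?thesis
  proof (cases s "0::real" rule: linorder_cases)
    case less
    then show ?thesis using pos[of "- s"] by (simp add: algebra_simps)
  qed (use pos in auto)
qed

text \<open>A \<open>C\<^sup>1\<close> step from 0 at \<open>u \<le> 0\<close> to 1 at \<open>u \<ge> 1\<close>; the coefficients are those of a quadratic spline
  with knots 0, 1/2, 1.\<close>

definition ramp :: "real \<Rightarrow> real" where
  "ramp u = 2 * (max 0 u)\<^sup>2 - 4 * (max 0 (u - 1/2))\<^sup>2 + 2 * (max 0 (u - 1))\<^sup>2"

lemma DERIV_max_0_sq: "((\<lambda>t::real. (max 0 (t - c))\<^sup>2) has_real_derivative 2 * max 0 (t - c)) (at t)"
proof (cases "t = c")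
  case True
  have "((\<lambda>t::real. (max 0 (t - c))\<^sup>2) has_real_derivative 0) (at c)"
    unfolding has_field_derivative_iff
  proof (rule tendsto_0_le[where K = 1 and f = "\<lambda>t. t - c"])
    show "((\<lambda>t. t - c) \<longlongrightarrow> 0) (at c)" by (auto intro!: tendsto_eq_intros)
    show "\<forall>\<^sub>F x in at c. norm (((max 0 (x - c))\<^sup>2 - (max 0 (c - c))\<^sup>2) / (x - c)) \<le> norm (x - c) * 1"
      by (rule always_eventually) (auto simp: max_def power2_eq_square)
  qed
  then show ?thesis using True by simp
next
  case False
  have open': "open {c<..}" "open {..<c}" by auto
  show ?thesis
  proof (cases "t < c")
    case True
    have "((\<lambda>t::real. 0) has_real_derivative 0) (at t)" by simp
    then have "((\<lambda>t::real. (max 0 (t - c))\<^sup>2) has_real_derivative 0) (at t)"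
      by (rule has_field_derivative_transform_within_open[OF _ open'(2)]) (use True in auto)
    then show ?thesis using True by simp
  next
    case f: False
    have "((\<lambda>t::real. (t - c)\<^sup>2) has_real_derivative 2 * (t - c)) (at t)"
      by (auto intro!: derivative_eq_intros)
    then have "((\<lambda>t::real. (max 0 (t - c))\<^sup>2) has_real_derivative 2 * (t - c)) (at t)"
      by (rule has_field_derivative_transform_within_open[OF _ open'(1)]) (use False f in auto)
    then show ?thesis using f by simp
  qed
qed

lemma ramp_eq: 
  "u \<le> 0 \<Longrightarrow> ramp u = 0" "0 \<le> u \<Longrightarrow> u \<le> 1/2 \<Longrightarrow> ramp u = 2 * u\<^sup>2"
  "1/2 \<le> u \<Longrightarrow> u \<le> 1 \<Longrightarrow> ramp u = 1 - 2 * (1 - u)\<^sup>2" "1 \<le> u \<Longrightarrow> ramp u = 1"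
  by (auto simp: ramp_def max_def power2_eq_square algebra_simps)

lemma ramp_bounds: "0 \<le> ramp u" "ramp u \<le> 1"
proof -
  have sq: "x\<^sup>2 \<le> 1/4" if "0 \<le> x" "x \<le> 1/2" for x :: real
    using power_mono[of x "1/2" 2] that by (simp add: power_divide)
  consider "u \<le> 0" | "0 \<le> u" "u \<le> 1/2" | "1/2 \<le> u" "u \<le> 1" | "1 \<le> u" by linarith
  then have "0 \<le> ramp u \<and> ramp u \<le> 1"
    using sq[of u] sq[of "1 - u"] by cases (auto simp: ramp_eq)
  then show "0 \<le> ramp u" "ramp u \<le> 1" by auto
qed

text \<open>The constant is 4 + 8 + 4, the sum of the absolute slopes of the three terms of the
  derivative.\<close>

lemma C11_ramp: "C11 16 ramp"
proof (rule C11_I[where f' = "\<lambda>u. 4 * max 0 u - 8 * max 0 (u - 1/2) + 4 * max 0 (u - 1)"])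
  show "(ramp has_real_derivative 4 * max 0 t - 8 * max 0 (t - 1/2) + 4 * max 0 (t - 1)) (at t)" for t
    unfolding ramp_def
    using DERIV_add[OF DERIV_diff[OF DERIV_cmult[OF DERIV_max_0_sq[of 0 t], of 2]
        DERIV_cmult[OF DERIV_max_0_sq[of "1/2" t], of 4]] DERIV_cmult[OF DERIV_max_0_sq[of 1 t], of 2]]
    by simp
  show "\<bar>ramp t\<bar> \<le> 16" for t using ramp_bounds[of t] by simp
qed (auto simp: max_def abs_if)

section \<open>Decay of Fourier integrals and of inner products of shifts\<close>

lemma integral_bound_Icc:
  fixes w :: "real \<Rightarrow> complex"
  assumes [measurable]: "w \<in> borel_measurable borel" and "\<And>t. cmod (w t) \<le> c * indicator {l..u} t" "l \<le> u"
  shows "integrable lborel w" "cmod (LINT t|lborel. w t) \<le> c * (u - l)"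
proof -
  have i: "integrable lborel (\<lambda>t. c * indicator {l..u} t :: real)"
    by (intro integrable_mult_right integrable_real_indicator) (auto simp: emeasure_lborel_Icc_eq)
  show w: "integrable lborel w"
    by (rule Bochner_Integration.integrable_bound[OF i]) (use assms(2) in \<open>auto intro: order_trans[OF _ abs_ge_self]\<close>)
  have "cmod (LINT t|lborel. w t) \<le> (LINT t|lborel. c * indicator {l..u} t)"
    by (rule order_trans[OF integral_norm_bound integral_mono[OF integrable_norm[OF w] i]]) (rule assms(2))
  also have "\<dots> = c * (u - l)" using assms(3) by simp
  finally show "cmod (LINT t|lborel. w t) \<le> c * (u - l)" .
qed

text \<open>A translation by half a period \<open>1 / (2 * b)\<close> flips the sign of the exponential, so four times the
  integral is the integral of a second difference of \<open>h\<close>.\<close>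

lemma C11_fourier_decay:
  assumes h: "C11 K h" and supp: "\<And>t. t \<notin> {n..n + 1} \<Longrightarrow> h t = 0"
  shows "cmod (LINT t|lborel. h t * exp (2 * complex_of_real pi * \<i> * complex_of_real (b * t))) \<le> 2 * K / (1 + b\<^sup>2)"
proof -
  have K: "0 \<le> K" using h by (rule C11_nonneg)
  note [measurable] = C11_measurable[OF h]
  define e where "e = (\<lambda>t. exp (2 * complex_of_real pi * \<i> * complex_of_real (b * t)))"
  have ne: "cmod (e t) = 1" for t by (simp only: e_def cmod_tf)
  have [measurable]: "e \<in> borel_measurable borel"
    unfolding e_def by measurable
  define I where "I = (LINT t|lborel. h t * e t)"
  have hb: "cmod (h t * e t) \<le> K * indicator {n..n+1} t" for t
    using C11_bound[OF h, of t] supp[of t] by (auto simp: norm_mult ne indicator_def)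
  have int: "integrable lborel (\<lambda>t. h t * e t)" and I1: "cmod I \<le> K"
    using integral_bound_Icc[OF _ hb] by (auto simp: I_def)
  have "cmod I \<le> 2 * K / (1 + b\<^sup>2)"
  \<comment> \<open>For small \<open>b\<close> the trivial bound \<open>K\<close> is enough, because
    \<open>1 + b\<^sup>2 \<le> 2\<close>.\<close>
  proof (cases "\<bar>b\<bar> \<le> 1")
    case True
    then have "b\<^sup>2 \<le> 1" by (simp add: abs_square_le_1)
    then have "K * (1 + b\<^sup>2) \<le> K * 2" using K by (intro mult_left_mono) auto
    then have "K \<le> 2 * K / (1 + b\<^sup>2)" by (simp add: pos_le_divide_eq add_pos_nonneg)
    then show ?thesis using I1 by linarith
  next
    case False
    define s where "s = 1 / (2 * b)"
    have bs: "b * s = 1/2" using False by (auto simp: s_def)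
    have s: "\<bar>s\<bar> \<le> 1/2" using False by (simp add: s_def field_simps)
    have esh1: "e (t + s) = - e t" for t
    proof -
      have "exp (2 * complex_of_real pi * \<i> * complex_of_real (1/2)) = -1"
        using exp_pi_i by (simp add: mult_ac)
      moreover have "e (t + s) = e t * exp (2 * complex_of_real pi * \<i> * complex_of_real (1/2))"
        unfolding e_def distrib_left bs of_real_add exp_add by simp
      ultimately show ?thesis by (simp only: mult_minus1_right)
    qed
    have esh: "e (t - s) = - e t" for t
      using esh1[of "t - s"] by simp
    have shift: "integrable lborel (\<lambda>t. h (t + x) * e t) \<and> (LINT t|lborel. h (t + x) * e t) = - I"
      if "x = s \<or> x = - s" for x
    proof -
      have ex: "e (t + x) = - e t" for t using that esh[of t] esh1[of t] by (auto simp: add.commute)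
      have eq: "(\<lambda>t. h (t + x) * e t) = (\<lambda>t. - (h (x + 1 * t) * e (x + 1 * t)))"
        by (simp add: ex add.commute)
      have "(LINT t|lborel. h t * e t) = (LINT t|lborel. h (x + 1 * t) * e (x + 1 * t))"
        using lborel_integral_real_affine[of 1 "\<lambda>t. h t * e t" x] by simp
      then show ?thesis unfolding eq I_def
        using lborel_integrable_real_affine[OF int, of 1 x] by simp
    qed
    have "4 * I = (LINT t|lborel. 2 * (h t * e t) - h (t + s) * e t - h (t + -s) * e t)"
      using shift[of s] shift[of "-s"] int by (simp add: I_def)
    also have "\<dots> = (LINT t|lborel. (2 * h t - h (t + s) - h (t - s)) * e t)"
      by (simp add: algebra_simps)
    \<comment> \<open>Since \<open>\<bar>s\<bar> \<le> 1/2\<close>, the three translates of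
      \<open>h\<close> live in one interval of length 2.\<close>
    also have "cmod \<dots> \<le> 2 * K * s\<^sup>2 * ((n + 3/2) - (n - 1/2))"
    proof (rule integral_bound_Icc(2))
      fix t
      have "2 * h t - h (t + s) - h (t - s) = 0" if "t \<notin> {n - 1/2..n + 3/2}"
      proof -
        have "t \<notin> {n..n + 1}" "t + s \<notin> {n..n + 1}" "t - s \<notin> {n..n + 1}"
          using that s unfolding atLeastAtMost_iff by (auto simp: abs_le_iff)
        then show ?thesis using supp by simp
      qed
      moreover have "cmod (complex_of_real (2 * h t - h (t + s) - h (t - s))) \<le> 2 * K * s\<^sup>2"
        using C11_second_difference[OF h, of t s] by (simp only: norm_of_real)
      ultimately show "cmod (complex_of_real (2 * h t - h (t + s) - h (t - s)) * e t) \<le> 2 * K * s\<^sup>2 * indicator {n - 1/2..n + 3/2} t"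
        unfolding norm_mult ne indicator_def by (simp del: of_real_diff of_real_mult)
    qed auto
    also have "\<dots> = K / b\<^sup>2" using False by (simp add: s_def power2_eq_square field_simps)
    finally have "cmod I \<le> K / (4 * b\<^sup>2)" by (simp add: norm_mult)
    also have "\<dots> \<le> 2 * K / (1 + b\<^sup>2)"
    proof -
      have "1 \<le> b\<^sup>2" using False abs_square_le_1[of b] by linarith
      then have "1 + b\<^sup>2 \<le> 2 * (4 * b\<^sup>2)" by linarith
      then have "2 * K / (8 * b\<^sup>2) \<le> 2 * K / (1 + b\<^sup>2)"
        using K \<open>1 \<le> b\<^sup>2\<close> by (intro divide_left_mono mult_pos_pos) auto
      then show ?thesis by simp
    qed
    finally show ?thesis .
  qed
  then show ?thesis by (simp add: I_def e_def)
qed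

text \<open>The unit interval with integer endpoints is aligned with the boxes of the lattice basis,
  so a single box carries the whole function when completeness is proved.\<close>

definition nice :: "(real \<Rightarrow> real) \<Rightarrow> bool" where
  "nice f \<longleftrightarrow> (\<exists>K (n::int). C11 K f \<and> (\<forall>t. t \<notin> {of_int n..of_int n + 1} \<longrightarrow> f t = 0))"

lemma nice_L2: assumes "nice f" shows "(\<lambda>t. complex_of_real (f t)) \<in> L2"
proof -
  obtain K n where f: "C11 K f" "\<And>t. t \<notin> {of_int n..of_int n + 1} \<Longrightarrow> f t = 0"
    using assms unfolding nice_def by blast
  note [measurable] = C11_measurable[OF f(1)]
  have "integrable lborel (\<lambda>t. complex_of_real ((f t)\<^sup>2))"
  proof (rule integral_bound_Icc(1))
    have "(f t)\<^sup>2 \<le> K\<^sup>2" for t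
      using power_mono[OF C11_bound[OF f(1), of t], of 2] by simp
    then show "cmod (complex_of_real ((f t)\<^sup>2)) \<le> K\<^sup>2 * indicator {of_int n..of_int n + 1} t" for t
      using f(2)[of t] by (cases "t \<in> {of_int n..of_int n + 1}") (auto simp: norm_power power2_abs)
  qed auto
  from integrable_Re[OF this] show ?thesis by (simp add: L2_def)
qed

text \<open>Decay in \<open>a\<close> is free: for large \<open>a\<close> the supports are disjoint,
  and for bounded \<open>a\<close> the factor \<open>1 + a\<^sup>2\<close> is bounded. Decay in
  \<open>b\<close> is the Fourier estimate for the product of the two functions.\<close>

lemma nice_decay:
  assumes "nice f" "nice g"
  shows "\<exists>C>0. \<forall>a b. cmod (L2_inner (\<lambda>t. complex_of_real (g t)) (tf_shift (\<lambda>t. complex_of_real (f t)) a b))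
    \<le> C / ((1 + a\<^sup>2) * (1 + b\<^sup>2))"
proof -
  obtain K n where f: "C11 K f" "\<And>t. t \<notin> {of_int n..of_int n + 1} \<Longrightarrow> f t = 0"
    using assms(1) unfolding nice_def by blast
  obtain L m where g: "C11 L g" "\<And>t. t \<notin> {of_int m..of_int m + 1} \<Longrightarrow> g t = 0"
    using assms(2) unfolding nice_def by blast
  have KL: "0 \<le> K" "0 \<le> L" using f g C11_nonneg by auto
  \<comment> \<open>Unit intervals starting at \<open>n\<close> and \<open>m\<close> can meet after
    a translation by \<open>a\<close> only if \<open>\<bar>a\<bar> \<le> D\<close>. The summand 1 in
    \<open>C\<close> keeps it positive even if a window vanishes.\<close>
  define D where "D = \<bar>of_int m - of_int n\<bar> + (1::real)"
  define C where "C = 2 * (4 * L * K) * (1 + D\<^sup>2) + 1"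
  have C: "C > 0" unfolding C_def using KL by (intro add_nonneg_pos mult_nonneg_nonneg) auto
  have "cmod (L2_inner (\<lambda>t. complex_of_real (g t)) (tf_shift (\<lambda>t. complex_of_real (f t)) a b))
    \<le> C / ((1 + a\<^sup>2) * (1 + b\<^sup>2))" for a b
  proof -
    define I where "I = L2_inner (\<lambda>t. complex_of_real (g t)) (tf_shift (\<lambda>t. complex_of_real (f t)) a b)"
    have I: "I = (LINT t|lborel. complex_of_real (g t * f (t - a)) * exp (2 * complex_of_real pi * \<i> * complex_of_real (- b * t)))"
      by (simp add: I_def L2_inner_def tf_shift_def exp_cnj mult_ac)
    show ?thesis
    proof (cases "\<bar>a\<bar> \<le> D")
      case False
      have z: "g t * f (t - a) = 0" for t
      proof (cases "t \<in> {of_int m..of_int m + 1}")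
        case True
        then have "t - a \<notin> {of_int n..of_int n + 1}"
          using False unfolding D_def by (auto simp: abs_if split: if_splits)
        then show ?thesis using f(2) by simp
      qed (use g(2) in simp)
      then have "I = 0" unfolding I z by simp
      then show ?thesis using C by (simp add: I_def[symmetric])
    next
      case True
      have "cmod I \<le> 2 * (4 * L * K) / (1 + (- b)\<^sup>2)"
        unfolding I by (rule C11_fourier_decay[OF C11_mult[OF g(1) C11_translate[OF f(1)]], of "of_int m"]) (use g(2) in auto)
      also have "\<dots> \<le> C / ((1 + a\<^sup>2) * (1 + b\<^sup>2))"
      proof -
        have "a\<^sup>2 \<le> D\<^sup>2" using True by (simp add: abs_le_square_iff[symmetric] D_def)
        then have "2 * (4 * L * K) * (1 + a\<^sup>2) \<le> 2 * (4 * L * K) * (1 + D\<^sup>2)"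
          using KL by (intro mult_left_mono) auto
        then have "2 * (4 * L * K) * (1 + a\<^sup>2) \<le> C" by (simp add: C_def)
        moreover have "0 < 1 + a\<^sup>2" "0 < 1 + b\<^sup>2" by (simp_all add: add_pos_nonneg)
        moreover have "x / q \<le> c / (p * q)" if "x * p \<le> c" "0 < p" "0 < q" for x p q c :: real
          using that divide_right_mono[of "x * p" c "p * q"] by (simp add: mult.commute)
        ultimately show ?thesis by simp
      qed
      finally show ?thesis unfolding I_def .
    qed
  qed
  with C show ?thesis by blast
qed

section \<open>An induction principle for L2\<close>

lemma L2_indicator:
  assumes "A \<in> sets borel" "emeasure lborel A < \<infinity>"
  shows "(\<lambda>t. indicator A t :: complex) \<in> L2"
proof -
  have "(\<lambda>t. (cmod (indicator A t))\<^sup>2) = (indicator A :: real \<Rightarrow> real)"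
    by (auto simp: indicator_def)
  then show ?thesis
    using assms by (auto simp: L2_def integrable_indicator_iff)
qed

lemma L2_dominated_limit:
  assumes s: "\<And>i. s i \<in> L2" and f: "f \<in> L2" and w: "integrable lborel w"
    and lim: "AE t in lborel. (\<lambda>i. s i t) \<longlonglongrightarrow> f t"
    and dom: "\<And>i t. (cmod (f t - s i t))\<^sup>2 \<le> w t"
  shows "(\<lambda>i. L2_normsq (\<lambda>t. f t - s i t)) \<longlonglongrightarrow> 0"
proof -
  have "(\<lambda>i. L2_normsq (\<lambda>t. f t - s i t)) \<longlonglongrightarrow> integral\<^sup>L lborel (\<lambda>t::real. 0 :: real)"
    unfolding L2_normsq_def
  proof (rule integral_dominated_convergence[where w = w])
    show "AE x in lborel. (\<lambda>i. (cmod (f x - s i x))\<^sup>2) \<longlonglongrightarrow> 0"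
      using lim
    proof eventually_elim
      case (elim x)
      have "(\<lambda>i. (cmod (f x - s i x))\<^sup>2) \<longlonglongrightarrow> (cmod (f x - f x))\<^sup>2"
        by (intro tendsto_intros elim)
      then show ?case by simp
    qed
    show "(\<lambda>x. (cmod (f x - s i x))\<^sup>2) \<in> borel_measurable lborel" for i
      using L2_D(2)[OF L2_diff[OF f s]] by (rule borel_measurable_integrable)
  qed (use w dom in auto)
  then show ?thesis by simp
qed

lemma ramp_scaled_limit:
  "(\<lambda>m. ramp (real (Suc m) * x)) \<longlonglongrightarrow> (if x > 0 then 1 else 0)"
proof (cases "x > 0")
  case True
  obtain M where "1 / x < real M" using reals_Archimedean2 by blast
  then have "1 \<le> real (Suc m) * x" if "m \<ge> M" for m
  proof -
    have "1 / x \<le> real (Suc m)" using that \<open>1 / x < real M\<close> by simp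
    then show ?thesis using True by (simp add: divide_le_eq del: of_nat_Suc)
  qed
  then have "\<forall>\<^sub>F m in sequentially. ramp (real (Suc m) * x) = 1"
    by (intro eventually_sequentiallyI[of M] ramp_eq(4))
  then show ?thesis using True by (simp add: tendsto_eventually)
next
  case False
  then have "ramp (real (Suc m) * x) = 0" for m
    by (intro ramp_eq(1) mult_nonneg_nonpos) auto
  then show ?thesis using False by simp
qed

text \<open>Density of the span of nice functions, packaged as an induction rule. Its ladder is:
  half-lines cut to a unit interval, Borel subsets of that interval, sets of finite measure, simple
  functions, L2. It serves both the tail estimates and the completeness of the lattice
  basis.\<close>

lemma L2_induct_nice [consumes 1, case_names nice add scale limit]:
  assumes "f \<in> L2"
    and nice: "\<And>f. nice f \<Longrightarrow> P (\<lambda>t. complex_of_real (f t))"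
    and add: "\<And>f g. f \<in> L2 \<Longrightarrow> g \<in> L2 \<Longrightarrow> P f \<Longrightarrow> P g \<Longrightarrow> P (\<lambda>t. f t + g t)"
    and scale: "\<And>f c. f \<in> L2 \<Longrightarrow> P f \<Longrightarrow> P (\<lambda>t. c * f t)"
    and limit: "\<And>f. f \<in> L2 \<Longrightarrow> (\<And>e. e > 0 \<Longrightarrow> \<exists>p\<in>L2. P p \<and> L2_normsq (\<lambda>t. f t - p t) < e) \<Longrightarrow> P f"
  shows "P f"
proof -
  have seq: "P h" if "\<And>i::nat. s i \<in> L2" "h \<in> L2" "\<And>i. P (s i)" "integrable lborel w"
    "AE t in lborel. (\<lambda>i. s i t) \<longlonglongrightarrow> h t" "\<And>i t. (cmod (h t - s i t))\<^sup>2 \<le> w t" for s h w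
  proof (rule limit[OF that(2)])
    fix e :: real assume "e > 0"
    with L2_dominated_limit[OF that(1,2,4,5,6)] obtain i where "L2_normsq (\<lambda>t. h t - s i t) < e"
      by (metis (no_types, lifting) order_tendstoD(2) eventually_sequentially order_refl)
    then show "\<exists>p\<in>L2. P p \<and> L2_normsq (\<lambda>t. h t - p t) < e" using that by blast
  qed
  have zero: "P (\<lambda>t. 0)"
    using nice[of "\<lambda>t. 0"] by (force simp: nice_def C11_def)
  have sum: "P (\<lambda>t. \<Sum>k\<in>F. u k t)" if "\<And>k. k \<in> F \<Longrightarrow> u k \<in> L2 \<and> P (u k)" for F and u :: "'k \<Rightarrow> real \<Rightarrow> complex"
    using that by (induction F rule: infinite_finite_induct) (auto simp: zero intro!: add)
  \<comment> \<open>Open intervals, because products of ramps converge pointwise to the indicator of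
    an open interval. The omitted integers are a null set.\<close>
  define I where "I = (\<lambda>n::int. {real_of_int n<..<real_of_int n + 1})"
  have [measurable]: "I n \<in> sets borel" for n by (simp add: I_def)
  have fin: "emeasure lborel (A \<inter> I n) < \<infinity>" for A n
    by (rule le_less_trans[OF emeasure_mono[of _ "I n"]]) (auto simp: I_def)
  have interval: "P (\<lambda>t. indicator ({..<c} \<inter> I n) t)" for c n
  proof -
    \<comment> \<open>The minimum keeps the support inside one unit interval wherever
      \<open>c\<close> lies; for \<open>b \<le> real_of_int n\<close> the product of ramps vanishes
      identically.\<close>
    define b where "b = min c (real_of_int n + 1)"
    define s where "s = (\<lambda>m t. ramp (real (Suc m) * t + real (Suc m) * - real_of_int n) * ramp (- real (Suc m) * t + real (Suc m) * b))"
    have s_eq: "s m t = ramp (real (Suc m) * (t - real_of_int n)) * ramp (real (Suc m) * (b - t))" for m t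
      by (simp add: s_def algebra_simps)
    have s0: "s m t = 0" if "t \<le> real_of_int n \<or> b \<le> t" for m t
      unfolding s_eq using that ramp_eq(1)[of "real (Suc m) * (t - real_of_int n)"] ramp_eq(1)[of "real (Suc m) * (b - t)"]
      by (auto simp: mult_nonneg_nonpos simp del: of_nat_Suc)
    have nice_s: "nice (s m)" for m
      unfolding nice_def
    proof (intro exI[of _ n] exI conjI allI impI)
      show "C11 (4 * (16 * (1 + \<bar>real (Suc m)\<bar> + (real (Suc m))\<^sup>2)) * (16 * (1 + \<bar>- real (Suc m)\<bar> + (- real (Suc m))\<^sup>2))) (s m)"
        unfolding s_def by (intro C11_mult C11_affine C11_ramp)
      show "s m t = 0" if "t \<notin> {real_of_int n..real_of_int n + 1}" for t
        using that by (intro s0) (auto simp: b_def)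
    qed
    have s_bd: "0 \<le> s m t" "s m t \<le> 1" for m t
      unfolding s_def using ramp_bounds by (auto simp: mult_le_one)
    have ind: "(indicator ({..<c} \<inter> I n) t :: real) = (if t - n > 0 then 1 else 0) * (if b - t > 0 then 1 else 0)" for t
      by (auto simp: indicator_def I_def b_def)
    show ?thesis
    proof (rule seq[where s = "\<lambda>m t. complex_of_real (s m t)" and w = "indicator (I n)"])
      show "(\<lambda>t. indicator ({..<c} \<inter> I n) t) \<in> L2" by (rule L2_indicator[OF _ fin]) measurable
      show "integrable lborel (indicator (I n) :: real \<Rightarrow> real)"
        using fin[of UNIV n] by (auto simp: integrable_indicator_iff)
      have "(\<lambda>i. s i t) \<longlonglongrightarrow> indicator ({..<c} \<inter> I n) t" for t
        unfolding s_eq ind by (intro tendsto_mult ramp_scaled_limit)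
      then have "(\<lambda>i. complex_of_real (s i t)) \<longlonglongrightarrow> complex_of_real (indicator ({..<c} \<inter> I n) t)" for t
        by (intro tendsto_of_real)
      then show "AE t in lborel. (\<lambda>i. complex_of_real (s i t)) \<longlonglongrightarrow> indicator ({..<c} \<inter> I n) t"
        by (simp add: of_real_indicator)
      show "(cmod (indicator ({..<c} \<inter> I n) t - complex_of_real (s i t)))\<^sup>2 \<le> indicator (I n) t" for i t
      proof -
        have "indicator ({..<c} \<inter> I n) t - complex_of_real (s i t) = complex_of_real (indicator ({..<c} \<inter> I n) t - s i t)"
          by (simp add: of_real_indicator)
        then have *: "cmod (indicator ({..<c} \<inter> I n) t - complex_of_real (s i t)) = \<bar>indicator ({..<c} \<inter> I n) t - s i t\<bar>"
          by (simp only: norm_of_real)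
        show ?thesis
        proof (cases "t \<in> I n")
          case True
          then show ?thesis
            unfolding * using s_bd[of i t] by (auto simp: indicator_def abs_square_le_1)
        next
          case False
          then have "s i t = 0" by (intro s0) (auto simp: I_def b_def)
          then show ?thesis unfolding * using False by simp
        qed
      qed
    qed (use nice nice_s nice_L2 in auto)
  qed
  have unit: "P (\<lambda>t. indicator (A \<inter> I n) t)" if "A \<in> sets borel" for A n
  proof -
    have full: "P (\<lambda>t. indicator (I n) t)"
    proof -
      have "{..<real_of_int n + 1} \<inter> I n = I n" by (auto simp: I_def)
      then show ?thesis using interval[of "real_of_int n + 1" n] by simp
    qed
    \<comment> \<open>Dynkin's argument with the half-lines as generating pi-system. It runs inside
      one unit interval so that relative complements keep finite measure and stay in L2.\<close>
    have stable: "Int_stable (range (lessThan :: real \<Rightarrow> real set))"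
      unfolding Int_stable_def
    proof (intro ballI)
      fix A B :: "real set" assume "A \<in> range lessThan" "B \<in> range lessThan"
      then obtain a b where "A = {..<a}" "B = {..<b}" by auto
      then have "A \<inter> B = {..<min a b}" by auto
      then show "A \<inter> B \<in> range lessThan" by blast
    qed
    have bor: "sigma_sets UNIV (range lessThan) = sets (borel :: real measure)"
      unfolding borel_Iio by (simp add: sets_measure_of)
    have pow: "range (lessThan :: real \<Rightarrow> real set) \<subseteq> Pow UNIV" by simp
    have "A \<in> sigma_sets UNIV (range lessThan)" using that bor by simp
    with stable pow show ?thesis
    proof (induction A rule: sigma_sets_induct_disjoint[consumes 3, case_names basic empty compl union])
      case (basic A) then show ?case using interval by auto
    next
      case empty then show ?case using zero by simp
    next
      case (compl A)
      then have [measurable]: "A \<in> sets borel" using bor by blast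
      have "(\<lambda>t. indicator ((UNIV - A) \<inter> I n) t :: complex) = (\<lambda>t. indicator (I n) t + (-1) * indicator (A \<inter> I n) t)"
        by (auto simp: indicator_def)
      moreover have "P (\<lambda>t. indicator (I n) t + (-1) * indicator (A \<inter> I n) t)"
        by (intro add scale full compl.IH L2_scale L2_indicator fin) (use fin[of UNIV n] in auto)
      ultimately show ?case by simp
    next
      case (union A)
      then have [measurable]: "A i \<in> sets borel" for i using bor by blast
      define s where "s = (\<lambda>k t. \<Sum>i<k. indicator (A i \<inter> I n) t :: complex)"
      have disj: "disjoint_family (\<lambda>i. A i \<inter> I n)"
        using union.hyps(1) by (auto simp: disjoint_family_on_def)
      have s_eq: "s k t = indicator (\<Union>i<k. A i \<inter> I n) t" for k t
        unfolding s_def using disj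
        by (subst indicator_UN_disjoint) (auto simp: disjoint_family_on_def)
      have "P (\<lambda>t. indicator ((\<Union> (range A)) \<inter> I n) t)"
      proof (rule seq[where s = s and w = "indicator (I n)"])
        show "s i \<in> L2" for i unfolding s_def by (intro L2_sum L2_indicator fin) measurable
        show "P (s i)" for i unfolding s_def by (intro sum conjI L2_indicator fin union.IH) measurable
        show "(\<lambda>t. indicator (\<Union> (range A) \<inter> I n) t) \<in> L2"
          by (intro L2_indicator fin) measurable
        show "integrable lborel (indicator (I n) :: real \<Rightarrow> real)"
          using fin[of UNIV n] by (auto simp: integrable_indicator_iff)
        show "AE t in lborel. (\<lambda>i. s i t) \<longlonglongrightarrow> indicator (\<Union> (range A) \<inter> I n) t"
        proof (intro AE_I2)
          fix t :: real
          have "(\<lambda>k. indicator (\<Union>i<k. A i \<inter> I n) t :: complex) \<longlonglongrightarrow> indicator (\<Union>i. A i \<inter> I n) t"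
            by (rule LIMSEQ_indicator_UN)
          moreover have "(\<Union>i. A i \<inter> I n) = \<Union> (range A) \<inter> I n" by auto
          ultimately show "(\<lambda>i. s i t) \<longlonglongrightarrow> indicator (\<Union> (range A) \<inter> I n) t"
            unfolding s_eq by simp
        qed
        show "(cmod (indicator (\<Union> (range A) \<inter> I n) t - s i t))\<^sup>2 \<le> indicator (I n) t" for i t
          unfolding s_eq by (auto simp: indicator_def)
      qed
      then show ?case .
    qed
  qed
  have finite_measure: "P (\<lambda>t. indicator A t)" if [measurable]: "A \<in> sets borel" and A: "emeasure lborel A < \<infinity>" for A
  proof (rule seq[where s = "\<lambda>N t. \<Sum>n\<in>{-int N..<int N}. indicator (A \<inter> I n) t" and w = "indicator A"])
    show "(\<lambda>t. \<Sum>n = - int N..<int N. indicator (A \<inter> I n) t) \<in> L2" for N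
      by (intro L2_sum L2_indicator fin) measurable
    show "P (\<lambda>t. \<Sum>n = - int N..<int N. indicator (A \<inter> I n) t)" for N
      by (intro sum conjI L2_indicator fin unit) measurable
    show "(\<lambda>t. indicator A t) \<in> L2" by (intro L2_indicator A) measurable
    show "integrable lborel (indicator A :: real \<Rightarrow> real)" using A by (simp add: integrable_indicator_iff)
    have floor: "t \<in> I n \<longleftrightarrow> t \<notin> \<int> \<and> n = \<lfloor>t\<rfloor>" for t n
    proof
      assume t: "t \<in> I n"
      then have "n = \<lfloor>t\<rfloor>" unfolding I_def by (auto intro!: floor_unique[symmetric])
      moreover have "t \<notin> \<int>" using t unfolding I_def by (auto elim!: Ints_cases)
      ultimately show "t \<notin> \<int> \<and> n = \<lfloor>t\<rfloor>" by simp
    next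
      assume t: "t \<notin> \<int> \<and> n = \<lfloor>t\<rfloor>"
      then have "t \<noteq> of_int n" by (metis Ints_of_int)
      then show "t \<in> I n" using t by (auto simp: I_def) linarith
    qed
    have val: "(\<Sum>n = - int N..<int N. indicator (A \<inter> I n) t :: complex) =
        (if t \<notin> \<int> \<and> - int N \<le> \<lfloor>t\<rfloor> \<and> \<lfloor>t\<rfloor> < int N then indicator A t else 0)" for N t
    proof -
      have "(\<Sum>n = - int N..<int N. indicator (A \<inter> I n) t :: complex) =
        (\<Sum>n = - int N..<int N. if n = \<lfloor>t\<rfloor> then (if t \<in> \<int> then 0 else indicator A t) else 0)"
        by (intro sum.cong refl) (auto simp: indicator_def floor)
      also have "\<dots> = (if t \<notin> \<int> \<and> - int N \<le> \<lfloor>t\<rfloor> \<and> \<lfloor>t\<rfloor> < int N then indicator A t else 0)"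
        by (subst sum.delta) auto
      finally show ?thesis .
    qed
    have "AE t in lborel. t \<notin> (\<int> :: real set)"
      by (rule AE_not_in) (simp add: countable_imp_null_set_lborel countable_int)
    then show "AE t in lborel. (\<lambda>N. \<Sum>n = - int N..<int N. indicator (A \<inter> I n) t) \<longlonglongrightarrow> (indicator A t :: complex)"
    proof eventually_elim
      case (elim t)
      have "\<forall>\<^sub>F N in sequentially. (\<Sum>n = - int N..<int N. indicator (A \<inter> I n) t) = (indicator A t :: complex)"
        unfolding val by (rule eventually_sequentiallyI[of "nat (\<bar>\<lfloor>t\<rfloor>\<bar> + 1)"]) (use elim in auto)
      then show ?case by (rule tendsto_eventually)
    qed
    show "(cmod (indicator A t - (\<Sum>n = - int N..<int N. indicator (A \<inter> I n) t)))\<^sup>2 \<le> indicator A t" for N t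
      unfolding val by (auto simp: indicator_def)
  qed
  have simple: "P S" if S: "simple_function lborel S" "S \<in> L2" for S
  proof -
    have [measurable]: "S \<in> borel_measurable borel" using S(2) by (auto simp: L2_def)
    have finS: "finite (range S)" using simple_functionD(1)[OF S(1)] by simp
    have m: "S -` {y} \<in> sets borel" for y
      using measurable_sets[of S borel borel "{y}"] by simp
    have fm: "emeasure lborel (S -` {y}) < \<infinity>" if "y \<noteq> 0" for y
    proof -
      have "integrable lborel (\<lambda>t. (cmod y)\<^sup>2 * indicator (S -` {y}) t :: real)"
        by (rule Bochner_Integration.integrable_bound[OF L2_D(2)[OF S(2)]]) (auto simp: indicator_def m)
      then show ?thesis using that m by (simp add: integrable_indicator_iff)
    qed
    have eq: "S = (\<lambda>t. \<Sum>y\<in>range S - {0}. y * indicator (S -` {y}) t)"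
    proof
      fix t
      have "(\<Sum>y\<in>range S - {0}. y * indicator (S -` {y}) t) = (\<Sum>y\<in>range S - {0}. if y = S t then S t else 0)"
        by (intro sum.cong) (auto simp: indicator_def)
      also have "\<dots> = S t" using finS by (subst sum.delta) auto
      finally show "S t = (\<Sum>y\<in>range S - {0}. y * indicator (S -` {y}) t)" by simp
    qed
    show ?thesis
      by (subst eq) (intro sum conjI scale L2_scale L2_indicator finite_measure; use m fm in force)
  qed
  have [measurable]: "f \<in> borel_measurable borel" using assms(1) by (auto simp: L2_def)
  obtain S where S: "\<And>i. simple_function lborel (S i)" "\<And>x. (\<lambda>i. S i x) \<longlonglongrightarrow> f x"
      "\<And>i x. dist (S i x) 0 \<le> 2 * dist (f x) 0"
    using borel_measurable_implies_sequence_metric[OF L2_D(1)[OF assms(1)], of 0] by auto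
  have SL2: "S i \<in> L2" for i
  proof -
    have [measurable]: "S i \<in> borel_measurable lborel" using S(1) by (rule borel_measurable_simple_function)
    have "integrable lborel (\<lambda>t. (cmod (S i t))\<^sup>2)"
    proof (rule Bochner_Integration.integrable_bound[where f = "\<lambda>t. 4 * (cmod (f t))\<^sup>2"])
      show "AE x in lborel. norm ((cmod (S i x))\<^sup>2) \<le> norm (4 * (cmod (f x))\<^sup>2)"
      proof (intro AE_I2)
        fix x
        show "norm ((cmod (S i x))\<^sup>2) \<le> norm (4 * (cmod (f x))\<^sup>2)"
          using power_mono[OF S(3)[of i x], of 2] by (simp add: power_mult_distrib)
      qed
    qed (use L2_D(2)[OF assms(1)] in auto)
    then show ?thesis by (simp add: L2_def)
  qed
  show ?thesis
  \<comment> \<open>The approximants satisfy \<open>cmod (S i t) \<le> 2 * cmod (f t)\<close>, so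
    the error is at most 3 times \<open>cmod (f t)\<close>; squaring gives 9.\<close>
  proof (rule seq[where s = S and w = "\<lambda>t. 9 * (cmod (f t))\<^sup>2"])
    show "(cmod (f t - S i t))\<^sup>2 \<le> 9 * (cmod (f t))\<^sup>2" for i t
    proof -
      have "cmod (f t - S i t) \<le> 3 * cmod (f t)"
        using norm_triangle_ineq4[of "f t" "S i t"] S(3)[of i t] by simp
      from power_mono[OF this, of 2] show ?thesis by (simp add: power_mult_distrib)
    qed
  qed (use S SL2 simple assms(1) L2_D(2) in auto)
qed

section \<open>Sums over separated sets\<close>

text \<open>The gap is a parameter, so that one constant serves all finite sets with this gap, in
  particular all reflected translates of subsets of a given set.\<close>

definition separated :: "real \<Rightarrow> (real \<times> real) set \<Rightarrow> bool" where
  "separated \<delta> S \<longleftrightarrow> (\<forall>x\<in>S. \<forall>y\<in>S. x \<noteq> y \<longrightarrow> dist x y > \<delta>)"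

lemma separated_subset: "separated \<delta> S \<Longrightarrow> T \<subseteq> S \<Longrightarrow> separated \<delta> T"
  unfolding separated_def by blast

lemma separated_reflect: "separated \<delta> S \<Longrightarrow> separated \<delta> ((\<lambda>l. z - l) ` S)"
  by (force simp: separated_def dist_norm norm_minus_commute)

text \<open>Index of the grid square of side \<open>1 / m\<close> containing the point. On a fine
  enough grid a separated set has at most one point per square, which turns sums over it into sums
  over integer pairs.\<close>

definition cell :: "nat \<Rightarrow> real \<times> real \<Rightarrow> int \<times> int" where
  "cell m p = (\<lfloor>real m * fst p\<rfloor>, \<lfloor>real m * snd p\<rfloor>)"

lemma inj_on_cell:
  assumes "separated \<delta> S" "m > 0" "2 / real m \<le> \<delta>"
  shows "inj_on (cell m) S"
proof (rule inj_onI, rule ccontr)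
  fix p q assume pq: "p \<in> S" "q \<in> S" "cell m p = cell m q" "p \<noteq> q"
  have close: "\<bar>x - y\<bar> < 1 / real m" if "\<lfloor>real m * x\<rfloor> = \<lfloor>real m * y\<rfloor>" for x y
  proof -
    have "\<bar>real m * x - real m * y\<bar> < 1"
      using that by linarith
    then have "real m * \<bar>x - y\<bar> < 1" by (simp add: abs_mult flip: right_diff_distrib)
    then show ?thesis using \<open>m > 0\<close> by (simp add: pos_less_divide_eq mult.commute)
  qed
  have "dist p q \<le> \<bar>fst p - fst q\<bar> + \<bar>snd p - snd q\<bar>"
    unfolding dist_prod_def dist_real_def 
    using sqrt_sum_squares_le_sum_abs[of "\<bar>fst p - fst q\<bar>" "\<bar>snd p - snd q\<bar>"] by simp
  also have "\<dots> < 2 / real m" using close[of "fst p" "fst q"] close[of "snd p" "snd q"] pq(3) by (simp add: cell_def)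
  finally show False using pq assms unfolding separated_def by force
qed

lemma cell_scale_exists: "\<delta> > 0 \<Longrightarrow> \<exists>m>0. 2 / real m \<le> \<delta>"
proof -
  assume "\<delta> > 0"
  obtain m where m: "real m > 2 / \<delta>" using reals_Archimedean2 by blast
  moreover have "0 < 2 / \<delta>" using \<open>\<delta> > 0\<close> by simp
  ultimately have "m > 0" by (metis of_nat_0_less_iff less_trans)
  then show ?thesis using m \<open>\<delta> > 0\<close> by (intro exI[of _ m]) (simp add: field_simps)
qed

lemma separated_card_square:
  assumes "separated \<delta> S" "m > 0" "2 / real m \<le> \<delta>" "R \<ge> 0"
  shows "finite (S \<inter> square p R)" "real (card (S \<inter> square p R)) \<le> (2 * real m * R + 2)\<^sup>2"
proof -
  define I where "I = (\<lambda>x. {\<lfloor>real m * (x - R)\<rfloor>..\<lfloor>real m * (x + R)\<rfloor>})"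
  have inj: "inj_on (cell m) (S \<inter> square p R)"
    using inj_on_cell[OF assms(1-3)] by (rule inj_on_subset) auto
  have sub: "cell m ` (S \<inter> square p R) \<subseteq> I (fst p) \<times> I (snd p)"
    by (auto simp: cell_def I_def square_def abs_le_iff intro!: floor_mono mult_left_mono)
  have fin: "finite (I (fst p) \<times> I (snd p))" by (simp add: I_def)
  show "finite (S \<inter> square p R)"
    using finite_imageD[OF finite_subset[OF sub fin] inj] .
  have "card (S \<inter> square p R) \<le> card (I (fst p) \<times> I (snd p))"
    using card_inj_on_le[OF inj sub fin] .
  then have "real (card (S \<inter> square p R)) \<le> real (card (I (fst p))) * real (card (I (snd p)))"
    by (simp add: card_cartesian_product flip: of_nat_mult)
  also have "\<dots> \<le> (2 * real m * R + 2) * (2 * real m * R + 2)"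
  proof -
    have "real (card (I x)) \<le> 2 * real m * R + 2" for x
    proof -
      have le: "\<lfloor>real m * (x - R)\<rfloor> \<le> \<lfloor>real m * (x + R)\<rfloor>"
        using assms(4) by (intro floor_mono mult_left_mono) auto
      have "real (card (I x)) = real_of_int (\<lfloor>real m * (x + R)\<rfloor> + 1 - \<lfloor>real m * (x - R)\<rfloor>)"
        using le by (simp add: I_def)
      also have "\<dots> \<le> real m * (x + R) - real m * (x - R) + 2" by linarith
      finally show ?thesis by (simp add: algebra_simps)
    qed
    then show ?thesis using assms(4) by (intro mult_mono) auto
  qed
  finally show "real (card (S \<inter> square p R)) \<le> (2 * real m * R + 2)\<^sup>2" by (simp add: power2_eq_square)
qed

text \<open>Comparison with the telescoping series of \<open>2 / k - 2 / (k + 1)\<close>; positive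
  and negative indices together double its tail.\<close>

lemma sum_inverse_square_tail:
  fixes F :: "int set"
  assumes "finite F" "\<And>i. i \<in> F \<Longrightarrow> int N < \<bar>i\<bar>"
  shows "(\<Sum>i\<in>F. 1 / (1 + (real_of_int i)\<^sup>2)) \<le> 4 / (real N + 1)"
proof -
  define M where "M = Max (insert N ((\<lambda>i. nat \<bar>i\<bar>) ` F))"
  have M: "nat \<bar>i\<bar> \<le> M" if "i \<in> F" for i
    unfolding M_def using that assms(1) by (intro Max_ge) auto
  have NM: "N \<le> M" unfolding M_def using assms(1) by (intro Max_ge) auto
  have tel: "(\<Sum>k=Suc N..M. 1 / (1 + (real k)\<^sup>2)) \<le> 2 / (real N + 1)"
  proof -
    have "(\<Sum>k=Suc N..M. 1 / (1 + (real k)\<^sup>2)) \<le> (\<Sum>k=Suc N..M. 2 / real k - 2 / real (Suc k))"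
    proof (rule sum_mono)
      fix k assume "k \<in> {Suc N..M}"
      then have k: "real k \<ge> 1" by simp
      have "2 / real k - 2 / real (Suc k) = 2 / (real k * (real k + 1))"
        using k by (simp add: field_simps)
      moreover have "real k \<le> (real k)\<^sup>2" using k by (simp add: power2_eq_square)
      moreover have *: "1 / x \<le> 2 / y" if "0 < x" "0 < y" "y \<le> 2 * x" for x y :: real
        using that by (simp add: divide_simps)
      have "1 / (1 + (real k)\<^sup>2) \<le> 2 / (real k * (real k + 1))"
      proof -
        have "0 < 1 + (real k)\<^sup>2" by (simp add: add_pos_nonneg)
        moreover have "0 < real k * (real k + 1)" using k by simp
        moreover have "real k * (real k + 1) \<le> 2 * (1 + (real k)\<^sup>2)"
          using \<open>real k \<le> (real k)\<^sup>2\<close> by (simp add: power2_eq_square algebra_simps)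
        ultimately show ?thesis by (rule *)
      qed
      ultimately show "1 / (1 + (real k)\<^sup>2) \<le> 2 / real k - 2 / real (Suc k)" by simp
    qed
    also have "\<dots> = 2 / real (Suc N) - 2 / real (Suc M)"
      using sum_telescope''[of "Suc N" "Suc M" "\<lambda>k. - 2 / real k"] NM
      by (cases "N = M") (simp_all add: sum_Suc_diff[of "Suc N" M "\<lambda>k. - 2 / real k", simplified])
    also have "\<dots> \<le> 2 / (real N + 1)" by (simp add: add.commute)
    finally show ?thesis .
  qed
  let ?g = "\<lambda>i. 1 / (1 + (real_of_int i)\<^sup>2)"
  let ?A = "int ` {Suc N..M}" and ?B = "(\<lambda>k. - int k) ` {Suc N..M}"
  have sub: "F \<subseteq> ?A \<union> ?B"
  proof
    fix i assume i: "i \<in> F"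
    then have r: "nat \<bar>i\<bar> \<in> {Suc N..M}" using M[OF i] assms(2)[OF i] by auto
    show "i \<in> ?A \<union> ?B"
    proof (cases "i \<ge> 0")
      case True
      then have "i = int (nat \<bar>i\<bar>)" by simp
      then show ?thesis using r by blast
    next
      case False
      then have "i = - int (nat \<bar>i\<bar>)" by simp
      then show ?thesis using r by blast
    qed
  qed
  have "(\<Sum>i\<in>F. ?g i) \<le> (\<Sum>i\<in>?A \<union> ?B. ?g i)"
    by (rule sum_mono2) (use sub in auto)
  also have "\<dots> \<le> (\<Sum>i\<in>?A. ?g i) + (\<Sum>i\<in>?B. ?g i)"
    by (subst sum_Un) (auto intro: sum_nonneg)
  also have "\<dots> = 2 * (\<Sum>k=Suc N..M. 1 / (1 + (real k)\<^sup>2))"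
    by (subst (1 2) sum.reindex) (auto simp: inj_on_def)
  finally show ?thesis using tel by simp
qed

lemma sum_inverse_square_bound:
  fixes F :: "int set"
  assumes "finite F"
  shows "(\<Sum>i\<in>F. 1 / (1 + (real_of_int i)\<^sup>2)) \<le> 5"
proof -
  have "(\<Sum>i\<in>F. 1 / (1 + (real_of_int i)\<^sup>2)) \<le> (\<Sum>i\<in>insert 0 (F - {0}). 1 / (1 + (real_of_int i)\<^sup>2))"
    by (rule sum_mono2) (use assms in auto)
  also have "\<dots> = 1 + (\<Sum>i\<in>F - {0}. 1 / (1 + (real_of_int i)\<^sup>2))"
    by (subst sum.insert) (use assms in auto)
  also have "\<dots> \<le> 5"
    using sum_inverse_square_tail[of "F - {0}" 0] assms by simp
  finally show ?thesis .
qed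

text \<open>The envelope from \<open>nice_decay\<close>. As a product of two one-dimensional
  summable sequences it can be summed coordinate by coordinate.\<close>

definition weight :: "real \<times> real \<Rightarrow> real" where
  "weight p = 1 / ((1 + (fst p)\<^sup>2) * (1 + (snd p)\<^sup>2))"

lemma weight_pos [simp]: "weight p > 0" and weight_le_1: "weight p \<le> 1"
proof -
  have "1 * 1 \<le> (1 + (fst p)\<^sup>2) * (1 + (snd p)\<^sup>2)" by (intro mult_mono) auto
  then show "weight p > 0" "weight p \<le> 1" by (auto simp: weight_def)
qed

lemma weight_uminus [simp]: "weight (- p) = weight p"
  by (simp add: weight_def)

lemma sum_int_weight_product:
  fixes F :: "(int \<times> int) set"
  assumes F: "finite F" "\<And>q. q \<in> F \<Longrightarrow> int N < \<bar>fst q\<bar>"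
  shows "(\<Sum>q\<in>F. weight (real_of_int (fst q), real_of_int (snd q))) \<le> 20 / (real N + 1)"
    "(\<Sum>q\<in>F. weight (real_of_int (snd q), real_of_int (fst q))) \<le> 20 / (real N + 1)"
proof -
  have "(\<Sum>q\<in>F. weight (real_of_int (fst q), real_of_int (snd q)))
      \<le> (\<Sum>q\<in>fst ` F \<times> snd ` F. weight (real_of_int (fst q), real_of_int (snd q)))"
    by (rule sum_mono2) (use F in \<open>auto simp: less_imp_le intro: rev_image_eqI\<close>)
  also have "\<dots> = (\<Sum>i\<in>fst ` F. 1 / (1 + (real_of_int i)\<^sup>2)) * (\<Sum>i\<in>snd ` F. 1 / (1 + (real_of_int i)\<^sup>2))"
    by (simp add: sum_product sum.cartesian_product weight_def case_prod_unfold)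
  also have "\<dots> \<le> 4 / (real N + 1) * 5"
    by (intro mult_mono sum_inverse_square_tail sum_inverse_square_bound sum_nonneg) (use F in auto)
  finally show *: "(\<Sum>q\<in>F. weight (real_of_int (fst q), real_of_int (snd q))) \<le> 20 / (real N + 1)" by simp
  then show "(\<Sum>q\<in>F. weight (real_of_int (snd q), real_of_int (fst q))) \<le> 20 / (real N + 1)"
    by (simp add: weight_def mult.commute)
qed

text \<open>An index pair far from the origin has a large first or a large second coordinate; each
  case contributes at most the product of a tail and a full sum.\<close>

lemma sum_int_weight_tail:
  fixes F :: "(int \<times> int) set"
  assumes F: "finite F" "\<And>q. q \<in> F \<Longrightarrow> int N < \<bar>fst q\<bar> \<or> int N < \<bar>snd q\<bar>"
  shows "(\<Sum>q\<in>F. weight (real_of_int (fst q), real_of_int (snd q))) \<le> 40 / (real N + 1)"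
proof -
  let ?w = "\<lambda>q. weight (real_of_int (fst q), real_of_int (snd q))"
  let ?A = "{q\<in>F. int N < \<bar>fst q\<bar>}" and ?B = "{q\<in>F. int N < \<bar>snd q\<bar>}"
  have "F = ?A \<union> ?B" using F by auto
  then have "sum ?w F = sum ?w (?A \<union> ?B)" by simp
  also have "\<dots> \<le> sum ?w ?A + sum ?w ?B"
    by (subst sum_Un) (use F in \<open>auto simp: less_imp_le intro: sum_nonneg\<close>)
  also have "sum ?w ?A \<le> 20 / (real N + 1)"
    by (rule sum_int_weight_product) (use F in auto)
  also have "sum ?w ?B = (\<Sum>q\<in>prod.swap ` ?B. weight (real_of_int (snd q), real_of_int (fst q)))"
    by (subst sum.reindex) auto
  also have "\<dots> \<le> 20 / (real N + 1)"
    by (rule sum_int_weight_product) (use F in auto)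
  finally show ?thesis by simp
qed

lemma sum_int_weight_bound:
  fixes F :: "(int \<times> int) set"
  assumes F: "finite F"
  shows "(\<Sum>q\<in>F. weight (real_of_int (fst q), real_of_int (snd q))) \<le> 41"
proof -
  let ?w = "\<lambda>q. weight (real_of_int (fst q), real_of_int (snd q))"
  have "sum ?w F \<le> sum ?w (insert (0, 0) (F - {(0, 0)}))"
    by (rule sum_mono2) (use F in \<open>auto simp: less_imp_le\<close>)
  also have "\<dots> = ?w (0, 0) + sum ?w (F - {(0, 0)})"
    by (subst sum.insert) (use F in auto)
  also have "\<dots> \<le> 1 + 40"
    using sum_int_weight_tail[of "F - {(0, 0)}" 0] F weight_le_1 by (intro add_mono) (auto simp: prod_eq_iff)
  finally show ?thesis by simp
qed

text \<open>Rounding \<open>m * x\<close> changes it by at most 1, so \<open>1 + x\<^sup>2\<close>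
  and its counterpart at the rounded value are comparable up to \<open>3 * m\<^sup>2\<close>. Two
  coordinates give the square of this factor.\<close>

lemma weight_le_cell:
  assumes "m > 0"
  shows "weight p \<le> 9 * real m ^ 4 * weight (real_of_int (fst (cell m p)), real_of_int (snd (cell m p)))"
proof -
  have *: "1 / (1 + x\<^sup>2) \<le> 3 * (real m)\<^sup>2 * (1 / (1 + (real_of_int \<lfloor>real m * x\<rfloor>)\<^sup>2))" for x
  proof -
    have "\<bar>real_of_int \<lfloor>real m * x\<rfloor>\<bar> \<le> \<bar>real m * x\<bar> + 1" by linarith
    then have "(real_of_int \<lfloor>real m * x\<rfloor>)\<^sup>2 \<le> (\<bar>real m * x\<bar> + 1)\<^sup>2"
      using power_mono[of "\<bar>real_of_int \<lfloor>real m * x\<rfloor>\<bar>" _ 2] by auto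
    also have "\<dots> \<le> 2 * (real m)\<^sup>2 * x\<^sup>2 + 2"
      using sum_squares_bound[of "\<bar>real m * x\<bar>" 1] by (simp add: power2_sum power_mult_distrib mult.commute)
    finally have 1: "1 + (real_of_int \<lfloor>real m * x\<rfloor>)\<^sup>2 \<le> 3 + 2 * ((real m)\<^sup>2 * x\<^sup>2)" by simp
    have "1 \<le> (real m)\<^sup>2" using assms by simp
    then have "3 + 2 * ((real m)\<^sup>2 * x\<^sup>2) \<le> 3 * (real m)\<^sup>2 + 3 * ((real m)\<^sup>2 * x\<^sup>2)"
      using mult_nonneg_nonneg[of "(real m)\<^sup>2" "x\<^sup>2"] zero_le_power2[of "real m"] zero_le_power2[of x] by linarith
    also have "\<dots> = 3 * (real m)\<^sup>2 * (1 + x\<^sup>2)" by (simp add: algebra_simps)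
    finally have "1 + (real_of_int \<lfloor>real m * x\<rfloor>)\<^sup>2 \<le> 3 * (real m)\<^sup>2 * (1 + x\<^sup>2)" using 1 by linarith
    moreover have "0 < 1 + x\<^sup>2" "0 < 1 + (real_of_int \<lfloor>real m * x\<rfloor>)\<^sup>2" by (simp_all add: add_pos_nonneg)
    moreover have "1 / y \<le> c * (1 / x)" if "0 < y" "0 < x" "x \<le> c * y" for x y c :: real
      using that by (simp add: divide_simps)
    ultimately show ?thesis by blast
  qed
  have "weight p = (1 / (1 + (fst p)\<^sup>2)) * (1 / (1 + (snd p)\<^sup>2))" by (simp add: weight_def)
  also have "\<dots> \<le> (3 * (real m)\<^sup>2 * (1 / (1 + (real_of_int \<lfloor>real m * fst p\<rfloor>)\<^sup>2))) *
      (3 * (real m)\<^sup>2 * (1 / (1 + (real_of_int \<lfloor>real m * snd p\<rfloor>)\<^sup>2)))"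
    by (intro mult_mono *) auto
  also have "\<dots> = 9 * real m ^ 4 * weight (real_of_int (fst (cell m p)), real_of_int (snd (cell m p)))"
    by (simp add: weight_def cell_def power4_eq_xxxx power2_eq_square)
  finally show ?thesis .
qed

lemma separated_weight_sum:
  assumes "\<delta> > 0"
  shows "\<exists>C>0. (\<forall>F. finite F \<longrightarrow> separated \<delta> F \<longrightarrow> sum weight F \<le> C) \<and>
    (\<forall>F N. finite F \<longrightarrow> separated \<delta> F \<longrightarrow> F \<inter> square 0 (real N + 1) = {} \<longrightarrow>
        sum weight F \<le> C / (real N + 1))"
proof -
  obtain m where m: "m > 0" "2 / real m \<le> \<delta>" using cell_scale_exists[OF assms] by blast
  let ?w = "\<lambda>q. weight (real_of_int (fst q), real_of_int (snd q))"
  let ?k = "9 * real m ^ 4"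
  have step: "sum weight F \<le> ?k * sum ?w (cell m ` F)" if "separated \<delta> F" for F
  proof -
    have "sum weight F \<le> (\<Sum>p\<in>F. ?k * ?w (cell m p))"
      by (rule sum_mono) (rule weight_le_cell[OF m(1)])
    also have "\<dots> = ?k * sum ?w (cell m ` F)"
      using inj_on_cell[OF that m] by (simp add: sum.reindex sum_distrib_left)
    finally show ?thesis .
  qed
  show ?thesis
  proof (intro exI[of _ "?k * 41"] conjI allI impI)
    show "?k * 41 > 0" using m by simp
    show "sum weight F \<le> ?k * 41" if "finite F" "separated \<delta> F" for F
      by (rule order_trans[OF step[OF that(2)]]) (intro mult_left_mono sum_int_weight_bound finite_imageI that; simp)
    fix F N assume F: "finite F" "separated \<delta> F" "F \<inter> square 0 (real N + 1) = {}"
    \<comment> \<open>Rounding can cost 1: a coordinate beyond \<open>N + 1\<close> yields a cell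
      index beyond \<open>N\<close>.\<close>
    have big: "int N < \<bar>\<lfloor>real m * x\<rfloor>\<bar>" if "\<not> \<bar>x\<bar> \<le> real N + 1" for x
    proof -
      have "1 * \<bar>x\<bar> \<le> real m * \<bar>x\<bar>" using m by (intro mult_right_mono) auto
      then have "\<bar>real m * x\<bar> > real N + 1" using that by (simp add: abs_mult)
      then show ?thesis by linarith
    qed
    have "sum ?w (cell m ` F) \<le> 40 / (real N + 1)"
    proof (rule sum_int_weight_tail)
      fix q assume "q \<in> cell m ` F"
      then obtain p where p: "p \<in> F" "q = cell m p" by auto
      then have "\<not> \<bar>fst p\<bar> \<le> real N + 1 \<or> \<not> \<bar>snd p\<bar> \<le> real N + 1"
        using F(3) by (auto simp: square_def case_prod_unfold)
      then show "int N < \<bar>fst q\<bar> \<or> int N < \<bar>snd q\<bar>" using big p by (auto simp: cell_def)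
    qed (use F in auto)
    then have "?k * sum ?w (cell m ` F) \<le> ?k * (40 / (real N + 1))" by (intro mult_left_mono) auto
    also have "\<dots> \<le> ?k * 41 / (real N + 1)" by (simp add: divide_right_mono)
    finally show "sum weight F \<le> ?k * 41 / (real N + 1)" using step[OF F(2)] by linarith
  qed
qed

section \<open>The homogeneous approximation property\<close>

text \<open>Each product of two coefficients is at most half the sum of their squares; symmetry of
  \<open>w\<close> makes both halves equal, and the row sums remain.\<close>

lemma Schur_test:
  fixes G :: "'a \<Rightarrow> 'a \<Rightarrow> complex"
  assumes "finite F" "\<And>p q. cmod (G p q) \<le> w p q" "\<And>p q. w p q = w q p" "\<And>p q. 0 \<le> w p q"
    "\<And>p. p \<in> F \<Longrightarrow> (\<Sum>q\<in>F. w p q) \<le> S"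
  shows "cmod (\<Sum>p\<in>F. \<Sum>q\<in>F. x p * cnj (x q) * G p q) \<le> S * (\<Sum>p\<in>F. (cmod (x p))\<^sup>2)"
proof -
  have "cmod (\<Sum>p\<in>F. \<Sum>q\<in>F. x p * cnj (x q) * G p q) \<le> (\<Sum>p\<in>F. \<Sum>q\<in>F. cmod (x p * cnj (x q) * G p q))"
    by (intro order_trans[OF norm_sum] sum_mono norm_sum)
  also have "\<dots> \<le> (\<Sum>p\<in>F. \<Sum>q\<in>F. (cmod (x p))\<^sup>2 / 2 * w p q + (cmod (x q))\<^sup>2 / 2 * w q p)"
  proof (intro sum_mono)
    fix p q
    have "cmod (x p * cnj (x q) * G p q) \<le> cmod (x p) * cmod (x q) * w p q"
      unfolding norm_mult complex_mod_cnj by (intro mult_left_mono assms) auto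
    also have "\<dots> \<le> ((cmod (x p))\<^sup>2 / 2 + (cmod (x q))\<^sup>2 / 2) * w p q"
      using sum_squares_bound[of "cmod (x p)" "cmod (x q)"] by (intro mult_right_mono assms) simp
    finally show "cmod (x p * cnj (x q) * G p q) \<le> (cmod (x p))\<^sup>2 / 2 * w p q + (cmod (x q))\<^sup>2 / 2 * w q p"
      using assms(3)[of p q] by (simp add: distrib_right)
  qed
  also have "\<dots> = (\<Sum>p\<in>F. \<Sum>q\<in>F. (cmod (x p))\<^sup>2 / 2 * w p q) + (\<Sum>p\<in>F. \<Sum>q\<in>F. (cmod (x q))\<^sup>2 / 2 * w q p)"
    by (simp only: sum.distrib)
  also have "(\<Sum>p\<in>F. \<Sum>q\<in>F. (cmod (x q))\<^sup>2 / 2 * w q p) = (\<Sum>p\<in>F. \<Sum>q\<in>F. (cmod (x p))\<^sup>2 / 2 * w p q)"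
    by (rule sum.swap)
  also have "(\<Sum>p\<in>F. \<Sum>q\<in>F. (cmod (x p))\<^sup>2 / 2 * w p q) + (\<Sum>p\<in>F. \<Sum>q\<in>F. (cmod (x p))\<^sup>2 / 2 * w p q)
      = (\<Sum>p\<in>F. (cmod (x p))\<^sup>2 * (\<Sum>q\<in>F. w p q))"
    unfolding sum.distrib[symmetric]
    by (intro sum.cong refl) (simp only: sum_distrib_left distrib_right[symmetric] field_sum_of_halves)
  also have "\<dots> \<le> (\<Sum>p\<in>F. (cmod (x p))\<^sup>2 * S)"
    by (intro sum_mono mult_left_mono assms) auto
  finally show ?thesis by (simp add: sum_distrib_left mult.commute)
qed

lemma separated_weight_row_sum:
  assumes "\<And>F. finite F \<Longrightarrow> separated \<delta> F \<Longrightarrow> sum weight F \<le> C" "finite F" "separated \<delta> F"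
  shows "(\<Sum>q\<in>F. weight (p - q)) \<le> C"
proof -
  have "(\<Sum>q\<in>F. weight (p - q)) = sum weight ((\<lambda>q. p - q) ` F)"
    by (simp add: sum.reindex inj_on_def)
  also have "\<dots> \<le> C" using assms by (intro assms(1) finite_imageI separated_reflect)
  finally show ?thesis .
qed

text \<open>The Gram matrix of the shifts is dominated by \<open>D * weight (p - q)\<close>, so
  Schur's test bounds synthesis. The Bessel bound follows by duality, with one constant for all sets
  of the given separation.\<close>

lemma nice_Bessel:
  assumes f: "nice f" and "\<delta> > 0"
  shows "\<exists>C>0. \<forall>u\<in>L2. \<forall>F. finite F \<longrightarrow> separated \<delta> F \<longrightarrow>
    (\<Sum>p\<in>F. (cmod (L2_inner u (tfs p (\<lambda>t. complex_of_real (f t)))))\<^sup>2) \<le> C * L2_normsq u"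
proof -
  define \<phi> where "\<phi> = (\<lambda>t. complex_of_real (f t))"
  have \<phi>: "\<phi> \<in> L2" unfolding \<phi>_def by (rule nice_L2[OF f])
  obtain D where D: "D > 0" "\<And>a b. cmod (L2_inner \<phi> (tf_shift \<phi> a b)) \<le> D / ((1 + a\<^sup>2) * (1 + b\<^sup>2))"
    using nice_decay[OF f f] unfolding \<phi>_def by blast
  have D2: "cmod (L2_inner \<phi> (tfs p \<phi>)) \<le> D * weight p" for p
    using D(2)[of "fst p" "snd p"] by (simp add: weight_def)
  obtain C where C: "C > 0" "\<And>F. finite F \<Longrightarrow> separated \<delta> F \<Longrightarrow> sum weight F \<le> C"
    using separated_weight_sum[OF \<open>\<delta> > 0\<close>] by blast
  define B where "B = D * C"
  have B: "B > 0" using D C by (simp add: B_def)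
  show ?thesis
  proof (intro exI[of _ B] conjI B ballI allI impI)
    fix u and F :: "(real \<times> real) set"
    assume u: "u \<in> L2" and F: "finite F" "separated \<delta> F"
    define \<alpha> where "\<alpha> = (\<lambda>p. L2_inner u (tfs p \<phi>))"
    define s where "s = (\<Sum>p\<in>F. (cmod (\<alpha> p))\<^sup>2)"
    \<comment> \<open>Dividing by \<open>B\<close> makes the norm of \<open>h\<close> at most
      \<open>s / B\<close>, half of the cross term, so that nonnegativity of the norm of
      \<open>u - h\<close> leaves \<open>s / B \<le> L2_normsq u\<close>.\<close>
    define h where "h = (\<lambda>t. \<Sum>p\<in>F. (\<alpha> p / of_real B) * tfs p \<phi> t)"
    have e: "tfs p \<phi> \<in> L2" for p using \<phi> by (rule L2_tf)
    have h: "h \<in> L2" unfolding h_def by (intro L2_sum L2_scale e)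
    have "L2_inner u h = (\<Sum>p\<in>F. cnj (\<alpha> p / of_real B) * \<alpha> p)"
      unfolding h_def \<alpha>_def by (intro L2_inner_sum_right e u)
    also have "\<dots> = of_real (s / B)"
      unfolding s_def of_real_divide of_real_sum complex_norm_square sum_divide_distrib by (simp add: mult.commute)
    finally have uh: "Re (L2_inner u h) = s / B" by simp
    have "L2_inner h h = (\<Sum>p\<in>F. (\<alpha> p / of_real B) * L2_inner (tfs p \<phi>) h)"
      unfolding h_def by (intro L2_inner_sum_left e h[unfolded h_def])
    also have "\<dots> = (\<Sum>p\<in>F. \<Sum>q\<in>F. (\<alpha> p / of_real B) * cnj (\<alpha> q / of_real B) * L2_inner (tfs p \<phi>) (tfs q \<phi>))"
    proof (intro sum.cong refl)
      fix p
      have "L2_inner (tfs p \<phi>) h = (\<Sum>q\<in>F. cnj (\<alpha> q / of_real B) * L2_inner (tfs p \<phi>) (tfs q \<phi>))"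
        unfolding h_def by (intro L2_inner_sum_right e)
      then show "(\<alpha> p / of_real B) * L2_inner (tfs p \<phi>) h =
          (\<Sum>q\<in>F. (\<alpha> p / of_real B) * cnj (\<alpha> q / of_real B) * L2_inner (tfs p \<phi>) (tfs q \<phi>))"
        by (simp only: sum_distrib_left mult.assoc)
    qed
    also have "cmod \<dots> \<le> B * (\<Sum>p\<in>F. (cmod (\<alpha> p / of_real B))\<^sup>2)"
    proof (rule Schur_test[where w = "\<lambda>p q. D * weight (p - q)"])
      show "cmod (L2_inner (tfs p \<phi>) (tfs q \<phi>)) \<le> D * weight (p - q)" for p q
        unfolding cmod_inner_tfs by (rule D2)
      show "D * weight (p - q) = D * weight (q - p)" for p q
        using weight_uminus[of "p - q"] by simp
      show "(\<Sum>q\<in>F. D * weight (p - q)) \<le> B" for p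
        using separated_weight_row_sum[OF C(2) F, of p] D by (simp add: B_def flip: sum_distrib_left)
    qed (use F D in \<open>auto simp: less_imp_le\<close>)
    also have "\<dots> = s / B"
      using B by (simp add: s_def norm_divide power_divide power2_eq_square[of B] flip: sum_divide_distrib)
    finally have hh: "L2_normsq h \<le> s / B" by (simp add: L2_inner_self)
    have "0 \<le> L2_normsq (\<lambda>t. u t - h t)" by simp
    also have "\<dots> = L2_normsq u - 2 * (s / B) + L2_normsq h"
      using L2_normsq_diff[OF u h] uh by simp
    finally have "s / B \<le> L2_normsq u" using hh by linarith
    then show "(\<Sum>p\<in>F. (cmod (L2_inner u (tfs p (\<lambda>t. complex_of_real (f t)))))\<^sup>2) \<le> B * L2_normsq u"
      using B by (simp add: s_def \<alpha>_def \<phi>_def pos_divide_le_eq mult.commute)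
  qed
qed

lemma sum_cmod_sq_add_le:
  "(\<Sum>k\<in>F. (cmod (x k + y k))\<^sup>2) \<le> 2 * (\<Sum>k\<in>F. (cmod (x k))\<^sup>2) + 2 * (\<Sum>k\<in>F. (cmod (y k))\<^sup>2)"
  unfolding sum_distrib_left sum.distrib[symmetric] by (intro sum_mono norm_add_sq_le)

lemma square_mono: "r \<le> s \<Longrightarrow> square p r \<subseteq> square p s"
  by (auto simp: square_def)

lemma in_square_shift: "z - l \<in> square 0 r \<longleftrightarrow> l \<in> square z r"
  by (auto simp: square_def case_prod_unfold abs_minus_commute)

text \<open>A pair \<open>(L, F) \<in> \<A> r\<close> is a family of linear functionals indexed by points, with a finite set of
  points that avoid a square of radius \<open>r\<close>.\<close>

lemma L2_tail_induct:
  fixes \<A> :: "real \<Rightarrow> (('k \<Rightarrow> (real \<Rightarrow> complex) \<Rightarrow> complex) \<times> 'k set) set"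
  assumes f: "f \<in> L2" and antimono: "\<And>r s. r \<le> s \<Longrightarrow> \<A> s \<subseteq> \<A> r" and B: "B > 0"
    and add: "\<And>L F r k f g. (L, F) \<in> \<A> r \<Longrightarrow> f \<in> L2 \<Longrightarrow> g \<in> L2 \<Longrightarrow> L k (\<lambda>t. f t + g t) = L k f + L k g"
    and scale: "\<And>L F r k f c. (L, F) \<in> \<A> r \<Longrightarrow> f \<in> L2 \<Longrightarrow> L k (\<lambda>t. c * f t) = c * L k f"
    and Bessel: "\<And>L F r f. (L, F) \<in> \<A> r \<Longrightarrow> f \<in> L2 \<Longrightarrow> (\<Sum>k\<in>F. (cmod (L k f))\<^sup>2) \<le> B * L2_normsq f"
    and nice: "\<And>f \<epsilon>. nice f \<Longrightarrow> \<epsilon> > 0 \<Longrightarrow>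
      \<exists>r. \<forall>(L, F)\<in>\<A> r. (\<Sum>k\<in>F. (cmod (L k (\<lambda>t. complex_of_real (f t))))\<^sup>2) \<le> \<epsilon>"
    and "\<epsilon> > 0"
  shows "\<exists>r. \<forall>(L, F)\<in>\<A> r. (\<Sum>k\<in>F. (cmod (L k f))\<^sup>2) \<le> \<epsilon>"
proof -
  define T where "T = (\<lambda>f r \<epsilon>. \<forall>(L, F)\<in>\<A> r. (\<Sum>k\<in>F. (cmod (L k f))\<^sup>2) \<le> \<epsilon>)"
  have T_mono: "T g s \<epsilon>" if "T g r \<epsilon>" "r \<le> s" for g r s \<epsilon>
    using that antimono[OF that(2)] unfolding T_def by blast
  have T_add: "T (\<lambda>t. g t + h t) r \<epsilon>" if "g \<in> L2" "h \<in> L2" "T g r (\<epsilon> / 4)" "T h r (\<epsilon> / 4)" for g h r \<epsilon>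
    unfolding T_def
  proof (intro ballI, clarify)
    fix L F assume LF: "(L, F) \<in> \<A> r"
    have "(\<Sum>k\<in>F. (cmod (L k g))\<^sup>2) \<le> \<epsilon> / 4" "(\<Sum>k\<in>F. (cmod (L k h))\<^sup>2) \<le> \<epsilon> / 4"
      using that LF unfolding T_def by auto
    then show "(\<Sum>k\<in>F. (cmod (L k (\<lambda>t. g t + h t)))\<^sup>2) \<le> \<epsilon>"
      using sum_cmod_sq_add_le[of "\<lambda>k. L k g" "\<lambda>k. L k h" F] by (simp add: add[OF LF] that)
  qed
  have "\<forall>\<epsilon>>0. \<exists>r. T f r \<epsilon>"
    using f
  proof (induction f rule: L2_induct_nice)
    case (nice f)
    then show ?case using assms(7) unfolding T_def by blast
  next
    case (add g h)
    show ?case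
    proof (intro allI impI)
      fix \<epsilon> :: real assume "\<epsilon> > 0"
      then obtain r s where "T g r (\<epsilon> / 4)" "T h s (\<epsilon> / 4)"
        using add.IH by (meson divide_pos_pos zero_less_numeral)
      then have "T g (max r s) (\<epsilon> / 4)" "T h (max r s) (\<epsilon> / 4)" by (auto intro: T_mono)
      then show "\<exists>r. T (\<lambda>t. g t + h t) r \<epsilon>" using T_add add.hyps by blast
    qed
  next
    case (scale g c)
    show ?case
    proof (intro allI impI)
      fix \<epsilon> :: real assume "\<epsilon> > 0"
      \<comment> \<open>Adding 1 covers the case \<open>c = 0\<close>.\<close>
      have c: "(cmod c)\<^sup>2 + 1 > 0" by (simp add: add_nonneg_pos)
      then obtain r where r: "T g r (\<epsilon> / ((cmod c)\<^sup>2 + 1))"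
        using scale.IH \<open>\<epsilon> > 0\<close> by (meson divide_pos_pos)
      have "T (\<lambda>t. c * g t) r \<epsilon>"
        unfolding T_def
      proof (intro ballI, clarify)
        fix L F assume LF: "(L, F) \<in> \<A> r"
        have "(\<Sum>k\<in>F. (cmod (L k (\<lambda>t. c * g t)))\<^sup>2) = (cmod c)\<^sup>2 * (\<Sum>k\<in>F. (cmod (L k g))\<^sup>2)"
          by (simp add: assms(5)[OF LF scale.hyps] norm_mult power_mult_distrib sum_distrib_left)
        also have "\<dots> \<le> ((cmod c)\<^sup>2 + 1) * (\<epsilon> / ((cmod c)\<^sup>2 + 1))"
          using r LF unfolding T_def by (intro mult_mono) (auto intro: sum_nonneg)
        also have "\<dots> = \<epsilon>" using c by simp
        finally show "(\<Sum>k\<in>F. (cmod (L k (\<lambda>t. c * g t)))\<^sup>2) \<le> \<epsilon>" .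
      qed
      then show "\<exists>r. T (\<lambda>t. c * g t) r \<epsilon>" by blast
    qed
  next
    case (limit g)
    show ?case
    proof (intro allI impI)
      fix \<epsilon> :: real assume "\<epsilon> > 0"
      then have "\<epsilon> / (4 * B) > 0" using B by simp
      then obtain p where p: "p \<in> L2" "\<forall>\<epsilon>>0. \<exists>r. T p r \<epsilon>" "L2_normsq (\<lambda>t. g t - p t) < \<epsilon> / (4 * B)"
        using limit.IH by blast
      obtain r where r: "T p r (\<epsilon> / 4)" using p(2) \<open>\<epsilon> > 0\<close> by (meson divide_pos_pos zero_less_numeral)
      have gp: "(\<lambda>t. g t - p t) \<in> L2" using limit.hyps p by auto
      \<comment> \<open>Here \<open>Bessel\<close> bounds the error for every pair in the class at
        once, so the radius found for \<open>p\<close> also serves \<open>g\<close>.\<close>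
      have "T (\<lambda>t. g t - p t) r (\<epsilon> / 4)"
        unfolding T_def
      proof (intro ballI, clarify)
        fix L F assume LF: "(L, F) \<in> \<A> r"
        have "B * L2_normsq (\<lambda>t. g t - p t) \<le> B * (\<epsilon> / (4 * B))"
          using B p(3) by (intro mult_left_mono) auto
        then show "(\<Sum>k\<in>F. (cmod (L k (\<lambda>t. g t - p t)))\<^sup>2) \<le> \<epsilon> / 4"
          using Bessel[OF LF gp] B by simp
      qed
      from T_add[OF gp p(1) this r] show "\<exists>r. T g r \<epsilon>" by auto
    qed
  qed
  then show ?thesis using \<open>\<epsilon> > 0\<close> unfolding T_def by blast
qed

text \<open>The first of two approximations: \<open>f\<close> is nice and \<open>g\<close> is
  approximated, with \<open>nice_Bessel\<close> as the uniform bound. For nice \<open>g\<close> the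
  squared coefficients are below a multiple of \<open>weight\<close>, whose tails are uniformly
  small on separated sets.\<close>

lemma nice_tail:
  assumes g: "g \<in> L2" and f: "nice f" and \<delta>: "\<delta> > 0" and "\<epsilon> > 0"
  shows "\<exists>r. \<forall>F. finite F \<longrightarrow> separated \<delta> F \<longrightarrow> F \<inter> square 0 r = {} \<longrightarrow>
    (\<Sum>p\<in>F. (cmod (L2_inner g (tfs p (\<lambda>t. complex_of_real (f t)))))\<^sup>2) \<le> \<epsilon>"
proof -
  define \<phi> where "\<phi> = (\<lambda>t. complex_of_real (f t))"
  have \<phi>: "\<phi> \<in> L2" unfolding \<phi>_def by (rule nice_L2[OF f])
  have e: "tfs p \<phi> \<in> L2" for p using \<phi> by (rule L2_tf)
  obtain B where B: "B > 0" "\<And>u F. u \<in> L2 \<Longrightarrow> finite F \<Longrightarrow> separated \<delta> F \<Longrightarrow>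
    (\<Sum>p\<in>F. (cmod (L2_inner u (tfs p \<phi>)))\<^sup>2) \<le> B * L2_normsq u"
    using nice_Bessel[OF f \<delta>] unfolding \<phi>_def by blast
  define \<A> where "\<A> = (\<lambda>r. {(L, F). L = (\<lambda>p u. L2_inner u (tfs p \<phi>)) \<and>
    finite F \<and> separated \<delta> F \<and> F \<inter> square 0 r = {}})"
  have "\<exists>r. \<forall>(L, F)\<in>\<A> r. (\<Sum>k\<in>F. (cmod (L k g))\<^sup>2) \<le> \<epsilon>"
    using g
  proof (rule L2_tail_induct)
    show "\<A> s \<subseteq> \<A> r" if "r \<le> s" for r s
      using square_mono[OF that] unfolding \<A>_def by blast
  next
    fix g and \<epsilon> :: real assume nice: "nice g" and "\<epsilon> > 0"
    obtain D where D: "D > 0" "\<And>a b. cmod (L2_inner (\<lambda>t. complex_of_real (g t)) (tf_shift \<phi> a b)) \<le> D / ((1 + a\<^sup>2) * (1 + b\<^sup>2))"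
      using nice_decay[OF f nice] unfolding \<phi>_def by blast
    obtain C where C: "C > 0" "\<And>F N. finite F \<Longrightarrow> separated \<delta> F \<Longrightarrow> F \<inter> square 0 (real N + 1) = {} \<Longrightarrow>
        sum weight F \<le> C / (real N + 1)"
      using separated_weight_sum[OF \<delta>] by blast
    obtain N where N: "D\<^sup>2 * C / \<epsilon> < real N" using reals_Archimedean2 by blast
    have "(\<Sum>p\<in>F. (cmod (L2_inner (\<lambda>t. complex_of_real (g t)) (tfs p \<phi>)))\<^sup>2) \<le> \<epsilon>"
      if F: "finite F" "separated \<delta> F" "F \<inter> square 0 (real N + 1) = {}" for F
    proof -
      have "(\<Sum>p\<in>F. (cmod (L2_inner (\<lambda>t. complex_of_real (g t)) (tfs p \<phi>)))\<^sup>2) \<le> (\<Sum>p\<in>F. D\<^sup>2 * weight p)"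
      proof (intro sum_mono)
        fix p
        have "cmod (L2_inner (\<lambda>t. complex_of_real (g t)) (tfs p \<phi>)) \<le> D * weight p"
          using D(2)[of "fst p" "snd p"] by (simp add: weight_def)
        from power_mono[OF this, of 2]
        have "(cmod (L2_inner (\<lambda>t. complex_of_real (g t)) (tfs p \<phi>)))\<^sup>2 \<le> D\<^sup>2 * (weight p)\<^sup>2"
          by (simp add: power_mult_distrib)
        also have "\<dots> \<le> D\<^sup>2 * (weight p * 1)"
          unfolding power2_eq_square[of "weight p"]
          by (intro mult_left_mono weight_le_1) (auto simp: less_imp_le)
        finally show "(cmod (L2_inner (\<lambda>t. complex_of_real (g t)) (tfs p \<phi>)))\<^sup>2 \<le> D\<^sup>2 * weight p" by simp
      qed
      also have "\<dots> = D\<^sup>2 * sum weight F" by (simp add: sum_distrib_left)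
      also have "\<dots> \<le> D\<^sup>2 * (C / (real N + 1))"
        using F by (intro mult_left_mono C(2)) auto
      also have "\<dots> \<le> \<epsilon>"
      proof -
        have "D\<^sup>2 * C < real N * \<epsilon>" using N \<open>\<epsilon> > 0\<close> by (simp add: pos_divide_less_eq)
        then have "D\<^sup>2 * C \<le> \<epsilon> * (real N + 1)" using \<open>\<epsilon> > 0\<close> by (simp add: algebra_simps)
        then show ?thesis by (simp add: pos_divide_le_eq)
      qed
      finally show ?thesis .
    qed
    then show "\<exists>r. \<forall>(L, F)\<in>\<A> r. (\<Sum>k\<in>F. (cmod (L k (\<lambda>t. complex_of_real (g t))))\<^sup>2) \<le> \<epsilon>"
      unfolding \<A>_def by blast
  qed (use B \<open>\<epsilon> > 0\<close> in \<open>auto simp: \<A>_def L2_inner_add_left L2_inner_scale_left e\<close>)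
  then obtain r where r: "\<forall>(L, F)\<in>\<A> r. (\<Sum>k\<in>F. (cmod (L k g))\<^sup>2) \<le> \<epsilon>" ..
  show ?thesis
  proof (intro exI[of _ r] allI impI)
    fix F :: "(real \<times> real) set"
    assume "finite F" "separated \<delta> F" "F \<inter> square 0 r = {}"
    then have "((\<lambda>p u. L2_inner u (tfs p \<phi>)), F) \<in> \<A> r" by (simp add: \<A>_def)
    from bspec[OF r this] show "(\<Sum>p\<in>F. (cmod (L2_inner g (tfs p (\<lambda>t. complex_of_real (f t)))))\<^sup>2) \<le> \<epsilon>"
      by (simp add: \<phi>_def)
  qed
qed

text \<open>The second approximation, now in \<open>f\<close>. The assumed Bessel bound applies
  uniformly in \<open>z\<close> because shifts preserve the norm. For nice \<open>f\<close>,
  covariance replaces the points \<open>l\<close> outside the square about \<open>z\<close> by the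
  points \<open>z - l\<close> outside the square about 0, so \<open>nice_tail\<close> gives a radius
  that does not depend on \<open>z\<close>.\<close>

lemma homogeneous_approximation_property:
  assumes f: "f \<in> L2" and g: "g \<in> L2" and \<delta>: "\<delta> > 0" "separated \<delta> \<Lambda>" and B: "B > 0"
    and Bessel: "\<And>F u. finite F \<Longrightarrow> F \<subseteq> \<Lambda> \<Longrightarrow> u \<in> L2 \<Longrightarrow> (\<Sum>l\<in>F. (cmod (L2_inner u (tfs l g)))\<^sup>2) \<le> B * L2_normsq u"
    and "\<epsilon> > 0"
  shows "\<exists>r. \<forall>z F. finite F \<longrightarrow> F \<subseteq> \<Lambda> - square z r \<longrightarrow>
    (\<Sum>l\<in>F. (cmod (L2_inner (tfs z f) (tfs l g)))\<^sup>2) \<le> \<epsilon>"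
proof -
  define \<A> where "\<A> = (\<lambda>r. {(L, F). finite F \<and> (\<exists>z. L = (\<lambda>l f. L2_inner (tfs z f) (tfs l g)) \<and>
    F \<subseteq> \<Lambda> - square z r)})"
  have "\<exists>r. \<forall>(L, F)\<in>\<A> r. (\<Sum>k\<in>F. (cmod (L k f))\<^sup>2) \<le> \<epsilon>"
    using f
  proof (rule L2_tail_induct)
    show "\<A> s \<subseteq> \<A> r" if "r \<le> s" for r s
      using square_mono[OF that] unfolding \<A>_def by blast
  next
    fix L F r and f :: "real \<Rightarrow> complex"
    assume LF: "(L, F) \<in> \<A> r" and f: "f \<in> L2"
    then obtain z where z: "finite F" "L = (\<lambda>l f. L2_inner (tfs z f) (tfs l g))" "F \<subseteq> \<Lambda>"
      unfolding \<A>_def by blast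
    show "(\<Sum>k\<in>F. (cmod (L k f))\<^sup>2) \<le> B * L2_normsq f"
      using Bessel[OF z(1,3) L2_tf[OF f], of "fst z" "snd z"] unfolding z(2) L2_normsq_tf .
  next
    fix f and \<epsilon> :: real assume nice: "nice f" and "\<epsilon> > 0"
    obtain r where r: "\<And>F. finite F \<Longrightarrow> separated \<delta> F \<Longrightarrow> F \<inter> square 0 r = {} \<Longrightarrow>
      (\<Sum>p\<in>F. (cmod (L2_inner g (tfs p (\<lambda>t. complex_of_real (f t)))))\<^sup>2) \<le> \<epsilon>"
      using nice_tail[OF g nice \<delta>(1) \<open>\<epsilon> > 0\<close>] by blast
    have "(\<Sum>l\<in>F. (cmod (L2_inner (tfs z (\<lambda>t. complex_of_real (f t))) (tfs l g)))\<^sup>2) \<le> \<epsilon>"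
      if F: "finite F" "F \<subseteq> \<Lambda> - square z r" for z F
    proof -
      have "(\<Sum>l\<in>F. (cmod (L2_inner (tfs z (\<lambda>t. complex_of_real (f t))) (tfs l g)))\<^sup>2)
        = (\<Sum>p\<in>(\<lambda>l. z - l) ` F. (cmod (L2_inner g (tfs p (\<lambda>t. complex_of_real (f t)))))\<^sup>2)"
        unfolding cmod_inner_tfs by (simp add: sum.reindex inj_on_def)
      also have "\<dots> \<le> \<epsilon>"
      proof (rule r)
        show "separated \<delta> ((\<lambda>l. z - l) ` F)"
          using F by (intro separated_reflect separated_subset[OF \<delta>(2)]) auto
        have "z - l \<notin> square 0 r" if "l \<in> F" for l
          using F that unfolding in_square_shift by blast
        then show "(\<lambda>l. z - l) ` F \<inter> square 0 r = {}" by blast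
      qed (use F in auto)
      finally show ?thesis .
    qed
    then show "\<exists>r. \<forall>(L, F)\<in>\<A> r. (\<Sum>k\<in>F. (cmod (L k (\<lambda>t. complex_of_real (f t))))\<^sup>2) \<le> \<epsilon>"
      unfolding \<A>_def by blast
  qed (use B \<open>\<epsilon> > 0\<close> g in \<open>auto simp: \<A>_def tf_shift_add tf_shift_scale L2_inner_add_left L2_inner_scale_left L2_tf\<close>)
  then obtain r where r: "\<forall>(L, F)\<in>\<A> r. (\<Sum>k\<in>F. (cmod (L k f))\<^sup>2) \<le> \<epsilon>" ..
  show ?thesis
  proof (intro exI[of _ r] allI impI)
    fix z F assume "finite F" "F \<subseteq> \<Lambda> - square z r"
    then have "((\<lambda>l f. L2_inner (tfs z f) (tfs l g)), F) \<in> \<A> r"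
      unfolding \<A>_def mem_Collect_eq case_prod_conv by (intro conjI exI[of _ z] refl)
    from bspec[OF r this] show "(\<Sum>l\<in>F. (cmod (L2_inner (tfs z f) (tfs l g)))\<^sup>2) \<le> \<epsilon>" by simp
  qed
qed

section \<open>The orthonormal basis generated by the unit box\<close>

definition unit_box :: "real \<Rightarrow> complex" where "unit_box = indicator {0..<1}"

text \<open>One point per unit square: counting these points produces the critical density
  1.\<close>

definition lattice :: "(real \<times> real) set" where "lattice = \<int> \<times> \<int>"

lemma unit_box_L2: "unit_box \<in> L2"
  unfolding unit_box_def by (rule L2_indicator) auto

text \<open>The gap is stated as 1/2 because \<open>separated\<close> asks for a strict inequality
  and neighbouring lattice points are at distance exactly 1.\<close>

lemma separated_lattice: "separated (1/2) lattice"
proof -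
  have Z: "\<bar>a - b\<bar> \<ge> 1" if ab: "a \<in> \<int>" "b \<in> \<int>" "a \<noteq> b" for a b :: real
  proof -
    obtain i j where ij: "a = of_int i" "b = of_int j" using ab(1,2) unfolding Ints_def by blast
    have "1 \<le> \<bar>i - j\<bar>" using ab(3) unfolding ij by auto
    then have "real_of_int 1 \<le> real_of_int \<bar>i - j\<bar>" by (simp only: of_int_le_iff)
    then show ?thesis by (simp add: ij)
  qed
  show ?thesis
    unfolding separated_def
  proof (intro ballI impI)
    fix p q :: "real \<times> real" assume pq: "p \<in> lattice" "q \<in> lattice" "p \<noteq> q"
    have "1 \<le> \<bar>fst p - fst q\<bar> \<or> 1 \<le> \<bar>snd p - snd q\<bar>"
      using pq Z[of "fst p" "fst q"] Z[of "snd p" "snd q"] by (auto simp: lattice_def mem_Times_iff prod_eq_iff)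
    moreover have "\<bar>fst p - fst q\<bar> \<le> dist p q" "\<bar>snd p - snd q\<bar> \<le> dist p q"
      using dist_fst_le[of p q] dist_snd_le[of p q] by (simp_all add: dist_real_def)
    ultimately show "1/2 < dist p q" by linarith
  qed
qed

lemma integral_exp_unit_interval:
  fixes a :: real and k :: int
  shows "(LINT t|lborel. exp (2 * complex_of_real pi * \<i> * complex_of_real (of_int k * t)) * indicator {a..<a + 1} t)
    = (if k = 0 then 1 else 0)"
proof -
  have "(LINT t|lborel. exp (2 * complex_of_real pi * \<i> * complex_of_real (of_int k * t)) * indicator {a..<a + 1} t)
    = (LINT t|lborel. indicator {a..a + 1} t *\<^sub>R exp (2 * complex_of_real pi * \<i> * complex_of_real (of_int k * t)))"
  proof (rule integral_cong_AE)
    show "AE t in lborel. exp (2 * complex_of_real pi * \<i> * complex_of_real (of_int k * t)) * indicator {a..<a + 1} t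
      = indicator {a..a + 1} t *\<^sub>R exp (2 * complex_of_real pi * \<i> * complex_of_real (of_int k * t))"
      using AE_lborel_singleton[of "a + 1"] by eventually_elim (auto simp: indicator_def)
  qed auto
  also have "\<dots> = (if k = 0 then 1 else 0)"
  proof (cases "k = 0")
    case True
    have "(LINT t|lborel. indicator {a..a + 1} t *\<^sub>R (1::complex)) = complex_of_real (LINT t|lborel. indicator {a..a + 1} t)"
      by (simp add: scaleR_conv_of_real flip: integral_complex_of_real)
    then show ?thesis using True by simp
  next
    case False
    define c where "c = 2 * complex_of_real pi * \<i> * of_int k"
    have c: "c \<noteq> 0" using False by (simp add: c_def)
    have eq: "2 * complex_of_real pi * \<i> * complex_of_real (of_int k * t) = c * complex_of_real t" for t
      by (simp add: c_def mult.assoc)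
    have "(LINT t|lborel. indicator {a..a + 1} t *\<^sub>R exp (c * complex_of_real t))
      = exp (c * complex_of_real (a + 1)) / c - exp (c * complex_of_real a) / c"
    proof (rule integral_FTC_Icc)
      show "continuous_on {a..a + 1} (\<lambda>t. exp (c * complex_of_real t))"
        by (intro continuous_intros)
      show "((\<lambda>t. exp (c * complex_of_real t) / c) has_vector_derivative exp (c * complex_of_real x)) (at x within {a..a + 1})" for x
      proof -
        have "((\<lambda>z. exp (c * z) / c) has_field_derivative exp (c * complex_of_real x)) (at (complex_of_real x))"
          using c by (auto intro!: derivative_eq_intros)
        from has_vector_derivative_real_field[OF this] show ?thesis .
      qed
    qed simp
    also have "exp (c * complex_of_real (a + 1)) = exp (c * complex_of_real a) * exp c"
      by (simp add: distrib_left exp_add)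
    also have "exp c = 1"
      unfolding exp_eq_1 c_def by (auto intro!: exI[of _ k])
    finally show ?thesis unfolding eq using False by simp
  qed
  finally show ?thesis .
qed

lemma lattice_orthonormal:
  assumes "p \<in> lattice" "q \<in> lattice"
  shows "L2_inner (tfs p unit_box) (tfs q unit_box) = (if p = q then 1 else 0)"
proof -
  obtain a b c d where pq: "p = (of_int a, of_int b)" "q = (of_int c, of_int d)"
    using assms by (auto simp: lattice_def elim!: Ints_cases)
  show ?thesis
  proof (cases "a = c")
    case False
    have z: "tfs p unit_box t * cnj (tfs q unit_box t) = 0" for t
    proof -
      have "\<not> (t - of_int a \<in> {0..<1} \<and> t - of_int c \<in> {0..<1})"
      proof
        assume "t - of_int a \<in> {0..<1} \<and> t - of_int c \<in> {0..<1}"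
        then have "\<lfloor>t\<rfloor> = a" "\<lfloor>t\<rfloor> = c" by (auto intro!: floor_unique)
        then show False using False by simp
      qed
      then show ?thesis unfolding pq unit_box_def tf_shift_def by (auto simp: indicator_def)
    qed
    show ?thesis unfolding L2_inner_def z using False by (simp add: pq)
  next
    case True
    have "tfs p unit_box t * cnj (tfs q unit_box t) =
        exp (2 * complex_of_real pi * \<i> * complex_of_real (of_int (b - d) * t)) * indicator {of_int a..<of_int a + 1} t" for t
    proof -
      have "exp (2 * complex_of_real pi * \<i> * complex_of_real (of_int (b - d) * t)) =
        exp (2 * complex_of_real pi * \<i> * complex_of_real (of_int b * t)) * cnj (exp (2 * complex_of_real pi * \<i> * complex_of_real (of_int d * t)))"
        by (simp add: exp_cnj algebra_simps flip: exp_add)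
      moreover have "indicator {0..<1} (t - real_of_int a) = (indicator {of_int a..<of_int a + 1} t :: complex)"
        by (auto simp: indicator_def)
      ultimately show ?thesis
        unfolding pq True[symmetric] unit_box_def tf_shift_def by (auto simp: indicator_def)
    qed
    then have "L2_inner (tfs p unit_box) (tfs q unit_box) = (if b - d = 0 then 1 else 0)"
      unfolding L2_inner_def by (simp only: integral_exp_unit_interval)
    then show ?thesis using True by (simp add: pq)
  qed
qed

text \<open>Completing the square for an orthonormal family. The choice of the inner products as
  \<open>c\<close> gives Bessel's inequality, \<open>u = 0\<close> gives the norm of a finite
  combination, and discarding the last sum turns density of the span into the lower half of
  Parseval's identity.\<close>

lemma L2_normsq_minus_lattice_sum:
  assumes u: "u \<in> L2" and F: "finite F" "F \<subseteq> lattice"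
  shows "L2_normsq (\<lambda>t. u t - (\<Sum>p\<in>F. c p * tfs p unit_box t)) =
    L2_normsq u - (\<Sum>p\<in>F. (cmod (L2_inner u (tfs p unit_box)))\<^sup>2) + (\<Sum>p\<in>F. (cmod (c p - L2_inner u (tfs p unit_box)))\<^sup>2)"
proof -
  have e: "tfs p unit_box \<in> L2" for p using unit_box_L2 by (rule L2_tf)
  define h where "h = (\<lambda>t. \<Sum>p\<in>F. c p * tfs p unit_box t)"
  define \<alpha> where "\<alpha> = (\<lambda>p. L2_inner u (tfs p unit_box))"
  have h: "h \<in> L2" unfolding h_def by (intro L2_sum L2_scale e)
  have uh: "L2_inner u h = (\<Sum>p\<in>F. cnj (c p) * \<alpha> p)"
    unfolding h_def \<alpha>_def by (intro L2_inner_sum_right e u)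
  have ph: "L2_inner (tfs p unit_box) h = cnj (c p)" if "p \<in> F" for p
  proof -
    have "L2_inner (tfs p unit_box) h = (\<Sum>q\<in>F. cnj (c q) * L2_inner (tfs p unit_box) (tfs q unit_box))"
      unfolding h_def by (intro L2_inner_sum_right e)
    also have "\<dots> = (\<Sum>q\<in>F. if q = p then cnj (c q) else 0)"
    proof (intro sum.cong refl)
      fix q assume "q \<in> F"
      then show "cnj (c q) * L2_inner (tfs p unit_box) (tfs q unit_box) = (if q = p then cnj (c q) else 0)"
        using lattice_orthonormal[of p q] subsetD[OF F(2)] that by auto
    qed
    finally show ?thesis using F that by simp
  qed
  have "L2_inner h h = (\<Sum>p\<in>F. c p * L2_inner (tfs p unit_box) h)"
    unfolding h_def by (intro L2_inner_sum_left e h[unfolded h_def])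
  also have "\<dots> = (\<Sum>p\<in>F. c p * cnj (c p))"
    by (intro sum.cong refl) (simp add: ph)
  also have "\<dots> = complex_of_real (\<Sum>p\<in>F. (cmod (c p))\<^sup>2)"
    by (simp only: of_real_sum complex_norm_square)
  finally have hh: "L2_normsq h = (\<Sum>p\<in>F. (cmod (c p))\<^sup>2)"
    unfolding L2_inner_self of_real_eq_iff .
  have "(cmod (c p - \<alpha> p))\<^sup>2 = (cmod (c p))\<^sup>2 - 2 * Re (cnj (c p) * \<alpha> p) + (cmod (\<alpha> p))\<^sup>2" for p
    unfolding cmod_power2 by (simp add: power2_eq_square algebra_simps)
  then have "(\<Sum>p\<in>F. (cmod (c p - \<alpha> p))\<^sup>2) = (\<Sum>p\<in>F. (cmod (c p))\<^sup>2) - 2 * Re (\<Sum>p\<in>F. cnj (c p) * \<alpha> p) + (\<Sum>p\<in>F. (cmod (\<alpha> p))\<^sup>2)"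
    by (simp add: sum.distrib sum_subtractf sum_distrib_left Re_sum del: times_complex.sel)
  then show ?thesis
    using L2_normsq_diff[OF u h] unfolding hh uh by (simp add: h_def \<alpha>_def)
qed

lemma lattice_Bessel:
  assumes "u \<in> L2" "finite F" "F \<subseteq> lattice"
  shows "(\<Sum>p\<in>F. (cmod (L2_inner u (tfs p unit_box)))\<^sup>2) \<le> L2_normsq u"
  using L2_normsq_minus_lattice_sum[OF assms, of "\<lambda>p. L2_inner u (tfs p unit_box)"]
    L2_normsq_nonneg[of "\<lambda>t. u t - (\<Sum>p\<in>F. L2_inner u (tfs p unit_box) * tfs p unit_box t)"] by simp

lemma lattice_norm:
  assumes "finite F" "F \<subseteq> lattice"
  shows "L2_normsq (\<lambda>t. \<Sum>p\<in>F. c p * tfs p unit_box t) = (\<Sum>p\<in>F. (cmod (c p))\<^sup>2)"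
proof -
  have "L2_inner (\<lambda>t. 0) h = 0" for h by (simp add: L2_inner_def)
  moreover have "L2_normsq (\<lambda>t. 0 - h t) = L2_normsq h" for h by (simp add: L2_normsq_def)
  ultimately show ?thesis
    using L2_normsq_minus_lattice_sum[OF L2_zero assms, of c] by (simp add: L2_normsq_def)
qed

text \<open>Trigonometric polynomials with period 1. Generation by rules makes closure under
  products and the passage to the lattice span plain inductions.\<close>

inductive_set trig :: "(real \<Rightarrow> complex) set" where
  mono: "(\<lambda>t. exp (2 * complex_of_real pi * \<i> * complex_of_real (of_int m * t))) \<in> trig"
| scale: "T \<in> trig \<Longrightarrow> (\<lambda>t. c * T t) \<in> trig"
| add: "T \<in> trig \<Longrightarrow> U \<in> trig \<Longrightarrow> (\<lambda>t. T t + U t) \<in> trig"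

lemma trig_const: "(\<lambda>t. c) \<in> trig"
  using trig.scale[OF trig.mono[of 0], of c] by simp

lemma trig_mult: "T \<in> trig \<Longrightarrow> U \<in> trig \<Longrightarrow> (\<lambda>t. T t * U t) \<in> trig"
proof (induction T rule: trig.induct)
  case (mono m)
  from mono.prems show ?case
  proof (induction U rule: trig.induct)
    case (mono n)
    show ?case using trig.mono[of "m + n"] by (simp add: distrib_left distrib_right exp_add)
  next
    case (scale T c) then show ?case using trig.scale[OF scale.IH, of c] by (simp add: mult_ac)
  next
    case (add T U) then show ?case using trig.add[OF add.IH] by (simp add: distrib_left)
  qed
next
  case (scale T c) then show ?case using trig.scale[OF scale.IH, of c] by (simp add: mult_ac)
next
  case (add T U) then show ?case using trig.add by (simp add: distrib_right)
qed

lemma trig_cos: "(\<lambda>t. complex_of_real (cos (2 * pi * t))) \<in> trig"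
  and trig_sin: "(\<lambda>t. complex_of_real (sin (2 * pi * t))) \<in> trig"
proof -
  have e: "exp (2 * complex_of_real pi * \<i> * complex_of_real (of_int 1 * t)) = cis (2 * pi * t)"
    "exp (2 * complex_of_real pi * \<i> * complex_of_real (of_int (-1) * t)) = cis (- (2 * pi * t))" for t
    by (simp_all add: cis_conv_exp mult_ac)
  have "(\<lambda>t. (1/2) * cis (2 * pi * t) + (1/2) * cis (- (2 * pi * t))) \<in> trig"
    unfolding e[symmetric] by (intro trig.intros)
  also have "(\<lambda>t. (1/2) * cis (2 * pi * t) + (1/2) * cis (- (2 * pi * t))) = (\<lambda>t. complex_of_real (cos (2 * pi * t)))"
    by (auto simp: complex_eq_iff)
  finally show "(\<lambda>t. complex_of_real (cos (2 * pi * t))) \<in> trig" .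
  have "(\<lambda>t. (-\<i>/2) * cis (2 * pi * t) + (\<i>/2) * cis (- (2 * pi * t))) \<in> trig"
    unfolding e[symmetric] by (intro trig.intros)
  also have "(\<lambda>t. (-\<i>/2) * cis (2 * pi * t) + (\<i>/2) * cis (- (2 * pi * t))) = (\<lambda>t. complex_of_real (sin (2 * pi * t)))"
    by (auto simp: complex_eq_iff)
  finally show "(\<lambda>t. complex_of_real (sin (2 * pi * t))) \<in> trig" .
qed

text \<open>A real-linear functional on the complex plane is determined by its values at 1 and the
  imaginary unit, so on the circle it is a combination of cosine and sine; sums and products stay in
  \<open>trig\<close>.\<close>

lemma trig_polynomial:
  "real_polynomial_function P \<Longrightarrow> (\<lambda>t. complex_of_real (P (cis (2 * pi * t)))) \<in> trig"
proof (induction P rule: real_polynomial_function.induct)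
  case (linear f)
  interpret bounded_linear f by fact
  have "f (cis x) = cos x * f 1 + sin x * f \<i>" for x
  proof -
    have "cis x = cos x *\<^sub>R 1 + sin x *\<^sub>R \<i>" by (simp add: complex_eq_iff)
    then show ?thesis by (simp only: add scale real_scaleR_def)
  qed
  then have "(\<lambda>t. complex_of_real (f (cis (2 * pi * t)))) =
      (\<lambda>t. complex_of_real (f 1) * complex_of_real (cos (2 * pi * t)) + complex_of_real (f \<i>) * complex_of_real (sin (2 * pi * t)))"
    by (simp add: mult.commute)
  then show ?case using trig.add[OF trig.scale[OF trig_cos] trig.scale[OF trig_sin]] by simp
qed (auto simp: trig_const trig.add trig_mult)

text \<open>Stone--Weierstrass on the unit circle, the quotient of \<open>{n..n + 1}\<close> by its endpoints.\<close>

lemma trig_dense: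
  fixes f :: "real \<Rightarrow> real"
  assumes f: "continuous_on {n..n + 1} f" "f n = f (n + 1)" and "\<eta> > 0"
  shows "\<exists>T\<in>trig. \<forall>t\<in>{n..n + 1}. cmod (complex_of_real (f t) - T t) < \<eta>"
proof -
  define q where "q = (\<lambda>t. cis (2 * pi * t))"
  define S where "S = q ` {n..n + 1}"
  \<comment> \<open>The function that \<open>f\<close> induces on the circle. The choice of preimage
    is harmless: two points of the interval with the same image are equal or are the two endpoints,
    where \<open>f\<close> agrees.\<close>
  define G where "G = (\<lambda>z. f (inv_into {n..n + 1} q z))"
  have Gq: "G (q t) = f t" if t: "t \<in> {n..n + 1}" for t
  proof -
    define s where "s = inv_into {n..n + 1} q (q t)"
    have s: "s \<in> {n..n + 1}" "q s = q t"
      using t inv_into_into[of "q t" q "{n..n + 1}"] f_inv_into_f[of "q t" q "{n..n + 1}"]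
      unfolding s_def by blast+
    then have "sin (2 * pi * s) = sin (2 * pi * t) \<and> cos (2 * pi * s) = cos (2 * pi * t)"
      by (simp add: q_def complex_eq_iff)
    then obtain k :: int where "2 * pi * s = 2 * pi * t + 2 * pi * of_int k"
      unfolding sin_cos_eq_iff by auto
    then have "2 * pi * s = 2 * pi * (t + of_int k)" by (simp add: distrib_left)
    then have k: "s = t + of_int k" by simp
    have "f s = f t"
    proof (cases "k = 0")
      case False
      have "\<bar>real_of_int k\<bar> \<le> 1" using s(1) t k by auto
      then have "k = 1 \<or> k = -1" using False by linarith
      then show ?thesis
      proof
        assume "k = 1"
        then have "s = n + 1" "t = n" using s(1) t k by auto
        then show ?thesis using f(2) by simp
      next
        assume "k = -1"
        then have "s = n" "t = n + 1" using s(1) t k by auto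
        then show ?thesis using f(2) by simp
      qed
    qed (use k in simp)
    then show ?thesis by (simp add: G_def s_def)
  qed
  have contq: "continuous_on {n..n + 1} q"
    unfolding q_def by (intro continuous_intros)
  \<comment> \<open>As a continuous image map on a compact interval, \<open>q\<close> is a quotient
    map; openness on the circle can therefore be tested on the interval, where \<open>G\<close>
    becomes \<open>f\<close>.\<close>
  have "continuous_on S G"
    unfolding continuous_on_open
  proof (intro allI impI)
    fix T assume T: "openin (top_of_set (G ` S)) T"
    have "G ` S = f ` {n..n + 1}" unfolding S_def image_image by (rule image_cong[OF refl Gq])
    then have "openin (top_of_set {n..n + 1}) ({n..n + 1} \<inter> f -` T)"
      using f(1) T unfolding continuous_on_open by simp
    also have "{n..n + 1} \<inter> f -` T = {n..n + 1} \<inter> q -` (S \<inter> G -` T)"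
    proof -
      have "q t \<in> S" if "t \<in> {n..n + 1}" for t using that by (simp add: S_def)
      then show ?thesis using Gq by auto
    qed
    finally show "openin (top_of_set S) (S \<inter> G -` T)"
      using Abstract_Topology_2.continuous_imp_quotient_map[OF contq S_def[symmetric], of "S \<inter> G -` T"] by simp
  qed
  moreover have "compact S" unfolding S_def by (intro compact_continuous_image contq) simp
  ultimately obtain P where P: "real_polynomial_function P" "\<And>z. z \<in> S \<Longrightarrow> \<bar>G z - P z\<bar> < \<eta>"
    using Stone_Weierstrass_real_polynomial_function \<open>\<eta> > 0\<close> by metis
  have "cmod (complex_of_real (f t) - complex_of_real (P (cis (2 * pi * t)))) < \<eta>" if "t \<in> {n..n + 1}" for t
  proof -
    have "\<bar>G (q t) - P (q t)\<bar> < \<eta>" using that by (intro P) (simp add: S_def)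
    then show ?thesis unfolding Gq[OF that] unfolding q_def by (metis norm_of_real of_real_diff)
  qed
  then show ?thesis by (intro bexI[OF _ trig_polynomial[OF P(1)]] ballI)
qed

section \<open>Completeness of the lattice system\<close>

definition lattice_span :: "(real \<Rightarrow> complex) set" where
  "lattice_span = {h. \<exists>F c. finite F \<and> F \<subseteq> lattice \<and> h = (\<lambda>t. \<Sum>p\<in>F. c p * tfs p unit_box t)}"

lemma lattice_spanI:
  "finite F \<Longrightarrow> F \<subseteq> lattice \<Longrightarrow> (\<lambda>t. \<Sum>p\<in>F. c p * tfs p unit_box t) \<in> lattice_span"
  unfolding lattice_span_def by blast

lemma lattice_span_L2: "h \<in> lattice_span \<Longrightarrow> h \<in> L2"
  unfolding lattice_span_def by (auto intro!: L2_sum L2_scale L2_tf unit_box_L2)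

lemma lattice_span_add:
  assumes "g \<in> lattice_span" "h \<in> lattice_span" shows "(\<lambda>t. g t + h t) \<in> lattice_span"
proof -
  obtain F c G d where F: "finite F" "F \<subseteq> lattice" "g = (\<lambda>t. \<Sum>p\<in>F. c p * tfs p unit_box t)"
    and G: "finite G" "G \<subseteq> lattice" "h = (\<lambda>t. \<Sum>p\<in>G. d p * tfs p unit_box t)"
    using assms unfolding lattice_span_def by blast
  define k where "k = (\<lambda>p. (if p \<in> F then c p else 0) + (if p \<in> G then d p else 0))"
  have "g t + h t = (\<Sum>p\<in>F \<union> G. k p * tfs p unit_box t)" for t
  proof -
    have "(\<Sum>p\<in>F \<union> G. (if p \<in> F then c p else 0) * tfs p unit_box t) = g t"
      unfolding F(3) using F G by (intro sum.mono_neutral_cong_right) auto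
    moreover have "(\<Sum>p\<in>F \<union> G. (if p \<in> G then d p else 0) * tfs p unit_box t) = h t"
      unfolding G(3) using F G by (intro sum.mono_neutral_cong_right) auto
    ultimately show ?thesis by (simp add: k_def distrib_right sum.distrib)
  qed
  then show ?thesis using lattice_spanI[of "F \<union> G" k] F G by simp
qed

lemma lattice_span_scale:
  assumes "g \<in> lattice_span" shows "(\<lambda>t. a * g t) \<in> lattice_span"
proof -
  obtain F c where F: "finite F" "F \<subseteq> lattice" "g = (\<lambda>t. \<Sum>p\<in>F. c p * tfs p unit_box t)"
    using assms unfolding lattice_span_def by blast
  then have "(\<lambda>t. a * g t) = (\<lambda>t. \<Sum>p\<in>F. (a * c p) * tfs p unit_box t)"
    by (simp add: sum_distrib_left mult.assoc)
  then show ?thesis using lattice_spanI[OF F(1,2), of "\<lambda>p. a * c p"] by simp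
qed

lemma trig_lattice_span:
  "T \<in> trig \<Longrightarrow> (\<lambda>t. T t * unit_box (t - of_int n)) \<in> lattice_span"
proof (induction T rule: trig.induct)
  case (mono m)
  have "(\<lambda>t. exp (2 * complex_of_real pi * \<i> * complex_of_real (of_int m * t)) * unit_box (t - of_int n))
    = (\<lambda>t. \<Sum>p\<in>{(of_int n, of_int m)}. 1 * tfs p unit_box t)" by (simp add: tf_shift_def)
  moreover have "{(of_int n, of_int m)} \<subseteq> lattice" by (simp add: lattice_def)
  ultimately show ?case using lattice_spanI[of "{(of_int n, of_int m)}" "\<lambda>_. 1"] by simp
next
  case (scale T c) then show ?case using lattice_span_scale[OF scale.IH, of c] by (simp add: mult.assoc)
next
  case (add T U) then show ?case using lattice_span_add[OF add.IH] by (simp add: distrib_right)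
qed

text \<open>A nice function vanishes at both ends of its interval and so is a continuous function on
  the circle. Uniform approximation on a box of measure 1 is approximation in L2, and the set of
  approximable functions is closed under the steps of the induction rule.\<close>

lemma lattice_span_dense:
  assumes "h \<in> L2" "\<eta> > 0" shows "\<exists>p\<in>lattice_span. L2_normsq (\<lambda>t. h t - p t) < \<eta>"
proof -
  have "\<forall>\<eta>>0. \<exists>p\<in>lattice_span. L2_normsq (\<lambda>t. h t - p t) < \<eta>"
    using assms(1)
  proof (induction h rule: L2_induct_nice)
    case (nice f)
    then obtain K n where f: "C11 K f" "\<And>t. t \<notin> {of_int n..of_int n + 1} \<Longrightarrow> f t = 0"
      unfolding nice_def by blast
    have cont: "continuous_on UNIV f" using C11_continuous[OF f(1)] .
    \<comment> \<open>The vanishing outside the closed interval reaches the endpoints by continuity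
      from outside.\<close>
    have ends: "f (of_int n) = 0" "f (of_int n + 1) = 0"
    proof -
      have "(f \<longlongrightarrow> f x) (at x within S)" for x S
        using cont by (meson continuous_on_def iso_tuple_UNIV_I tendsto_within_subset subset_UNIV)
      note c = this
      have "f x = 0" if "x = of_int n \<and> S = {..<x} \<or> x = of_int n + 1 \<and> S = {x<..}" for x and S :: "real set"
      proof -
        have "\<forall>\<^sub>F t in at x within S. f t = 0"
          unfolding eventually_at_filter using that f(2) by (intro always_eventually) auto
        then have "(f \<longlongrightarrow> 0) (at x within S)" by (rule tendsto_eventually)
        moreover have "at x within S \<noteq> bot"
          using that trivial_limit_at_left_real[of x] trivial_limit_at_right_real[of x] by (auto simp: trivial_limit_def)
        ultimately show ?thesis using c[of x S] tendsto_unique by blast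
      qed
      then show "f (of_int n) = 0" "f (of_int n + 1) = 0" by auto
    qed
    show ?case
    proof (intro allI impI)
      fix \<eta> :: real assume \<eta>: "\<eta> > 0"
      \<comment> \<open>A uniform error \<open>e\<close> on an interval of length 1 costs at most
        \<open>e\<^sup>2 = \<eta> / 2\<close>, which leaves a strict inequality.\<close>
      define e where "e = sqrt (\<eta> / 2)"
      have e: "e > 0" "e\<^sup>2 = \<eta> / 2" using \<eta> by (auto simp: e_def)
      obtain T where T: "T \<in> trig" "\<And>t. t \<in> {of_int n..of_int n + 1} \<Longrightarrow> cmod (complex_of_real (f t) - T t) < e"
        using trig_dense[of "of_int n" f e] continuous_on_subset[OF cont subset_UNIV] ends e by force
      define p where "p = (\<lambda>t. T t * unit_box (t - of_int n))"
      have p: "p \<in> lattice_span" unfolding p_def by (rule trig_lattice_span[OF T(1)])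
      have d: "(\<lambda>t. complex_of_real (f t) - p t) \<in> L2"
        using nice_L2[OF nice] lattice_span_L2[OF p] by (rule L2_diff)
      have "(cmod (complex_of_real (f t) - p t))\<^sup>2 \<le> \<eta> / 2 * indicator {of_int n..of_int n + 1} t" for t
      proof (cases "t \<in> {of_int n..<of_int n + 1}")
        case True
        then have "cmod (complex_of_real (f t) - p t) \<le> e" 
          using T(2)[of t] by (simp add: p_def unit_box_def indicator_def less_imp_le)
        from power_mono[OF this, of 2] show ?thesis using True e by (simp add: indicator_def)
      next
        case False
        \<comment> \<open>The box is half-open: at its right end the approximant is cut off to 0,
          and \<open>f\<close> vanishes there too.\<close>
        then have "f t = 0" using f(2)[of t] ends by (cases "t = of_int n + 1") auto
        moreover have "p t = 0" using False by (auto simp: p_def unit_box_def indicator_def)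
        ultimately show ?thesis using \<eta> by (simp add: indicator_def)
      qed
      then have "L2_normsq (\<lambda>t. complex_of_real (f t) - p t) \<le> (LINT t|lborel. \<eta> / 2 * indicator {real_of_int n..real_of_int n + 1} t)"
        unfolding L2_normsq_def
        by (intro integral_mono L2_D(2)[OF d] integrable_mult_right integrable_real_indicator) (auto simp: emeasure_lborel_Icc_eq)
      also have "\<dots> < \<eta>" using \<eta> by simp
      finally show "\<exists>p\<in>lattice_span. L2_normsq (\<lambda>t. complex_of_real (f t) - p t) < \<eta>" using p by blast
    qed
  next
    case (add f g)
    show ?case
    proof (intro allI impI)
      fix \<eta> :: real assume \<eta>: "\<eta> > 0"
      then obtain p q where pq: "p \<in> lattice_span" "q \<in> lattice_span" "L2_normsq (\<lambda>t. f t - p t) < \<eta> / 4" "L2_normsq (\<lambda>t. g t - q t) < \<eta> / 4"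
        using add.IH by (meson divide_pos_pos zero_less_numeral)
      have "(\<lambda>t. f t + g t - (p t + q t)) = (\<lambda>t. (f t - p t) + (g t - q t))" by auto
      then have "L2_normsq (\<lambda>t. f t + g t - (p t + q t)) < \<eta>"
        using L2_normsq_add_le[of "\<lambda>t. f t - p t" "\<lambda>t. g t - q t"] pq add.hyps lattice_span_L2 by (simp add: L2_diff)
      then show "\<exists>p\<in>lattice_span. L2_normsq (\<lambda>t. f t + g t - p t) < \<eta>"
        by (intro bexI[OF _ lattice_span_add[OF pq(1,2)]])
    qed
  next
    case (scale f c)
    show ?case
    proof (intro allI impI)
      fix \<eta> :: real assume \<eta>: "\<eta> > 0"
      have c: "(cmod c)\<^sup>2 + 1 > 0" by (simp add: add_nonneg_pos)
      then obtain p where p: "p \<in> lattice_span" "L2_normsq (\<lambda>t. f t - p t) < \<eta> / ((cmod c)\<^sup>2 + 1)"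
        using scale.IH \<eta> by (meson divide_pos_pos)
      have "L2_normsq (\<lambda>t. c * f t - c * p t) = (cmod c)\<^sup>2 * L2_normsq (\<lambda>t. f t - p t)"
        unfolding right_diff_distrib[symmetric] by (rule L2_normsq_scale)
      also have "\<dots> \<le> ((cmod c)\<^sup>2 + 1) * L2_normsq (\<lambda>t. f t - p t)"
        by (intro mult_right_mono) auto
      also have "\<dots> < \<eta>" using p(2) c by (simp add: pos_less_divide_eq mult.commute)
      finally show "\<exists>p\<in>lattice_span. L2_normsq (\<lambda>t. c * f t - p t) < \<eta>"
        by (intro bexI[OF _ lattice_span_scale[OF p(1), of c]])
    qed
  next
    case (limit f)
    show ?case
    proof (intro allI impI)
      fix \<eta> :: real assume \<eta>: "\<eta> > 0"
      then have "\<eta> / 4 > 0" by simp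
      then obtain g where g: "g \<in> L2" "\<forall>\<eta>>0. \<exists>p\<in>lattice_span. L2_normsq (\<lambda>t. g t - p t) < \<eta>" "L2_normsq (\<lambda>t. f t - g t) < \<eta> / 4"
        using limit.IH by blast
      obtain p where p: "p \<in> lattice_span" "L2_normsq (\<lambda>t. g t - p t) < \<eta> / 4" using g(2) \<open>\<eta> / 4 > 0\<close> by blast
      have "(\<lambda>t. f t - p t) = (\<lambda>t. (f t - g t) + (g t - p t))" by auto
      then have "L2_normsq (\<lambda>t. f t - p t) < \<eta>"
        using L2_normsq_add_le[of "\<lambda>t. f t - g t" "\<lambda>t. g t - p t"] p g limit.hyps lattice_span_L2 by (simp add: L2_diff)
      then show "\<exists>p\<in>lattice_span. L2_normsq (\<lambda>t. f t - p t) < \<eta>" using p by blast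
    qed
  qed
  then show ?thesis using assms(2) by blast
qed

text \<open>Completeness in finite form with a loss \<open>\<eta>\<close>, the form in which
  \<open>dimension_comparison\<close> takes its lower bound.\<close>

lemma lattice_Parseval_lower:
  assumes h: "h \<in> L2" and "\<eta> > 0"
  shows "\<exists>F. finite F \<and> F \<subseteq> lattice \<and> L2_normsq h - \<eta> \<le> (\<Sum>p\<in>F. (cmod (L2_inner h (tfs p unit_box)))\<^sup>2)"
proof -
  obtain F c where F: "finite F" "F \<subseteq> lattice" and lt: "L2_normsq (\<lambda>t. h t - (\<Sum>p\<in>F. c p * tfs p unit_box t)) < \<eta>"
    using lattice_span_dense[OF assms] unfolding lattice_span_def by blast
  have "0 \<le> (\<Sum>p\<in>F. (cmod (c p - L2_inner h (tfs p unit_box)))\<^sup>2)" by (intro sum_nonneg) auto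
  then show ?thesis
    using lt L2_normsq_minus_lattice_sum[OF h F, of c] F by (intro exI[of _ F]) auto
qed

section \<open>Comparison of dimensions\<close>

text \<open>Gaussian elimination. An equation with a nonzero coefficient is solved for one unknown
  and substituted into the others, which leaves one equation and one unknown fewer.\<close>

lemma homogeneous_system_nontrivial_solution:
  fixes a :: "'j \<Rightarrow> 'e \<Rightarrow> complex"
  assumes "finite E" "finite J" "card E < card J"
  shows "\<exists>c. (\<exists>j\<in>J. c j \<noteq> 0) \<and> (\<forall>e\<in>E. (\<Sum>j\<in>J. c j * a j e) = 0)"
  using assms
proof (induction E arbitrary: J a)
  case empty
  then obtain j where "j \<in> J" by (metis card.empty less_irrefl ex_in_conv)
  then show ?case by (intro exI[of _ "\<lambda>_. 1"]) auto
next
  case (insert e E)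
  show ?case
  proof (cases "\<forall>j\<in>J. a j e = 0")
    case True
    have "card E < card J" using insert by simp
    then show ?thesis using insert.IH[of J a] insert.prems True by auto
  next
    case False
    then obtain i where i: "i \<in> J" "a i e \<noteq> 0" by auto
    have "card E < card (J - {i})" using insert i by (simp add: card_Diff_singleton)
    then obtain c where c: "\<exists>j\<in>J - {i}. c j \<noteq> 0"
      "\<forall>f\<in>E. (\<Sum>j\<in>J - {i}. c j * (a j f - a i f * a j e / a i e)) = 0"
      using insert.IH[of "J - {i}" "\<lambda>j f. a j f - a i f * a j e / a i e"] insert.prems by auto
    \<comment> \<open>The value forced on the eliminated unknown by equation
      \<open>e\<close>.\<close>
    define x where "x = - (\<Sum>j\<in>J - {i}. c j * a j e) / a i e"
    have split: "(\<Sum>j\<in>J. (c(i := x)) j * a j f) = x * a i f + (\<Sum>j\<in>J - {i}. c j * a j f)" for f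
    proof -
      have "(\<Sum>j\<in>J. (c(i := x)) j * a j f) = (c(i := x)) i * a i f + (\<Sum>j\<in>J - {i}. (c(i := x)) j * a j f)"
        using i insert.prems by (intro sum.remove) auto
      also have "(\<Sum>j\<in>J - {i}. (c(i := x)) j * a j f) = (\<Sum>j\<in>J - {i}. c j * a j f)"
        by (intro sum.cong) auto
      finally show ?thesis by simp
    qed
    have "(\<Sum>j\<in>J. (c(i := x)) j * a j e) = 0"
      unfolding split using i by (simp add: x_def)
    moreover have "(\<Sum>j\<in>J. (c(i := x)) j * a j f) = 0" if "f \<in> E" for f
    proof -
      have "(\<Sum>j\<in>J - {i}. c j * a j f - a i f / a i e * (c j * a j e)) =
          (\<Sum>j\<in>J - {i}. c j * (a j f - a i f * a j e / a i e))"
        by (intro sum.cong refl) (simp add: algebra_simps)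
      also have "\<dots> = 0" using c(2) that by blast
      finally have "(\<Sum>j\<in>J - {i}. c j * a j f) - a i f / a i e * (\<Sum>j\<in>J - {i}. c j * a j e) = 0"
        by (simp only: sum_subtractf sum_distrib_left)
      then show ?thesis unfolding split by (simp add: x_def)
    qed
    moreover have "\<exists>j\<in>J. (c(i := x)) j \<noteq> 0" using c(1) by auto
    ultimately show ?thesis by (intro exI[of _ "c(i := x)"]) auto
  qed
qed

text \<open>Orthogonality to the vectors already found is itself a linear condition. The next vector
  solves the system enlarged by these conditions, and only has to be normalised.\<close>

lemma orthonormal_solutions:
  fixes a :: "'j \<Rightarrow> 'e \<Rightarrow> complex"
  assumes "finite E" "finite J" "card E + d \<le> card J"
  shows "\<exists>c. (\<forall>i<d. \<forall>k<d. (\<Sum>j\<in>J. c i j * cnj (c k j)) = (if i = k then 1 else 0)) \<and>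
     (\<forall>i<d. \<forall>e\<in>E. (\<Sum>j\<in>J. c i j * a j e) = 0)"
  using assms(3)
proof (induction d)
  case 0
  then show ?case by simp
next
  case (Suc d)
  then have "card E + d \<le> card J" by simp
  from Suc.IH[OF this] obtain c where c: "\<And>i k. i < d \<Longrightarrow> k < d \<Longrightarrow> (\<Sum>j\<in>J. c i j * cnj (c k j)) = (if i = k then 1 else 0)"
     "\<And>i e. i < d \<Longrightarrow> e \<in> E \<Longrightarrow> (\<Sum>j\<in>J. c i j * a j e) = 0" by blast
  define b where "b = (\<lambda>j. case_sum (a j) (\<lambda>k. cnj (c k j)))"
  have "card (E <+> {..<d}) < card J"
    using Suc.prems assms by (simp add: card_Plus)
  then obtain v where v: "\<exists>j\<in>J. v j \<noteq> 0" "\<forall>e\<in>E <+> {..<d}. (\<Sum>j\<in>J. v j * b j e) = 0"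
    using homogeneous_system_nontrivial_solution[of "E <+> {..<d}" J b] assms by auto
  define s where "s = (\<Sum>j\<in>J. (cmod (v j))\<^sup>2)"
  have s: "s > 0" unfolding s_def using v(1) assms(2) by (metis (no_types, lifting) sum_pos2 zero_le_power2 zero_less_norm_iff zero_less_power)
  define w where "w = (\<lambda>j. v j / complex_of_real (sqrt s))"
  have vE: "(\<Sum>j\<in>J. v j * a j e) = 0" if "e \<in> E" for e
    using v(2) that by (auto simp: b_def dest: bspec[where x = "Inl e"])
  have vc: "(\<Sum>j\<in>J. v j * cnj (c k j)) = 0" if "k < d" for k
    using v(2) that by (auto simp: b_def dest: bspec[where x = "Inr k"])
  have wE: "(\<Sum>j\<in>J. w j * a j e) = 0" if "e \<in> E" for e
    using vE[OF that] by (simp add: w_def flip: sum_divide_distrib)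
  have wc: "(\<Sum>j\<in>J. w j * cnj (c k j)) = 0" if "k < d" for k
    using vc[OF that] by (simp add: w_def flip: sum_divide_distrib)
  have cw: "(\<Sum>j\<in>J. c k j * cnj (w j)) = 0" if "k < d" for k
  proof -
    have "(\<Sum>j\<in>J. c k j * cnj (w j)) = cnj (\<Sum>j\<in>J. w j * cnj (c k j))" by (simp add: mult.commute)
    then show ?thesis using wc[OF that] by simp
  qed
  have ww: "(\<Sum>j\<in>J. w j * cnj (w j)) = 1"
  proof -
    have "(\<Sum>j\<in>J. w j * cnj (w j)) = (\<Sum>j\<in>J. complex_of_real ((cmod (v j))\<^sup>2)) / complex_of_real s"
      unfolding sum_divide_distrib
    proof (intro sum.cong refl)
      fix j
      have "sqrt s * sqrt s = s" using s by simp
      then have ss: "complex_of_real (sqrt s) * complex_of_real (sqrt s) = complex_of_real s"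
        unfolding of_real_mult[symmetric] by (rule arg_cong)
      have "w j * cnj (w j) = v j * cnj (v j) / (complex_of_real (sqrt s) * complex_of_real (sqrt s))"
        unfolding w_def complex_cnj_divide complex_cnj_complex_of_real by (rule times_divide_times_eq)
      then show "w j * cnj (w j) = complex_of_real ((cmod (v j))\<^sup>2) / complex_of_real s"
        unfolding ss complex_norm_square .
    qed
    also have "(\<Sum>j\<in>J. complex_of_real ((cmod (v j))\<^sup>2)) = complex_of_real s"
      unfolding s_def of_real_sum ..
    also have "complex_of_real s / complex_of_real s = 1" using s by simp
    finally show ?thesis .
  qed
  show ?case
    by (rule exI[of _ "c(d := w)"]) (auto simp: less_Suc_eq c wE wc cw ww)
qed

lemma finite_Bessel_inequality:
  fixes c :: "nat \<Rightarrow> 'j \<Rightarrow> complex"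
  assumes "finite J" "\<And>i k. i < d \<Longrightarrow> k < d \<Longrightarrow> (\<Sum>j\<in>J. c i j * cnj (c k j)) = (if i = k then 1 else 0)"
  shows "(\<Sum>i<d. (cmod (\<Sum>j\<in>J. c i j * v j))\<^sup>2) \<le> (\<Sum>j\<in>J. (cmod (v j))\<^sup>2)"
proof -
  define \<alpha> where "\<alpha> = (\<lambda>i. \<Sum>j\<in>J. c i j * v j)"
  \<comment> \<open>The pairing of \<open>c i\<close> with \<open>v\<close> has no conjugate, so the
    relevant orthonormal family consists of the conjugates of the \<open>c i\<close>;
    \<open>u\<close> is the orthogonal projection of \<open>v\<close> onto their span.\<close>
  define u where "u = (\<lambda>j. \<Sum>i<d. \<alpha> i * cnj (c i j))"
  have vu: "(\<Sum>j\<in>J. v j * cnj (u j)) = (\<Sum>i<d. \<alpha> i * cnj (\<alpha> i))"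
  proof -
    have "(\<Sum>j\<in>J. v j * cnj (u j)) = (\<Sum>j\<in>J. \<Sum>i<d. cnj (\<alpha> i) * (c i j * v j))"
      by (simp add: u_def sum_distrib_left mult_ac)
    also have "\<dots> = (\<Sum>i<d. cnj (\<alpha> i) * (\<Sum>j\<in>J. c i j * v j))"
      by (subst sum.swap) (simp add: sum_distrib_left)
    finally show ?thesis by (simp add: \<alpha>_def mult.commute)
  qed
  have uu: "(\<Sum>j\<in>J. u j * cnj (u j)) = (\<Sum>i<d. \<alpha> i * cnj (\<alpha> i))"
  proof -
    have "(\<Sum>j\<in>J. u j * cnj (u j)) = (\<Sum>j\<in>J. \<Sum>i<d. \<Sum>k<d. \<alpha> i * cnj (\<alpha> k) * (c k j * cnj (c i j)))"
      by (simp add: u_def sum_product mult_ac)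
    also have "\<dots> = (\<Sum>i<d. \<Sum>k<d. \<alpha> i * cnj (\<alpha> k) * (\<Sum>j\<in>J. c k j * cnj (c i j)))"
      by (subst sum.swap, intro sum.cong refl, subst sum.swap) (simp add: sum_distrib_left)
    also have "\<dots> = (\<Sum>i<d. \<Sum>k<d. if k = i then \<alpha> i * cnj (\<alpha> k) else 0)"
      by (intro sum.cong refl) (simp add: assms(2))
    also have "\<dots> = (\<Sum>i<d. \<alpha> i * cnj (\<alpha> i))" by simp
    finally show ?thesis .
  qed
  have "complex_of_real (\<Sum>j\<in>J. (cmod (v j - u j))\<^sup>2) = (\<Sum>j\<in>J. (v j - u j) * cnj (v j - u j))"
    by (simp only: of_real_sum complex_norm_square)
  also have "\<dots> = (\<Sum>j\<in>J. v j * cnj (v j)) - (\<Sum>j\<in>J. v j * cnj (u j)) - cnj (\<Sum>j\<in>J. v j * cnj (u j)) + (\<Sum>j\<in>J. u j * cnj (u j))"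
    by (simp add: algebra_simps sum.distrib sum_subtractf)
  also have "\<dots> = (\<Sum>j\<in>J. v j * cnj (v j)) - (\<Sum>i<d. \<alpha> i * cnj (\<alpha> i))"
    unfolding vu uu by (simp add: mult.commute)
  also have "\<dots> = complex_of_real ((\<Sum>j\<in>J. (cmod (v j))\<^sup>2) - (\<Sum>i<d. (cmod (\<alpha> i))\<^sup>2))"
    by (simp only: of_real_sum complex_norm_square of_real_diff)
  finally have "(\<Sum>j\<in>J. (cmod (v j - u j))\<^sup>2) = (\<Sum>j\<in>J. (cmod (v j))\<^sup>2) - (\<Sum>i<d. (cmod (\<alpha> i))\<^sup>2)"
    by (simp only: of_real_eq_iff)
  moreover have "0 \<le> (\<Sum>j\<in>J. (cmod (v j - u j))\<^sup>2)" by (intro sum_nonneg) auto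
  ultimately show ?thesis by (simp add: \<alpha>_def)
qed

text \<open>A trace argument: sum the lower bound over an orthonormal family of \<open>card J - card K0\<close> coefficient
  vectors annihilated by the columns in \<open>K0\<close>, and bound the remaining columns by Bessel's inequality.\<close>

lemma dimension_comparison:
  fixes M :: "'j \<Rightarrow> 'k \<Rightarrow> complex"
  assumes J: "finite J" and K0: "finite K0" and A: "A > 0"
    and lower: "\<And>c \<eta>. \<eta> > 0 \<Longrightarrow> \<exists>F. finite F \<and> F \<subseteq> K \<and>
        A * (\<Sum>j\<in>J. (cmod (c j))\<^sup>2) - \<eta> \<le> (\<Sum>k\<in>F. (cmod (\<Sum>j\<in>J. c j * M j k))\<^sup>2)"
    and tail: "\<And>j F. j \<in> J \<Longrightarrow> finite F \<Longrightarrow> F \<subseteq> K - K0 \<Longrightarrow> (\<Sum>k\<in>F. (cmod (M j k))\<^sup>2) \<le> \<epsilon>"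
  shows "A * (real (card J) - real (card K0)) \<le> \<epsilon> * real (card J)"
proof (cases "card J \<le> card K0")
  case True
  have "0 \<le> \<epsilon> * real (card J)"
  proof (cases "J = {}")
    case False
    \<comment> \<open>The empty set of columns in \<open>tail\<close> shows that
      \<open>\<epsilon>\<close> is nonnegative.\<close>
    then show ?thesis using tail[of _ "{}"] by auto
  qed simp
  moreover have "A * (real (card J) - real (card K0)) \<le> 0"
    using True A by (intro mult_nonneg_nonpos) auto
  ultimately show ?thesis by linarith
next
  case False
  define d where "d = card J - card K0"
  have d: "d > 0" "card K0 + d \<le> card J" "real d = real (card J) - real (card K0)"
    using False by (auto simp: d_def)
  obtain c where c: "\<And>i k. i < d \<Longrightarrow> k < d \<Longrightarrow> (\<Sum>j\<in>J. c i j * cnj (c k j)) = (if i = k then 1 else 0)"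
     "\<And>i k. i < d \<Longrightarrow> k \<in> K0 \<Longrightarrow> (\<Sum>j\<in>J. c i j * M j k) = 0"
    using orthonormal_solutions[OF K0 J d(2), of M] by blast
  have norm1: "(\<Sum>j\<in>J. (cmod (c i j))\<^sup>2) = 1" if "i < d" for i
  proof -
    have "complex_of_real (\<Sum>j\<in>J. (cmod (c i j))\<^sup>2) = 1"
      using c(1)[OF that that] by (simp only: of_real_sum complex_norm_square if_True simp_thms)
    then show ?thesis using of_real_eq_1_iff by blast
  qed
  show ?thesis
  proof (rule field_le_epsilon)
    fix e :: real assume "e > 0"
    \<comment> \<open>The error is split evenly over the \<open>d\<close> coefficient
      vectors.\<close>
    then have "e / real d > 0" using d by simp
    define Q where "Q = (\<lambda>i F. finite F \<and> F \<subseteq> K \<and>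
        A * (\<Sum>j\<in>J. (cmod (c i j))\<^sup>2) - e / real d \<le> (\<Sum>k\<in>F. (cmod (\<Sum>j\<in>J. c i j * M j k))\<^sup>2))"
    have "\<forall>i. \<exists>F. Q i F"
      unfolding Q_def using lower[OF \<open>e / real d > 0\<close>] by blast
    then obtain F where "\<forall>i. Q i (F i)" by (rule choice[THEN exE])
    then have F: "\<And>i. finite (F i)" "\<And>i. F i \<subseteq> K"
      "\<And>i. A * (\<Sum>j\<in>J. (cmod (c i j))\<^sup>2) - e / real d \<le> (\<Sum>k\<in>F i. (cmod (\<Sum>j\<in>J. c i j * M j k))\<^sup>2)"
      unfolding Q_def by blast+
    \<comment> \<open>One finite set of columns for all \<open>d\<close> vectors; the columns of
      \<open>K0\<close> can be removed because every vector annihilates them.\<close>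
    define G where "G = (\<Union>i<d. F i) - K0"
    have G: "finite G" "G \<subseteq> K - K0" using F by (auto simp: G_def)
    have "A - e / real d \<le> (\<Sum>k\<in>G. (cmod (\<Sum>j\<in>J. c i j * M j k))\<^sup>2)" if "i < d" for i
    proof -
      have "A - e / real d \<le> (\<Sum>k\<in>F i. (cmod (\<Sum>j\<in>J. c i j * M j k))\<^sup>2)"
        using F(3)[of i] norm1[OF that] by simp
      also have "\<dots> = (\<Sum>k\<in>F i - K0. (cmod (\<Sum>j\<in>J. c i j * M j k))\<^sup>2)"
        by (rule sum.mono_neutral_right) (use F c(2)[OF that] in auto)
      also have "\<dots> \<le> (\<Sum>k\<in>G. (cmod (\<Sum>j\<in>J. c i j * M j k))\<^sup>2)"
        by (rule sum_mono2) (use G that in \<open>auto simp: G_def\<close>)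
      finally show ?thesis .
    qed
    then have "(\<Sum>i<d. A - e / real d) \<le> (\<Sum>i<d. \<Sum>k\<in>G. (cmod (\<Sum>j\<in>J. c i j * M j k))\<^sup>2)"
      by (intro sum_mono) auto
    also have "\<dots> = (\<Sum>k\<in>G. \<Sum>i<d. (cmod (\<Sum>j\<in>J. c i j * M j k))\<^sup>2)" by (rule sum.swap)
    \<comment> \<open>For each column \<open>k\<close> this is Bessel's inequality for the vector of
      the entries \<open>M j k\<close>. After the exchange of sums, \<open>tail\<close> applies row
      by row.\<close>
    also have "\<dots> \<le> (\<Sum>k\<in>G. \<Sum>j\<in>J. (cmod (M j k))\<^sup>2)"
      by (intro sum_mono finite_Bessel_inequality J c)
    also have "\<dots> = (\<Sum>j\<in>J. \<Sum>k\<in>G. (cmod (M j k))\<^sup>2)" by (rule sum.swap)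
    also have "\<dots> \<le> (\<Sum>j\<in>J. \<epsilon>)" by (intro sum_mono tail G)
    finally have "(\<Sum>i<d. A - e / real d) \<le> \<epsilon> * real (card J)" by (simp add: mult.commute)
    moreover have "(\<Sum>i<d. A - e / real d) = A * real d - e"
      using d(1) by (simp add: right_diff_distrib mult.commute)
    ultimately show "A * (real (card J) - real (card K0)) \<le> \<epsilon> * real (card J) + e"
      using d(3) by simp
  qed
qed

section \<open>Existence of the densities\<close>

lemma ud_separated:
  fixes \<Lambda> :: "nat \<Rightarrow> (real \<times> real) set"
  assumes "\<forall>n\<in>{1..N}. uniformly_discrete (\<Lambda> n)"
  shows "\<exists>\<delta>>0. \<forall>n\<in>{1..N}. separated \<delta> (\<Lambda> n)"
proof -
  have "\<forall>n\<in>{1..N}. \<exists>\<delta>>0. separated \<delta> (\<Lambda> n)"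
    using assms unfolding uniformly_discrete_def separated_def by blast
  then obtain \<delta> where \<delta>: "\<forall>n\<in>{1..N}. \<delta> n > 0 \<and> separated (\<delta> n) (\<Lambda> n)"
    unfolding bchoice_iff by blast
  define d where "d = Min (insert 1 (\<delta> ` {1..N}))"
  have "d > 0" using \<delta> by (auto simp: d_def)
  moreover have "separated d (\<Lambda> n)" if n: "n \<in> {1..N}" for n
  proof -
    have "d \<le> \<delta> n" unfolding d_def using n by (intro Min_le) auto
    then show ?thesis using \<delta> n unfolding separated_def by (meson le_less_trans)
  qed
  ultimately show ?thesis by blast
qed

lemma ud_count_bound:
  fixes \<Lambda> :: "nat \<Rightarrow> (real \<times> real) set"
  assumes "\<forall>n\<in>{1..N}. uniformly_discrete (\<Lambda> n)"
  shows "\<exists>C\<ge>0. \<forall>p R. R \<ge> 0 \<longrightarrow> count_in N \<Lambda> p R \<le> C * (R + 1)\<^sup>2"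
    and "n \<in> {1..N} \<Longrightarrow> finite (\<Lambda> n \<inter> square p R)"
proof -
  obtain \<delta> where \<delta>: "\<delta> > 0" "\<forall>n\<in>{1..N}. separated \<delta> (\<Lambda> n)"
    using ud_separated[OF assms] by blast
  obtain m where m: "m > 0" "2 / real m \<le> \<delta>" using cell_scale_exists[OF \<delta>(1)] by blast
  have "count_in N \<Lambda> p R \<le> real N * (2 * real m)\<^sup>2 * (R + 1)\<^sup>2" if R: "R \<ge> 0" for p R
  proof -
    have "count_in N \<Lambda> p R \<le> (\<Sum>n=1..N. (2 * real m * (R + 1))\<^sup>2)"
      unfolding count_in_def
    proof (rule sum_mono)
      fix n assume n: "n \<in> {1..N}"
      have "real (card (\<Lambda> n \<inter> square p R)) \<le> (2 * real m * R + 2)\<^sup>2"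
        by (rule separated_card_square[OF bspec[OF \<delta>(2) n] m R])
      also have "\<dots> \<le> (2 * real m * (R + 1))\<^sup>2"
        using m R by (intro power_mono) (auto simp: algebra_simps)
      finally show "real (card (\<Lambda> n \<inter> square p R)) \<le> (2 * real m * (R + 1))\<^sup>2" .
    qed
    then show ?thesis by (simp add: power_mult_distrib)
  qed
  then show "\<exists>C\<ge>0. \<forall>p R. R \<ge> 0 \<longrightarrow> count_in N \<Lambda> p R \<le> C * (R + 1)\<^sup>2"
    by (intro exI[of _ "real N * (2 * real m)\<^sup>2"]) auto
  show "finite (\<Lambda> n \<inter> square p R)" if n: "n \<in> {1..N}"
  proof (cases "R \<ge> 0")
    case True
    then show ?thesis by (rule separated_card_square[OF bspec[OF \<delta>(2) n] m])
  next
    case False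
    then have "square p R = {}" by (auto simp: square_def)
    then show ?thesis by simp
  qed
qed

lemma count_in_nonneg [simp]: "0 \<le> count_in N \<Lambda> p R"
  by (simp add: count_in_def sum_nonneg)

lemma interval_cover:
  fixes x a R \<rho> :: real
  assumes "\<rho> > 0" "k > 0" "R \<le> real k * \<rho>" "\<bar>x - a\<bar> \<le> R"
  shows "\<exists>i<k. \<bar>x - (a - R + (2 * real i + 1) * \<rho>)\<bar> \<le> \<rho>"
proof -
  define y where "y = (x - a + R) / (2 * \<rho>)"
  have y: "0 \<le> y" "y \<le> real k" "x = a - R + 2 * \<rho> * y"
    using assms by (auto simp: y_def abs_le_iff pos_divide_le_eq)
  obtain i where i: "i < k" "real i \<le> y" "y \<le> real i + 1"
  \<comment> \<open>At the right end the floor of \<open>y\<close> would be \<open>k\<close>, one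
    too many; this point is assigned to the last subinterval.\<close>
  proof (cases "y = real k")
    case True
    then show ?thesis using that[of "k - 1"] assms(2) by (simp add: of_nat_diff)
  next
    case False
    then have "y < real k" using y by simp
    then show ?thesis using that[of "nat \<lfloor>y\<rfloor>"] y(1) by (auto simp: nat_less_iff floor_less_iff)
  qed
  have "x - (a - R + (2 * real i + 1) * \<rho>) = \<rho> * (2 * (y - real i) - 1)"
    unfolding y(3) by (simp add: algebra_simps)
  also have "\<bar>\<dots>\<bar> \<le> \<rho> * 1"
    unfolding abs_mult using i assms(1) by (intro mult_mono) auto
  finally show ?thesis using i by auto
qed

lemma count_in_subadditive:
  assumes ud: "\<forall>n\<in>{1..N}. uniformly_discrete (\<Lambda> n)"
    and "\<rho> > 0" "k > 0" "R \<le> real k * \<rho>" and U: "\<And>q. count_in N \<Lambda> q \<rho> \<le> U"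
  shows "count_in N \<Lambda> p R \<le> (real k)\<^sup>2 * U"
proof -
  define c where "c = (\<lambda>(i, j). (fst p - R + (2 * real i + 1) * \<rho>, snd p - R + (2 * real j + 1) * \<rho>))"
  let ?I = "{..<k} \<times> {..<k}"
  have cover: "square p R \<subseteq> (\<Union>ij\<in>?I. square (c ij) \<rho>)"
  proof
    fix z assume "z \<in> square p R"
    then have z: "\<bar>fst z - fst p\<bar> \<le> R" "\<bar>snd z - snd p\<bar> \<le> R" by (auto simp: square_def)
    obtain i where i: "i < k" "\<bar>fst z - (fst p - R + (2 * real i + 1) * \<rho>)\<bar> \<le> \<rho>"
      using interval_cover[OF assms(2-4) z(1)] by blast
    obtain j where j: "j < k" "\<bar>snd z - (snd p - R + (2 * real j + 1) * \<rho>)\<bar> \<le> \<rho>"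
      using interval_cover[OF assms(2-4) z(2)] by blast
    have "z \<in> square (c (i, j)) \<rho>" using i j by (simp add: square_def c_def case_prod_unfold)
    then show "z \<in> (\<Union>ij\<in>?I. square (c ij) \<rho>)" using i j by blast
  qed
  have "count_in N \<Lambda> p R \<le> (\<Sum>n=1..N. \<Sum>ij\<in>?I. real (card (\<Lambda> n \<inter> square (c ij) \<rho>)))"
    unfolding count_in_def
  proof (rule sum_mono)
    fix n assume n: "n \<in> {1..N}"
    have fin: "finite (\<Lambda> n \<inter> square q \<rho>)" for q by (rule ud_count_bound(2)[OF ud n])
    have "card (\<Lambda> n \<inter> square p R) \<le> card (\<Union>ij\<in>?I. \<Lambda> n \<inter> square (c ij) \<rho>)"
      using cover by (intro card_mono finite_UN_I fin) auto
    also have "\<dots> \<le> (\<Sum>ij\<in>?I. card (\<Lambda> n \<inter> square (c ij) \<rho>))"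
      by (rule card_UN_le) simp
    finally show "real (card (\<Lambda> n \<inter> square p R)) \<le> (\<Sum>ij\<in>?I. real (card (\<Lambda> n \<inter> square (c ij) \<rho>)))"
      unfolding of_nat_sum[symmetric] of_nat_le_iff .
  qed
  also have "\<dots> = (\<Sum>ij\<in>?I. count_in N \<Lambda> (c ij) \<rho>)"
    unfolding count_in_def by (rule sum.swap)
  also have "\<dots> \<le> (\<Sum>ij\<in>?I. U)" by (intro sum_mono U)
  finally show ?thesis by (simp add: power2_eq_square)
qed

text \<open>Centres at spacing \<open>2 * \<sigma>\<close> leave gaps between closed squares of
  radius \<open>\<rho>\<close>, so no point is counted twice, and
  \<open>k * \<sigma> \<le> R\<close> keeps the squares inside the large one.\<close>

lemma count_in_superadditive:
  assumes ud: "\<forall>n\<in>{1..N}. uniformly_discrete (\<Lambda> n)"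
    and \<rho>: "0 < \<rho>" "\<rho> < \<sigma>" "real k * \<sigma> \<le> R" and L: "\<And>q. l \<le> count_in N \<Lambda> q \<rho>"
  shows "(real k)\<^sup>2 * l \<le> count_in N \<Lambda> p R"
proof -
  define c where "c = (\<lambda>(i, j). (fst p - R + (2 * real i + 1) * \<sigma>, snd p - R + (2 * real j + 1) * \<sigma>))"
  let ?I = "{..<k} \<times> {..<k}"
  have inside: "\<bar>x - a\<bar> \<le> R" if "i < k" "\<bar>x - (a - R + (2 * real i + 1) * \<sigma>)\<bar> \<le> \<rho>" for x a :: real and i
  proof -
    have "(real i + 1) * \<sigma> \<le> real k * \<sigma>" using that \<rho> by (intro mult_right_mono) auto
    then have "(2 * real i + 1) * \<sigma> + \<sigma> \<le> 2 * R" using \<rho>(3) by (simp add: algebra_simps)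
    moreover have "\<sigma> \<le> (2 * real i + 1) * \<sigma>" using \<rho> by simp
    ultimately show ?thesis using that(2) \<rho> unfolding abs_le_iff by linarith
  qed
  have disj1: "i = i'" if "\<bar>x - (a - R + (2 * real i + 1) * \<sigma>)\<bar> \<le> \<rho>" "\<bar>x - (a - R + (2 * real i' + 1) * \<sigma>)\<bar> \<le> \<rho>" for x a :: real and i i' :: nat
  proof -
    have "(2 * real i + 1) * \<sigma> - (2 * real i' + 1) * \<sigma> = 2 * (real i - real i') * \<sigma>"
      by (simp add: algebra_simps)
    then have "\<bar>2 * (real i - real i') * \<sigma>\<bar> \<le> 2 * \<rho>" using that unfolding abs_le_iff by linarith
    moreover have "\<bar>2 * (real i - real i') * \<sigma>\<bar> = 2 * (\<bar>real i - real i'\<bar> * \<sigma>)"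
      using \<rho> unfolding abs_mult by simp
    ultimately have "\<bar>real i - real i'\<bar> * \<sigma> < 1 * \<sigma>" using \<rho> by linarith
    then have "\<bar>real i - real i'\<bar> < 1" using \<rho> by (simp only: mult_less_cancel_right_pos)
    then show ?thesis by linarith
  qed
  have "(\<Sum>ij\<in>?I. l) \<le> (\<Sum>ij\<in>?I. count_in N \<Lambda> (c ij) \<rho>)" by (intro sum_mono L)
  also have "\<dots> = (\<Sum>n=1..N. \<Sum>ij\<in>?I. real (card (\<Lambda> n \<inter> square (c ij) \<rho>)))"
    unfolding count_in_def by (rule sum.swap)
  also have "\<dots> \<le> count_in N \<Lambda> p R"
    unfolding count_in_def
  proof (rule sum_mono)
    fix n assume n: "n \<in> {1..N}"
    have fin: "finite (\<Lambda> n \<inter> square q r)" for q r by (rule ud_count_bound(2)[OF ud n])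
    have "(\<Sum>ij\<in>?I. card (\<Lambda> n \<inter> square (c ij) \<rho>)) = card (\<Union>ij\<in>?I. \<Lambda> n \<inter> square (c ij) \<rho>)"
    proof (rule card_UN_disjoint[symmetric])
      show "\<forall>ij\<in>?I. \<forall>ij'\<in>?I. ij \<noteq> ij' \<longrightarrow> (\<Lambda> n \<inter> square (c ij) \<rho>) \<inter> (\<Lambda> n \<inter> square (c ij') \<rho>) = {}"
      proof (intro ballI impI)
        fix ij ij' :: "nat \<times> nat" assume ne: "ij \<noteq> ij'"
        have False if z: "z \<in> square (c ij) \<rho>" "z \<in> square (c ij') \<rho>" for z
        proof -
          have "fst ij = fst ij'" "snd ij = snd ij'"
            using z disj1[of "fst z" "fst p" "fst ij" "fst ij'"] disj1[of "snd z" "snd p" "snd ij" "snd ij'"]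
            by (auto simp: square_def c_def case_prod_unfold)
          then show False using ne by (simp add: prod_eq_iff)
        qed
        then show "(\<Lambda> n \<inter> square (c ij) \<rho>) \<inter> (\<Lambda> n \<inter> square (c ij') \<rho>) = {}" by blast
      qed
    qed (use fin in auto)
    also have "\<dots> \<le> card (\<Lambda> n \<inter> square p R)"
    proof (rule card_mono[OF fin])
      have "z \<in> square p R" if "ij \<in> ?I" "z \<in> square (c ij) \<rho>" for z ij
        using that inside[of "fst ij" "fst z" "fst p"] inside[of "snd ij" "snd z" "snd p"]
        by (auto simp: square_def c_def case_prod_unfold)
      then show "(\<Union>ij\<in>?I. \<Lambda> n \<inter> square (c ij) \<rho>) \<subseteq> \<Lambda> n \<inter> square p R" by blast
    qed
    finally show "(\<Sum>ij\<in>?I. real (card (\<Lambda> n \<inter> square (c ij) \<rho>))) \<le> real (card (\<Lambda> n \<inter> square p R))"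
      unfolding of_nat_sum[symmetric] of_nat_le_iff .
  qed
  finally show ?thesis by (simp add: power2_eq_square)
qed

lemma tendsto_affine_ratio_sq:
  "((\<lambda>R::real. ((a * R + b) / (2 * R))\<^sup>2) \<longlongrightarrow> (a / 2)\<^sup>2) at_top"
proof -
  have "((\<lambda>R. (a / 2 + b / 2 * inverse R)\<^sup>2) \<longlongrightarrow> (a / 2 + b / 2 * 0)\<^sup>2) at_top"
    by (intro tendsto_intros tendsto_inverse_0_at_top filterlim_ident)
  then have "((\<lambda>R. (a / 2 + b / 2 * inverse R)\<^sup>2) \<longlongrightarrow> (a / 2)\<^sup>2) at_top" by simp
  moreover have "\<forall>\<^sub>F R in at_top. (a / 2 + b / 2 * inverse R)\<^sup>2 = ((a * R + b) / (2 * R))\<^sup>2"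
    using eventually_gt_at_top[of 0] by eventually_elim (simp add: field_simps)
  ultimately show ?thesis by (rule Lim_transform_eventually)
qed

text \<open>Fekete's argument in dimension two: the limit is the infimum. For fixed
  \<open>\<rho>\<close> the bound on the quotient at \<open>R\<close> tends to the quotient at
  \<open>\<rho>\<close>; the \<open>+ 1\<close> pays for rounding up the number of squares per
  side.\<close>

lemma subadditive_density_converges:
  fixes u :: "real \<Rightarrow> real"
  assumes u0: "\<And>R. 0 \<le> u R" and sub: "\<And>\<rho> R. 0 < \<rho> \<Longrightarrow> 0 < R \<Longrightarrow> u R \<le> (R / \<rho> + 1)\<^sup>2 * u \<rho>"
  shows "\<exists>L. ((\<lambda>R. u R / (2 * R)\<^sup>2) \<longlongrightarrow> L) at_top"
proof -
  define L where "L = (INF R\<in>{0<..}. u R / (2 * R)\<^sup>2)"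
  have bdd: "bdd_below ((\<lambda>R. u R / (2 * R)\<^sup>2) ` {0<..})"
    by (rule bdd_belowI[of _ 0]) (auto simp: u0)
  have "((\<lambda>R. u R / (2 * R)\<^sup>2) \<longlongrightarrow> L) at_top"
  proof (rule order_tendstoI)
    fix a assume "a < L"
    show "\<forall>\<^sub>F R in at_top. a < u R / (2 * R)\<^sup>2"
      using eventually_gt_at_top[of 0]
    proof eventually_elim
      case (elim R)
      then have "L \<le> u R / (2 * R)\<^sup>2" unfolding L_def by (intro cINF_lower bdd) auto
      with \<open>a < L\<close> show ?case by linarith
    qed
  next
    fix a assume "L < a"
    then obtain \<rho> where \<rho>: "\<rho> > 0" "u \<rho> / (2 * \<rho>)\<^sup>2 < a"
      unfolding L_def using cINF_less_iff[OF _ bdd] by auto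
    have "((\<lambda>R. ((1 / \<rho> * R + 1) / (2 * R))\<^sup>2 * u \<rho>) \<longlongrightarrow> (1 / \<rho> / 2)\<^sup>2 * u \<rho>) at_top"
      by (intro tendsto_intros tendsto_affine_ratio_sq)
    moreover have "(1 / \<rho> / 2)\<^sup>2 * u \<rho> < a" using \<rho> by (simp add: power_divide power_mult_distrib mult.commute)
    ultimately have "\<forall>\<^sub>F R in at_top. ((1 / \<rho> * R + 1) / (2 * R))\<^sup>2 * u \<rho> < a"
      by (rule order_tendstoD)
    then show "\<forall>\<^sub>F R in at_top. u R / (2 * R)\<^sup>2 < a"
      using eventually_gt_at_top[of 0]
    proof eventually_elim
      case (elim R)
      have "u R / (2 * R)\<^sup>2 \<le> (R / \<rho> + 1)\<^sup>2 * u \<rho> / (2 * R)\<^sup>2"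
        using sub[OF \<rho>(1) elim(2)] by (rule divide_right_mono) simp
      then show ?case using elim(1) by (simp add: power_divide)
    qed
  qed
  then show ?thesis by blast
qed

text \<open>Closed squares of equal size that tile a larger one share edges, so packing disjoint copies costs a gap:
  hence \<open>\<rho> + 1\<close> in place of \<open>\<rho>\<close>.\<close>

lemma superadditive_density_converges:
  fixes l :: "real \<Rightarrow> real"
  assumes l0: "\<And>R. 0 \<le> l R" and up: "\<And>R. R > 0 \<Longrightarrow> l R \<le> C * (R + 1)\<^sup>2"
    and super: "\<And>\<rho> R. 0 < \<rho> \<Longrightarrow> \<rho> + 1 \<le> R \<Longrightarrow> (R / (\<rho> + 1) - 1)\<^sup>2 * l \<rho> \<le> l R"
  shows "\<exists>L. ((\<lambda>R. l R / (2 * R)\<^sup>2) \<longlongrightarrow> L) at_top"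
proof -
  \<comment> \<open>Each packed square of radius \<open>\<rho>\<close> takes room of radius
    \<open>\<rho> + 1\<close>, so the supremum is taken with that normalisation. The ratio of the
    two normalisations tends to 1.\<close>
  define L where "L = (SUP R\<in>{0<..}. l R / (2 * (R + 1))\<^sup>2)"
  have bdd: "bdd_above ((\<lambda>R. l R / (2 * (R + 1))\<^sup>2) ` {0<..})"
  proof (rule bdd_aboveI2)
    fix R :: real assume "R \<in> {0<..}"
    then have "l R \<le> C * (R + 1)\<^sup>2" "0 < (R + 1)\<^sup>2" using up by auto
    then have "l R / (R + 1)\<^sup>2 \<le> C" by (simp add: pos_divide_le_eq)
    then show "l R / (2 * (R + 1))\<^sup>2 \<le> C / 4"
      by (simp add: power_mult_distrib del: distrib_left_numeral)
  qed
  have "((\<lambda>R. l R / (2 * R)\<^sup>2) \<longlongrightarrow> L) at_top"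
  proof (rule order_tendstoI)
    fix a assume "L < a"
    have "((\<lambda>R. L * ((2 * R + 2) / (2 * R))\<^sup>2) \<longlongrightarrow> L * (2 / 2)\<^sup>2) at_top"
      by (intro tendsto_intros tendsto_affine_ratio_sq)
    then have "\<forall>\<^sub>F R in at_top. L * ((2 * R + 2) / (2 * R))\<^sup>2 < a"
      using \<open>L < a\<close> by (intro order_tendstoD(2)) auto
    then show "\<forall>\<^sub>F R in at_top. l R / (2 * R)\<^sup>2 < a"
      using eventually_gt_at_top[of 0]
    proof eventually_elim
      case (elim R)
      have "l R / (2 * (R + 1))\<^sup>2 \<le> L" unfolding L_def using elim by (intro cSUP_upper bdd) auto
      then have "l R / (2 * (R + 1))\<^sup>2 * ((2 * R + 2) / (2 * R))\<^sup>2 \<le> L * ((2 * R + 2) / (2 * R))\<^sup>2"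
        by (rule mult_right_mono) simp
      moreover have "l R / (2 * (R + 1))\<^sup>2 * ((2 * R + 2) / (2 * R))\<^sup>2 = l R / (2 * R)\<^sup>2"
      proof -
        have "(2 * R + 2)\<^sup>2 = (2 * (R + 1))\<^sup>2" by (simp add: distrib_left)
        then show ?thesis using elim by (simp add: power_divide)
      qed
      ultimately show ?case using elim(1) by simp
    qed
  next
    fix a assume "a < L"
    then obtain \<rho> where \<rho>: "\<rho> > 0" "a < l \<rho> / (2 * (\<rho> + 1))\<^sup>2"
      unfolding L_def using less_cSUP_iff[OF _ bdd] by auto
    have "((\<lambda>R. ((1 / (\<rho> + 1) * R + (-1)) / (2 * R))\<^sup>2 * l \<rho>) \<longlongrightarrow> (1 / (\<rho> + 1) / 2)\<^sup>2 * l \<rho>) at_top"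
      by (intro tendsto_intros tendsto_affine_ratio_sq)
    moreover have "a < (1 / (\<rho> + 1) / 2)\<^sup>2 * l \<rho>" using \<rho> by (simp add: power_divide power_mult_distrib mult.commute)
    ultimately have "\<forall>\<^sub>F R in at_top. a < ((1 / (\<rho> + 1) * R + (-1)) / (2 * R))\<^sup>2 * l \<rho>"
      by (rule order_tendstoD)
    then show "\<forall>\<^sub>F R in at_top. a < l R / (2 * R)\<^sup>2"
      using eventually_ge_at_top[of "\<rho> + 1"]
    proof eventually_elim
      case (elim R)
      have "(R / (\<rho> + 1) - 1)\<^sup>2 * l \<rho> / (2 * R)\<^sup>2 \<le> l R / (2 * R)\<^sup>2"
        using super[OF \<rho>(1) elim(2)] by (rule divide_right_mono) simp
      then show ?case using elim(1) by (simp add: power_divide)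
    qed
  qed
  then show ?thesis by blast
qed

section \<open>From counting bounds at all scales to bounds on the densities\<close>

context
  fixes N :: nat and \<Lambda> :: "nat \<Rightarrow> (real \<times> real) set"
  assumes ud: "\<forall>n\<in>{1..N}. uniformly_discrete (\<Lambda> n)"
begin

lemma count_in_bdd_above: "R \<ge> 0 \<Longrightarrow> bdd_above (range (\<lambda>p. count_in N \<Lambda> p R))"
  using ud_count_bound(1)[OF ud] by (force intro: bdd_aboveI2)

lemma count_in_bdd_below: "bdd_below (range (\<lambda>p. count_in N \<Lambda> p R))"
  by (rule bdd_belowI2[of _ 0]) simp

lemma upper_density_le:
  assumes c: "0 \<le> c" and le: "\<And>p R. R > 0 \<Longrightarrow> c * count_in N \<Lambda> p R \<le> (2 * R + b)\<^sup>2"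
  shows "c * upper_density N \<Lambda> \<le> 1"
proof -
  \<comment> \<open>The value 0 at nonpositive radii gives nonnegativity for every \<open>R\<close>,
    as the convergence lemma requires, without affecting the limit at infinity.\<close>
  define u where "u = (\<lambda>R. if R > 0 then SUP p. count_in N \<Lambda> p R else 0)"
  have cu: "count_in N \<Lambda> p R \<le> u R" if "R > 0" for p R
    unfolding u_def using that count_in_bdd_above[of R] by (auto intro: cSUP_upper)
  have u0: "0 \<le> u R" for R
    using order_trans[OF count_in_nonneg cu[of R]] by (cases "R > 0") (auto simp: u_def)
  have "u R \<le> (R / \<rho> + 1)\<^sup>2 * u \<rho>" if "0 < \<rho>" "0 < R" for \<rho> R
  proof -
    define k where "k = nat \<lceil>R / \<rho>\<rceil>"
    have "R / \<rho> > 0" using that by simp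
    then have "0 < \<lceil>R / \<rho>\<rceil>" by simp
    then have "k > 0" "real k = of_int \<lceil>R / \<rho>\<rceil>" by (simp_all add: k_def)
    then have k: "k > 0" "R / \<rho> \<le> real k" "real k \<le> R / \<rho> + 1" by linarith+
    have "R \<le> real k * \<rho>" using k(2) that by (simp add: pos_divide_le_eq)
    then have "count_in N \<Lambda> p R \<le> (real k)\<^sup>2 * u \<rho>" for p
      by (rule count_in_subadditive[OF ud that(1) k(1) _ cu[OF that(1)]])
    then have "u R \<le> (real k)\<^sup>2 * u \<rho>" using that by (auto simp: u_def intro: cSUP_least)
    also have "\<dots> \<le> (R / \<rho> + 1)\<^sup>2 * u \<rho>" using k by (intro mult_right_mono power_mono u0) auto
    finally show ?thesis .
  qed
  from subadditive_density_converges[OF u0 this] obtain L where L: "((\<lambda>R. u R / (2 * R)\<^sup>2) \<longlongrightarrow> L) at_top"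
    by blast
  moreover have "\<forall>\<^sub>F R in at_top. u R / (2 * R)\<^sup>2 = (SUP p. count_in N \<Lambda> p R) / (2 * R)\<^sup>2"
    using eventually_gt_at_top[of 0] by eventually_elim (simp add: u_def)
  ultimately have "((\<lambda>R. (SUP p. count_in N \<Lambda> p R) / (2 * R)\<^sup>2) \<longlongrightarrow> L) at_top"
    by (rule Lim_transform_eventually)
  then have "upper_density N \<Lambda> = L"
    unfolding upper_density_def by (intro tendsto_Lim) auto
  moreover have "c * L \<le> (2 / 2)\<^sup>2"
  proof (rule tendsto_le[OF _ tendsto_affine_ratio_sq[of 2 b] tendsto_mult[OF tendsto_const L]])
    show "\<forall>\<^sub>F R in at_top. c * (u R / (2 * R)\<^sup>2) \<le> ((2 * R + b) / (2 * R))\<^sup>2"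
      using eventually_gt_at_top[of 0]
    proof eventually_elim
      case (elim R)
      have "c * u R \<le> (2 * R + b)\<^sup>2"
      proof (cases "c = 0")
        case False
        then have "c > 0" using c by simp
        then have "count_in N \<Lambda> p R \<le> (2 * R + b)\<^sup>2 / c" for p
          using le[OF elim, of p] by (simp add: pos_le_divide_eq mult.commute)
        then have "u R \<le> (2 * R + b)\<^sup>2 / c" using elim by (auto simp: u_def intro: cSUP_least)
        then show ?thesis using \<open>c > 0\<close> by (simp add: pos_le_divide_eq mult.commute)
      qed simp
      then show ?case by (simp add: power_divide divide_right_mono)
    qed
  qed simp
  ultimately show ?thesis by simp
qed

lemma lower_density_ge:
  assumes ge: "\<And>p R. R > R0 \<Longrightarrow> (2 * R - a)\<^sup>2 - \<theta> * (2 * R + b)\<^sup>2 \<le> count_in N \<Lambda> p R"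
  shows "1 - \<theta> \<le> lower_density N \<Lambda>"
proof -
  define l where "l = (\<lambda>R. INF p. count_in N \<Lambda> p R)"
  have cl: "l R \<le> count_in N \<Lambda> p R" for p R
    unfolding l_def by (intro cINF_lower count_in_bdd_below) simp
  have l0: "0 \<le> l R" for R unfolding l_def by (intro cINF_greatest) auto
  obtain C where C: "C \<ge> 0" "\<And>p R. R \<ge> 0 \<Longrightarrow> count_in N \<Lambda> p R \<le> C * (R + 1)\<^sup>2"
    using ud_count_bound(1)[OF ud] by blast
  have up: "l R \<le> C * (R + 1)\<^sup>2" if "R > 0" for R
    using order_trans[OF cl[of R 0] C(2)[of R 0]] that by simp
  have "(R / (\<rho> + 1) - 1)\<^sup>2 * l \<rho> \<le> l R" if "0 < \<rho>" "\<rho> + 1 \<le> R" for \<rho> R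
  proof -
    \<comment> \<open>Rounding down: \<open>k\<close> squares per side fit when each occupies radius
      \<open>\<rho> + 1\<close>, which takes the place of \<open>\<sigma>\<close> in the
      packing.\<close>
    define k where "k = nat \<lfloor>R / (\<rho> + 1)\<rfloor>"
    have "R / (\<rho> + 1) \<ge> 1" using that by simp
    moreover from this have "real k = of_int \<lfloor>R / (\<rho> + 1)\<rfloor>" by (simp add: k_def)
    ultimately have k: "real k \<le> R / (\<rho> + 1)" "R / (\<rho> + 1) - 1 \<le> real k" "0 \<le> R / (\<rho> + 1) - 1"
      by linarith+
    have kR: "real k * (\<rho> + 1) \<le> R" using k(1) that by (simp add: pos_le_divide_eq)
    have "(real k)\<^sup>2 * l \<rho> \<le> count_in N \<Lambda> p R" for p
      by (rule count_in_superadditive[OF ud that(1) _ kR cl]) simp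
    then have "(real k)\<^sup>2 * l \<rho> \<le> l R" unfolding l_def by (intro cINF_greatest) auto
    moreover have "(R / (\<rho> + 1) - 1)\<^sup>2 * l \<rho> \<le> (real k)\<^sup>2 * l \<rho>"
      using k by (intro mult_right_mono power_mono l0) auto
    ultimately show ?thesis by linarith
  qed
  from superadditive_density_converges[OF l0 up this] obtain L where L: "((\<lambda>R. l R / (2 * R)\<^sup>2) \<longlongrightarrow> L) at_top"
    by blast
  then have "lower_density N \<Lambda> = L"
    unfolding lower_density_def l_def by (intro tendsto_Lim) auto
  moreover have "(2 / 2)\<^sup>2 - \<theta> * (2 / 2)\<^sup>2 \<le> L"
  proof (rule tendsto_le[OF _ L tendsto_diff[OF tendsto_affine_ratio_sq[of 2 "- a"]
          tendsto_mult[OF tendsto_const tendsto_affine_ratio_sq[of 2 b]]]])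
    show "\<forall>\<^sub>F R in at_top. ((2 * R + - a) / (2 * R))\<^sup>2 - \<theta> * ((2 * R + b) / (2 * R))\<^sup>2 \<le> l R / (2 * R)\<^sup>2"
      using eventually_gt_at_top[of R0]
    proof eventually_elim
      case (elim R)
      have "(2 * R - a)\<^sup>2 - \<theta> * (2 * R + b)\<^sup>2 \<le> l R"
        unfolding l_def by (intro cINF_greatest ge elim) auto
      then have "((2 * R - a)\<^sup>2 - \<theta> * (2 * R + b)\<^sup>2) / (2 * R)\<^sup>2 \<le> l R / (2 * R)\<^sup>2"
        by (rule divide_right_mono) simp
      then show ?case
        unfolding power_divide times_divide_eq_right diff_divide_distrib[symmetric] add_uminus_conv_diff .
    qed
  qed simp
  ultimately show ?thesis by simp
qed

end

section \<open>The density theorem\<close>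

lemma card_Ints_interval:
  fixes a R :: real
  assumes "R \<ge> 1/2"
  shows "finite {x \<in> \<int>. \<bar>x - a\<bar> \<le> R}" "2 * R - 1 \<le> real (card {x \<in> \<int>. \<bar>x - a\<bar> \<le> R})"
    "real (card {x \<in> \<int>. \<bar>x - a\<bar> \<le> R}) \<le> 2 * R + 1"
proof -
  have eq: "{x \<in> \<int>. \<bar>x - a\<bar> \<le> R} = real_of_int ` {\<lceil>a - R\<rceil>..\<lfloor>a + R\<rfloor>}"
  proof (intro set_eqI iffI)
    fix x assume "x \<in> {x \<in> \<int>. \<bar>x - a\<bar> \<le> R}"
    then obtain i where "x = of_int i" "a - R \<le> x" "x \<le> a + R" by (auto simp: Ints_def abs_le_iff)
    then show "x \<in> real_of_int ` {\<lceil>a - R\<rceil>..\<lfloor>a + R\<rfloor>}" by (auto simp: ceiling_le_iff le_floor_iff)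
  qed (auto simp: ceiling_le_iff le_floor_iff abs_le_iff)
  show "finite {x \<in> \<int>. \<bar>x - a\<bar> \<le> R}" unfolding eq by simp
  have "card {x \<in> \<int>. \<bar>x - a\<bar> \<le> R} = card {\<lceil>a - R\<rceil>..\<lfloor>a + R\<rfloor>}"
    unfolding eq by (rule card_image) (simp add: inj_on_def)
  then have card: "real (card {x \<in> \<int>. \<bar>x - a\<bar> \<le> R}) = real (nat (\<lfloor>a + R\<rfloor> + 1 - \<lceil>a - R\<rceil>))" by simp
  show "2 * R - 1 \<le> real (card {x \<in> \<int>. \<bar>x - a\<bar> \<le> R})" "real (card {x \<in> \<int>. \<bar>x - a\<bar> \<le> R}) \<le> 2 * R + 1"
    unfolding card using assms by linarith+
qed

lemma lattice_square:
  "lattice \<inter> square p R = {x \<in> \<int>. \<bar>x - fst p\<bar> \<le> R} \<times> {y \<in> \<int>. \<bar>y - snd p\<bar> \<le> R}"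
  by (auto simp: lattice_def square_def)

lemma card_lattice_square:
  assumes "R \<ge> 1/2"
  shows "finite (lattice \<inter> square p R)" "(2 * R - 1)\<^sup>2 \<le> real (card (lattice \<inter> square p R))"
    "real (card (lattice \<inter> square p R)) \<le> (2 * R + 1)\<^sup>2"
proof -
  note c = card_Ints_interval[OF assms]
  show "finite (lattice \<inter> square p R)" unfolding lattice_square by (intro finite_cartesian_product c)
  show "(2 * R - 1)\<^sup>2 \<le> real (card (lattice \<inter> square p R))"
    unfolding lattice_square card_cartesian_product of_nat_mult power2_eq_square
    using assms by (intro mult_mono c) auto
  show "real (card (lattice \<inter> square p R)) \<le> (2 * R + 1)\<^sup>2"
    unfolding lattice_square card_cartesian_product of_nat_mult power2_eq_square
    using assms by (intro mult_mono c) auto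
qed

lemma square_add:
  assumes "q \<in> square p R" shows "square q r \<subseteq> square p (R + r)"
proof
  fix z assume z: "z \<in> square q r"
  have "\<bar>fst z - fst p\<bar> \<le> R + r" "\<bar>snd z - snd p\<bar> \<le> R + r"
    using assms z unfolding square_def case_prod_unfold mem_Collect_eq by linarith+
  then show "z \<in> square p (R + r)" by (auto simp: square_def case_prod_unfold)
qed

text \<open>A set of indices, not of points: a point lying in several of the sets
  \<open>\<Lambda> n\<close> is counted once for each, as in \<open>count_in\<close>.\<close>

definition gabor_in :: "nat \<Rightarrow> (nat \<Rightarrow> (real \<times> real) set) \<Rightarrow> real \<times> real \<Rightarrow> real \<Rightarrow> (nat \<times> (real \<times> real)) set" where
  "gabor_in N \<Lambda> p R = {k \<in> gabor_index N \<Lambda>. snd k \<in> square p R}"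

lemma card_gabor_in:
  assumes "\<forall>n\<in>{1..N}. uniformly_discrete (\<Lambda> n)"
  shows "finite (gabor_in N \<Lambda> p R)" "real (card (gabor_in N \<Lambda> p R)) = count_in N \<Lambda> p R"
proof -
  have eq: "gabor_in N \<Lambda> p R = Sigma {1..N} (\<lambda>n. \<Lambda> n \<inter> square p R)"
    by (auto simp: gabor_in_def gabor_index_def)
  have fin: "\<forall>n\<in>{1..N}. finite (\<Lambda> n \<inter> square p R)"
    using ud_count_bound(2)[OF assms] by blast
  show "finite (gabor_in N \<Lambda> p R)" unfolding eq using fin by (intro finite_SigmaI) auto
  show "real (card (gabor_in N \<Lambda> p R)) = count_in N \<Lambda> p R"
    unfolding eq count_in_def using fin by (subst card_SigmaI) auto
qed

lemma sum_by_window: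
  assumes "finite F" "F \<subseteq> gabor_index N \<Lambda>"
  shows "sum f F = (\<Sum>n=1..N. \<Sum>l\<in>{l. (n, l) \<in> F}. f (n, l))"
proof -
  have fin: "finite {l. (n, l) \<in> F}" for n
    by (rule finite_subset[of _ "snd ` F"]) (use assms(1) in force)+
  have "F = Sigma {1..N} (\<lambda>n. {l. (n, l) \<in> F})"
    using assms(2) by (auto simp: gabor_index_def)
  then have "sum f F = sum f (Sigma {1..N} (\<lambda>n. {l. (n, l) \<in> F}))" by simp
  also have "\<dots> = (\<Sum>n=1..N. \<Sum>l\<in>{l. (n, l) \<in> F}. f (n, l))"
    by (subst sum.Sigma) (auto simp: fin)
  finally show ?thesis .
qed

text \<open>There are finitely many windows, so the largest radius serves all. The bound
  \<open>r \<ge> 1\<close> makes \<open>R + r\<close> large enough for the lattice count whenever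
  \<open>R > 0\<close>.\<close>

lemma uniform_radius:
  fixes P :: "nat \<Rightarrow> real \<Rightarrow> bool"
  assumes "\<And>n. n \<in> {1..N} \<Longrightarrow> \<exists>r. P n r" "\<And>n r s. P n r \<Longrightarrow> r \<le> s \<Longrightarrow> P n s"
  shows "\<exists>r\<ge>1. \<forall>n\<in>{1..N}. P n r"
proof -
  have "\<forall>n\<in>{1..N}. \<exists>r. P n r" using assms(1) by blast
  then obtain r where r: "\<forall>n\<in>{1..N}. P n (r n)" unfolding bchoice_iff by blast
  have "r n \<le> Max (insert 1 (r ` {1..N}))" if "n \<in> {1..N}" for n
    using that by (intro Max_ge) auto
  then have "\<forall>n\<in>{1..N}. P n (Max (insert 1 (r ` {1..N})))" using assms(2) r by blast
  moreover have "1 \<le> Max (insert 1 (r ` {1..N}))" by (intro Max_ge) auto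
  ultimately show ?thesis by blast
qed

text \<open>The Gabor elements in the square form the rows and the lattice basis the columns. The
  lower Riesz bound controls the norm of a combination, and completeness of the basis expresses that
  norm by columns.\<close>

lemma Riesz_sequence_count_le:
  assumes g: "\<forall>n\<in>{1..N}. g n \<in> L2" and ud: "\<forall>n\<in>{1..N}. uniformly_discrete (\<Lambda> n)"
    and riesz: "riesz_sequence (gabor_index N \<Lambda>) (gabor_family g)" and \<theta>: "\<theta> > 0"
  shows "\<exists>r\<ge>1. \<forall>p R. R > 0 \<longrightarrow> (1 - \<theta>) * count_in N \<Lambda> p R \<le> (2 * (R + r) + 1)\<^sup>2"
proof -
  obtain A where A: "A > 0" and lower: "\<And>F c. finite F \<Longrightarrow> F \<subseteq> gabor_index N \<Lambda> \<Longrightarrow>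
      A * (\<Sum>k\<in>F. (cmod (c k))\<^sup>2) \<le> L2_normsq (\<lambda>t. \<Sum>k\<in>F. c k * gabor_family g k t)"
    using riesz unfolding riesz_sequence_def by blast
  \<comment> \<open>The tolerance \<open>\<theta> * A\<close> makes \<open>A\<close> cancel from the
    comparison of dimensions, leaving \<open>1 - \<theta>\<close>.\<close>
  define P where "P = (\<lambda>n r. \<forall>z F. finite F \<longrightarrow> F \<subseteq> lattice - square z r \<longrightarrow>
    (\<Sum>l\<in>F. (cmod (L2_inner (tfs z (g n)) (tfs l unit_box)))\<^sup>2) \<le> \<theta> * A)"
  have "\<exists>r\<ge>1. \<forall>n\<in>{1..N}. P n r"
  proof (rule uniform_radius)
    show "\<exists>r. P n r" if n: "n \<in> {1..N}" for n
      unfolding P_def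
    proof (rule homogeneous_approximation_property[where B = 1 and \<delta> = "1/2"])
      show "g n \<in> L2" using g n by blast
    qed (use \<theta> A unit_box_L2 separated_lattice lattice_Bessel in auto)
    show "P n s" if "P n r" "r \<le> s" for n r s
      using that(1) square_mono[OF that(2)] unfolding P_def by (meson Diff_mono order_refl order_trans)
  qed
  then obtain r where r: "r \<ge> 1" "\<And>n. n \<in> {1..N} \<Longrightarrow> P n r" by blast
  have "(1 - \<theta>) * count_in N \<Lambda> p R \<le> (2 * (R + r) + 1)\<^sup>2" if R: "R > 0" for p R
  proof -
    let ?J = "gabor_in N \<Lambda> p R" and ?K0 = "lattice \<inter> square p (R + r)"
    have Rr: "R + r \<ge> 1/2" using R r(1) by simp
    have J: "?J \<subseteq> gabor_index N \<Lambda>" by (auto simp: gabor_in_def)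
    have f: "gabor_family g k \<in> L2" if "k \<in> ?J" for k
      using that J g unfolding gabor_family_def by (auto simp: gabor_index_def intro!: L2_tf)
    have "A * (real (card ?J) - real (card ?K0)) \<le> (\<theta> * A) * real (card ?J)"
    proof (rule dimension_comparison[where K = lattice and M = "\<lambda>j k. L2_inner (gabor_family g j) (tfs k unit_box)"])
      show "finite ?J" by (rule card_gabor_in[OF ud])
      show "finite ?K0" by (rule card_lattice_square[OF Rr])
    next
      fix c :: "nat \<times> real \<times> real \<Rightarrow> complex" and \<eta> :: real assume \<eta>: "\<eta> > 0"
      define h where "h = (\<lambda>t. \<Sum>j\<in>?J. c j * gabor_family g j t)"
      have h: "h \<in> L2" unfolding h_def by (intro L2_sum L2_scale f)
      have inner: "L2_inner h (tfs k unit_box) = (\<Sum>j\<in>?J. c j * L2_inner (gabor_family g j) (tfs k unit_box))" for k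
        unfolding h_def by (intro L2_inner_sum_left f L2_tf unit_box_L2)
      obtain F where F: "finite F" "F \<subseteq> lattice" "L2_normsq h - \<eta> \<le> (\<Sum>k\<in>F. (cmod (L2_inner h (tfs k unit_box)))\<^sup>2)"
        using lattice_Parseval_lower[OF h \<eta>] by blast
      moreover have "A * (\<Sum>j\<in>?J. (cmod (c j))\<^sup>2) \<le> L2_normsq h"
        unfolding h_def by (rule lower[OF card_gabor_in(1)[OF ud] J])
      ultimately show "\<exists>F. finite F \<and> F \<subseteq> lattice \<and> A * (\<Sum>j\<in>?J. (cmod (c j))\<^sup>2) - \<eta> \<le>
          (\<Sum>k\<in>F. (cmod (\<Sum>j\<in>?J. c j * L2_inner (gabor_family g j) (tfs k unit_box)))\<^sup>2)"
        unfolding inner by (intro exI[of _ F]) auto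
    next
      fix j F assume j: "j \<in> ?J" and F: "finite F" "F \<subseteq> lattice - ?K0"
      have n: "fst j \<in> {1..N}" and sq: "snd j \<in> square p R" using j by (auto simp: gabor_in_def gabor_index_def)
      \<comment> \<open>What lies outside radius \<open>R + r\<close> about \<open>p\<close> is at
        least \<open>r\<close> away, in the sense of squares, from every position in the square of
        radius \<open>R\<close>.\<close>
      have "F \<subseteq> lattice - square (snd j) r" using F square_add[OF sq, of r] by blast
      then show "(\<Sum>k\<in>F. (cmod (L2_inner (gabor_family g j) (tfs k unit_box)))\<^sup>2) \<le> \<theta> * A"
        using r(2)[OF n] F(1) unfolding P_def gabor_family_def by blast
    qed (rule A)
    then have "A * ((1 - \<theta>) * real (card ?J)) \<le> A * real (card ?K0)" by (simp add: algebra_simps)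
    then have "(1 - \<theta>) * real (card ?J) \<le> real (card ?K0)" using A by simp
    also have "\<dots> \<le> (2 * (R + r) + 1)\<^sup>2" by (rule card_lattice_square[OF Rr])
    finally show ?thesis unfolding card_gabor_in(2)[OF ud] .
  qed
  then show ?thesis using r(1) by blast
qed

text \<open>The roles are exchanged: finite combinations of the orthonormal lattice elements have
  norm equal to that of their coefficients, and the lower frame bound expresses this norm by Gabor
  columns.\<close>

lemma frame_count_ge:
  assumes g: "\<forall>n\<in>{1..N}. g n \<in> L2" and ud: "\<forall>n\<in>{1..N}. uniformly_discrete (\<Lambda> n)"
    and frame: "frame (gabor_index N \<Lambda>) (gabor_family g)" and \<theta>: "\<theta> > 0"
  shows "\<exists>r. \<forall>p R. R \<ge> 1/2 \<longrightarrow> (2 * R - 1)\<^sup>2 - \<theta> * (2 * R + 1)\<^sup>2 \<le> count_in N \<Lambda> p (R + r)"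
proof -
  let ?I = "gabor_index N \<Lambda>" and ?f = "gabor_family g"
  obtain A B where A: "A > 0" "B > 0" and fr: "\<And>h. h \<in> L2 \<Longrightarrow> (\<lambda>k. (cmod (L2_inner h (?f k)))\<^sup>2) summable_on ?I"
    "\<And>h. h \<in> L2 \<Longrightarrow> A * L2_normsq h \<le> (\<Sum>\<^sub>\<infinity>k\<in>?I. (cmod (L2_inner h (?f k)))\<^sup>2)"
    "\<And>h. h \<in> L2 \<Longrightarrow> (\<Sum>\<^sub>\<infinity>k\<in>?I. (cmod (L2_inner h (?f k)))\<^sup>2) \<le> B * L2_normsq h"
    using frame unfolding frame_def by blast
  obtain \<delta> where \<delta>: "\<delta> > 0" "\<forall>n\<in>{1..N}. separated \<delta> (\<Lambda> n)"
    using ud_separated[OF ud] by blast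
  \<comment> \<open>The tail splits into one sum per window, so each gets an \<open>N\<close>-th of
    the tolerance; \<open>N + 1\<close> avoids division by zero.\<close>
  define \<epsilon> where "\<epsilon> = \<theta> * A / (real N + 1)"
  have \<epsilon>: "\<epsilon> > 0" "real N * \<epsilon> \<le> \<theta> * A" using \<theta> A by (simp_all add: \<epsilon>_def field_simps)
  define P where "P = (\<lambda>n r. \<forall>z F. finite F \<longrightarrow> F \<subseteq> \<Lambda> n - square z r \<longrightarrow>
    (\<Sum>l\<in>F. (cmod (L2_inner (tfs z unit_box) (tfs l (g n))))\<^sup>2) \<le> \<epsilon>)"
  have "\<exists>r\<ge>1. \<forall>n\<in>{1..N}. P n r"
  proof (rule uniform_radius)
    fix n assume n: "n \<in> {1..N}"
    \<comment> \<open>The Bessel bound of a single window: its finite sums are partial sums of the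
      full frame sum.\<close>
    have "(\<Sum>l\<in>F. (cmod (L2_inner u (tfs l (g n))))\<^sup>2) \<le> B * L2_normsq u"
      if F: "finite F" "F \<subseteq> \<Lambda> n" and u: "u \<in> L2" for F u
    proof -
      have "(\<Sum>l\<in>F. (cmod (L2_inner u (tfs l (g n))))\<^sup>2) = (\<Sum>k\<in>Pair n ` F. (cmod (L2_inner u (?f k)))\<^sup>2)"
        by (subst sum.reindex) (auto simp: inj_on_def gabor_family_def)
      also have "\<dots> \<le> (\<Sum>\<^sub>\<infinity>k\<in>?I. (cmod (L2_inner u (?f k)))\<^sup>2)"
        by (rule finite_sum_le_infsum[OF fr(1)[OF u]]) (use F n in \<open>auto simp: gabor_index_def\<close>)
      finally show ?thesis using fr(3)[OF u] by linarith
    qed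
    then show "\<exists>r. P n r"
      unfolding P_def using \<delta> g n A(2) \<epsilon>(1) unit_box_L2
      by (intro homogeneous_approximation_property[where B = B and \<delta> = \<delta>]) auto
  next
    show "P n s" if "P n r" "r \<le> s" for n r s
      using that(1) square_mono[OF that(2)] unfolding P_def by (meson Diff_mono order_refl order_trans)
  qed
  then obtain r where r: "r \<ge> 1" "\<And>n. n \<in> {1..N} \<Longrightarrow> P n r" by blast
  have "(2 * R - 1)\<^sup>2 - \<theta> * (2 * R + 1)\<^sup>2 \<le> count_in N \<Lambda> p (R + r)" if R: "R \<ge> 1/2" for p R
  proof -
    let ?J = "lattice \<inter> square p R" and ?K0 = "gabor_in N \<Lambda> p (R + r)"
    note J = card_lattice_square[OF R, of p]
    have "A * (real (card ?J) - real (card ?K0)) \<le> (\<theta> * A) * real (card ?J)"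
    proof (rule dimension_comparison[where K = ?I and M = "\<lambda>j k. L2_inner (tfs j unit_box) (?f k)"])
      show "finite ?J" by (rule J)
      show "finite ?K0" by (rule card_gabor_in[OF ud])
    next
      fix c :: "real \<times> real \<Rightarrow> complex" and \<eta> :: real assume \<eta>: "\<eta> > 0"
      define h where "h = (\<lambda>t. \<Sum>j\<in>?J. c j * tfs j unit_box t)"
      have h: "h \<in> L2" unfolding h_def by (intro L2_sum L2_scale L2_tf unit_box_L2)
      have inner: "L2_inner h (?f k) = (\<Sum>j\<in>?J. c j * L2_inner (tfs j unit_box) (?f k))" if "k \<in> ?I" for k
        unfolding h_def
      proof (intro L2_inner_sum_left L2_tf unit_box_L2)
        show "?f k \<in> L2" using that g unfolding gabor_family_def by (auto simp: gabor_index_def intro!: L2_tf)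
      qed
      \<comment> \<open>The frame inequality concerns an infinite sum; truncation to a finite set
        costs \<open>\<eta>\<close>, which \<open>dimension_comparison\<close> allows.\<close>
      obtain F where F: "finite F" "F \<subseteq> ?I"
        "dist (\<Sum>k\<in>F. (cmod (L2_inner h (?f k)))\<^sup>2) (\<Sum>\<^sub>\<infinity>k\<in>?I. (cmod (L2_inner h (?f k)))\<^sup>2) \<le> \<eta>"
        using infsum_finite_approximation[OF fr(1)[OF h] \<eta>] by blast
      have "A * (\<Sum>j\<in>?J. (cmod (c j))\<^sup>2) - \<eta> = A * L2_normsq h - \<eta>"
        unfolding h_def by (subst lattice_norm[OF J(1)]) auto
      also have "\<dots> \<le> (\<Sum>k\<in>F. (cmod (L2_inner h (?f k)))\<^sup>2)"
        using fr(2)[OF h] F(3) unfolding dist_real_def by linarith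
      also have "\<dots> = (\<Sum>k\<in>F. (cmod (\<Sum>j\<in>?J. c j * L2_inner (tfs j unit_box) (?f k)))\<^sup>2)"
        by (intro sum.cong refl) (simp only: inner[OF subsetD[OF F(2)]])
      finally show "\<exists>F. finite F \<and> F \<subseteq> ?I \<and> A * (\<Sum>j\<in>?J. (cmod (c j))\<^sup>2) - \<eta> \<le>
          (\<Sum>k\<in>F. (cmod (\<Sum>j\<in>?J. c j * L2_inner (tfs j unit_box) (?f k)))\<^sup>2)"
        using F(1,2) by blast
    next
      fix j F assume j: "j \<in> ?J" and F: "finite F" "F \<subseteq> ?I - ?K0"
      have sq: "square j r \<subseteq> square p (R + r)" using j square_add by blast
      have "(\<Sum>k\<in>F. (cmod (L2_inner (tfs j unit_box) (?f k)))\<^sup>2) =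
          (\<Sum>n=1..N. \<Sum>l\<in>{l. (n, l) \<in> F}. (cmod (L2_inner (tfs j unit_box) (?f (n, l))))\<^sup>2)"
        using F by (intro sum_by_window) auto
      also have "\<dots> \<le> (\<Sum>n=1..N. \<epsilon>)"
      proof (rule sum_mono)
        fix n assume n: "n \<in> {1..N}"
        have "finite {l. (n, l) \<in> F}" by (rule finite_subset[of _ "snd ` F"]) (use F(1) in force)+
        moreover have "{l. (n, l) \<in> F} \<subseteq> \<Lambda> n - square j r"
        proof
          fix l assume "l \<in> {l. (n, l) \<in> F}"
          then have "(n, l) \<in> ?I" "(n, l) \<notin> ?K0" using F(2) by blast+
          then show "l \<in> \<Lambda> n - square j r"
            using subsetD[OF sq, of l] by (auto simp: gabor_in_def gabor_index_def)
        qed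
        ultimately show "(\<Sum>l\<in>{l. (n, l) \<in> F}. (cmod (L2_inner (tfs j unit_box) (?f (n, l))))\<^sup>2) \<le> \<epsilon>"
          using r(2)[OF n] unfolding P_def gabor_family_def fst_conv snd_conv by blast
      qed
      also have "\<dots> \<le> \<theta> * A" using \<epsilon>(2) by simp
      finally show "(\<Sum>k\<in>F. (cmod (L2_inner (tfs j unit_box) (?f k)))\<^sup>2) \<le> \<theta> * A" .
    qed (rule A)
    then have "A * (real (card ?J) - \<theta> * real (card ?J)) \<le> A * real (card ?K0)" by (simp add: algebra_simps)
    then have "real (card ?J) - \<theta> * real (card ?J) \<le> real (card ?K0)" using A by simp
    moreover have "\<theta> * real (card ?J) \<le> \<theta> * (2 * R + 1)\<^sup>2" using J(3) \<theta> by (intro mult_left_mono) auto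
    ultimately show ?thesis using J(2) unfolding card_gabor_in(2)[OF ud] by linarith
  qed
  then show ?thesis by blast
qed

theorem theoremA:
  fixes N :: nat and g :: "nat \<Rightarrow> real \<Rightarrow> complex" and \<Lambda> :: "nat \<Rightarrow> (real \<times> real) set"
  assumes L2: "\<And>n. n \<in> {1..N} \<Longrightarrow> g n \<in> L2"
    and distinct: "\<And>n m. n \<in> {1..N} \<Longrightarrow> m \<in> {1..N} \<Longrightarrow> n \<noteq> m \<Longrightarrow>
                     \<not> (AE t in lborel. g n t = g m t)"
    and ud: "\<And>n. n \<in> {1..N} \<Longrightarrow> uniformly_discrete (\<Lambda> n)"
  shows "(riesz_sequence (gabor_index N \<Lambda>) (gabor_family g) \<longrightarrow> upper_density N \<Lambda> \<le> 1)
       \<and> (frame (gabor_index N \<Lambda>) (gabor_family g) \<longrightarrow> lower_density N \<Lambda> \<ge> 1)"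
proof -
  have g: "\<forall>n\<in>{1..N}. g n \<in> L2" and ud': "\<forall>n\<in>{1..N}. uniformly_discrete (\<Lambda> n)"
    using L2 ud by blast+
  show ?thesis
  proof (intro conjI impI)
    assume riesz: "riesz_sequence (gabor_index N \<Lambda>) (gabor_family g)"
    have D: "(1 - \<theta>) * upper_density N \<Lambda> \<le> 1" if \<theta>: "0 < \<theta>" "\<theta> < 1" for \<theta>
    proof -
      obtain r where r: "\<And>p R. R > 0 \<Longrightarrow> (1 - \<theta>) * count_in N \<Lambda> p R \<le> (2 * (R + r) + 1)\<^sup>2"
        using Riesz_sequence_count_le[OF g ud' riesz \<theta>(1)] by blast
      show ?thesis
        by (rule upper_density_le[OF ud', of _ "2 * r + 1"]) (use \<theta> r in \<open>auto simp: algebra_simps\<close>)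
    qed
    show "upper_density N \<Lambda> \<le> 1"
    proof (rule ccontr)
      assume "\<not> upper_density N \<Lambda> \<le> 1"
      then have D1: "upper_density N \<Lambda> > 1" by simp
      \<comment> \<open>Chosen so that \<open>1 - \<theta>\<close> times the density is the midpoint
        between 1 and the density, still above 1.\<close>
      define \<theta> where "\<theta> = (1 - 1 / upper_density N \<Lambda>) / 2"
      have "0 < \<theta>" "\<theta> < 1" using D1 by (auto simp: \<theta>_def field_simps)
      moreover have "(1 - \<theta>) * upper_density N \<Lambda> = (upper_density N \<Lambda> + 1) / 2"
        using D1 by (simp add: \<theta>_def field_simps)
      ultimately show False using D[of \<theta>] D1 by simp
    qed
  next
    assume frame: "frame (gabor_index N \<Lambda>) (gabor_family g)"
    show "1 \<le> lower_density N \<Lambda>"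
    proof (rule field_le_epsilon)
      fix \<theta> :: real assume "\<theta> > 0"
      then obtain r where r: "\<And>p R. R \<ge> 1/2 \<Longrightarrow> (2 * R - 1)\<^sup>2 - \<theta> * (2 * R + 1)\<^sup>2 \<le> count_in N \<Lambda> p (R + r)"
        using frame_count_ge[OF g ud' frame] by blast
      \<comment> \<open>The count was bounded on the enlarged square. With \<open>R - r\<close> in
        place of \<open>R\<close> the square has radius \<open>R\<close>, and \<open>r\<close> moves
        into the lower-order terms.\<close>
      have "1 - \<theta> \<le> lower_density N \<Lambda>"
      proof (rule lower_density_ge[OF ud', of "r + 1/2" "2 * r + 1" \<theta> "1 - 2 * r"])
        fix p :: "real \<times> real" and R assume "R > r + 1/2"
        then show "(2 * R - (2 * r + 1))\<^sup>2 - \<theta> * (2 * R + (1 - 2 * r))\<^sup>2 \<le> count_in N \<Lambda> p R"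
          using r[of "R - r" p] by (simp add: algebra_simps)
      qed
      then show "1 \<le> lower_density N \<Lambda> + \<theta>" by simp
    qed
  qed
qed

end
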